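(* Let $n\ge3$ and let $\mathbb{F}$ be a field of characteristic zero. Irreducible representations of the $n$-Lie algebra $S^n$ are in one-to-one correspondence with irreducible representations of the universal enveloping algebra $U(S_n)$ on which the two-sided ideal $Q(S^n)$, generated by the elements $$x_{f_1,\dots,f_{2n-2}}=\mathrm{ad}([f_1,\dots,f_n]\wedge f_{n+1}\wedge\dots\wedge f_{2n-2})-\sum_{i=1}^n(-1)^{i+n}\,\mathrm{ad}(f_1\wedge\dots\wedge\widehat{f_i}\wedge\dots\wedge f_n)\,\mathrm{ad}(f_i\wedge f_{n+1}\wedge\dots\wedge f_{2n-2}),$$ where $f_i\in\mathbb{F}[[x_1,\dots,x_n]]$ and $f_i\ne1$ for all $i=1,\dots,n$, acts trivially. (The hat means that the entry is omitted.)
   Context: An $n$-Lie algebra is a vector space $V$ over $\mathbb{F}$ with an $n$-linear alternating bracket $\wedge^nV\to V$ satisfying $[a_1,\dots,a_{n-1},[b_1,\dots,b_n]]=\sum_{i=1}^n[b_1,\dots,[a_1,\dots,a_{n-1},b_i],\dots,b_n]$. A representation of $V$ is an $n$-Lie module: a vector space $M$ such that $V\oplus M$ carries an $n$-Lie algebra structure for which $V$ is a subalgebra (with its own bracket) and $M$ is an abelian ideal, i.e. an ideal such that the bracket vanishes when at least two entries lie in $M$. $S^n$ is the $n$-Lie algebra $\mathbb{F}[[x_1,\dots,x_n]]$ with bracket $[f_1,\dots,f_n]=\det(D_i(f_j))_{1\le i,j\le n}$, $D_i=\partial/\partial x_i$. $S_n$ is the Lie algebra of derivations $\sum_{i=1}^nf_iD_i$,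 $f_i\in\mathbb{F}[[x_1,\dots,x_n]]$, with $\sum_iD_i(f_i)=0$. For $f_1,\dots,f_{n-1}\in S^n$, $\mathrm{ad}(f_1\wedge\dots\wedge f_{n-1})$ is the inner derivation $f\mapsto[f_1,\dots,f_{n-1},f]$ of $S^n$; it equals the element $\sum_{i=1}^n(-1)^{n+i}\det\big(D_r(f_s)\big)_{r\ne i,\,1\le s\le n-1}\,D_i$ of $S_n$, and this identifies the Lie algebra of inner derivations of $S^n$ with $S_n$. Products of elements $\mathrm{ad}(\cdot)$ are taken in $U(S_n)$. *)

theory Defs
  imports
    "Jordan_Normal_Form.Determinant"
    "HOL-Algebra.QuotRing"
    "HOL-Library.Poly_Mapping"
    "HOL-Library.Function_Algebras"
    "HOL-Library.Product_Plus"
    "HOL-Library.FuncSet"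
begin

section \<open>Multivariate formal power series\<close>

text \<open>
  Series in the variables \<open>x\<^sub>0, x\<^sub>1, \<dots>\<close>: arbitrary coefficient families on the finitely supported
  exponent vectors.  The ring of series in exactly \<open>n\<close> variables is the subring \<open>mfps_in n\<close> of those
  that involve only \<open>x\<^sub>0, \<dots>, x\<^sub>n\<^sub>-\<^sub>1\<close>.
\<close>

typedef 'a mfps = "UNIV :: ((nat \<Rightarrow>\<^sub>0 nat) \<Rightarrow> 'a) set"
  morphisms mcoeff Abs_mfps ..

setup_lifting type_definition_mfps

lemma mfps_eqI: "(\<And>m. mcoeff f m = mcoeff g m) \<Longrightarrow> f = g"
  by transfer auto

text \<open>The ways of writing a monomial as a product of two (resp. three) monomials.\<close>

definition splits :: "(nat \<Rightarrow>\<^sub>0 nat) \<Rightarrow> ((nat \<Rightarrow>\<^sub>0 nat) \<times> (nat \<Rightarrow>\<^sub>0 nat)) set"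
  where "splits m = {(a, b). a + b = m}"

lemma finite_splits [simp]: "finite (splits m)"
proof -
  have fin: "finite {a :: nat \<Rightarrow>\<^sub>0 nat. \<exists>b. a + b = m}"
  proof (rule finite_imageD)
    let ?F = "{f. \<forall>i. (i \<in> Poly_Mapping.keys m \<longrightarrow> f i \<in> {..Max (insert 0 (Poly_Mapping.lookup m ` Poly_Mapping.keys m))})
        \<and> (i \<notin> Poly_Mapping.keys m \<longrightarrow> f i = (0::nat))}"
    have "finite ?F"
      by (rule finite_set_of_finite_funs) auto
    moreover have "Poly_Mapping.lookup ` {a. \<exists>b. a + b = m} \<subseteq> ?F"
    proof (clarsimp simp: lookup_add, intro conjI impI)
      fix a b :: "nat \<Rightarrow>\<^sub>0 nat" and i
      assume i: "i \<in> Poly_Mapping.keys (a + b)" and m: "m = a + b"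
      let ?g = "\<lambda>i. Poly_Mapping.lookup a i + Poly_Mapping.lookup b i"
      have "?g i \<le> Max (insert 0 (?g ` Poly_Mapping.keys (a + b)))"
        using i by (intro Max_ge) auto
      then show "Poly_Mapping.lookup a i \<le> Max (insert 0 (?g ` Poly_Mapping.keys (a + b)))"
        by linarith
    next
      fix a b :: "nat \<Rightarrow>\<^sub>0 nat" and i
      assume "i \<notin> Poly_Mapping.keys (a + b)"
      then show "Poly_Mapping.lookup a i = 0"
        by (simp add: in_keys_iff lookup_add)
    qed
    ultimately show "finite (Poly_Mapping.lookup ` {a. \<exists>b. a + b = m})"
      using finite_subset by blast
    show "inj_on Poly_Mapping.lookup {a. \<exists>b. a + b = m}"
      by (auto intro!: inj_onI poly_mapping_eqI)
  qed
  have "splits m \<subseteq> {a. \<exists>b. a + b = m} \<times> {a. \<exists>b. a + b = m}"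
    by (auto simp: splits_def) (metis add.commute)
  then show ?thesis
    by (rule finite_subset) (use fin in auto)
qed

lemma mem_splits: "(a, b) \<in> splits m \<longleftrightarrow> a + b = m"
  by (simp add: splits_def)

instantiation mfps :: (comm_ring_1) comm_ring_1
begin

lift_definition zero_mfps :: "'a mfps" is "\<lambda>_. 0" .
lift_definition one_mfps :: "'a mfps" is "\<lambda>m. if m = 0 then 1 else 0" .
lift_definition plus_mfps :: "'a mfps \<Rightarrow> 'a mfps \<Rightarrow> 'a mfps" is "\<lambda>f g m. f m + g m" .
lift_definition minus_mfps :: "'a mfps \<Rightarrow> 'a mfps \<Rightarrow> 'a mfps" is "\<lambda>f g m. f m - g m" .
lift_definition uminus_mfps :: "'a mfps \<Rightarrow> 'a mfps" is "\<lambda>f m. - f m" .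
lift_definition times_mfps :: "'a mfps \<Rightarrow> 'a mfps \<Rightarrow> 'a mfps"
  is "\<lambda>f g m. \<Sum>(a, b)\<in>splits m. f a * g b" .

instance
proof
  fix f g h :: "'a mfps"
  show "f + g + h = f + (g + h)" by transfer (simp add: fun_eq_iff add.assoc)
  show "f + g = g + f" by transfer (simp add: fun_eq_iff add.commute)
  show "0 + f = f" by transfer simp
  show "- f + f = 0" by transfer simp
  show "f - g = f + - g" by transfer simp
  show "(0::'a mfps) \<noteq> 1" by transfer (auto simp: fun_eq_iff)
  show "(f + g) * h = f * h + g * h"
    by transfer (simp add: fun_eq_iff case_prod_unfold distrib_right sum.distrib)
  show "f * g = g * f"
  proof (transfer, rule ext)
    fix f g :: "(nat \<Rightarrow>\<^sub>0 nat) \<Rightarrow> 'a" and m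
    show "(\<Sum>(a, b)\<in>splits m. f a * g b) = (\<Sum>(a, b)\<in>splits m. g a * f b)"
      by (rule sum.reindex_bij_witness[of _ prod.swap prod.swap])
        (auto simp: mem_splits add.commute mult.commute)
  qed
  show "1 * f = f"
  proof (transfer, rule ext)
    fix f :: "(nat \<Rightarrow>\<^sub>0 nat) \<Rightarrow> 'a" and m
    have "(\<Sum>(a, b)\<in>splits m. (if a = 0 then 1 else 0) * f b) = (\<Sum>(a, b)\<in>{(0 :: nat \<Rightarrow>\<^sub>0 nat, m)}. f b)"
      by (rule sum.mono_neutral_cong_right) (auto simp: mem_splits split: if_splits)
    then show "(\<Sum>(a, b)\<in>splits m. (if a = 0 then 1 else 0) * f b) = f m" by simp
  qed
  show "f * g * h = f * (g * h)"
  proof (transfer, rule ext)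
    fix f g h :: "(nat \<Rightarrow>\<^sub>0 nat) \<Rightarrow> 'a" and m
    have "(\<Sum>(a, b)\<in>splits m. (\<Sum>(c, d)\<in>splits a. f c * g d) * h b)
        = (\<Sum>(p, q)\<in>(SIGMA p:splits m. splits (fst p)). f (fst q) * g (snd q) * h (snd p))"
      by (simp add: case_prod_unfold sum_distrib_right sum.Sigma)
    also have "\<dots> = (\<Sum>(p, q)\<in>(SIGMA p:splits m. splits (snd p)). f (fst p) * (g (fst q) * h (snd q)))"
      by (rule sum.reindex_bij_witness[of _
            "\<lambda>(p, q). ((fst p + fst q, snd q), (fst p, fst q))"
            "\<lambda>(p, q). ((fst q, snd q + snd p), (snd q, snd p))"])
        (auto simp: mem_splits add.assoc mult.assoc)
    also have "\<dots> = (\<Sum>(a, b)\<in>splits m. f a * (\<Sum>(c, d)\<in>splits b. g c * h d))"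
      by (simp add: case_prod_unfold sum_distrib_left sum.Sigma)
    finally show "(\<Sum>(a, b)\<in>splits m. (\<Sum>(c, d)\<in>splits a. f c * g d) * h b)
        = (\<Sum>(a, b)\<in>splits m. f a * (\<Sum>(c, d)\<in>splits b. g c * h d))" .
  qed
qed

end

lift_definition mfps_scale :: "'a::comm_ring_1 \<Rightarrow> 'a mfps \<Rightarrow> 'a mfps" is "\<lambda>c f m. c * f m" .

lemma vector_space_mfps_scale: "vector_space (mfps_scale :: 'a::field \<Rightarrow> 'a mfps \<Rightarrow> 'a mfps)"
  by unfold_locales (transfer, simp add: fun_eq_iff algebra_simps)+

definition mfps_in :: "nat \<Rightarrow> 'a::zero mfps set"
  where "mfps_in n = {f. \<forall>m. mcoeff f m \<noteq> 0 \<longrightarrow> Poly_Mapping.keys m \<subseteq> {..<n}}"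

lift_definition pderiv_at :: "nat \<Rightarrow> 'a::comm_ring_1 mfps \<Rightarrow> 'a mfps"
  is "\<lambda>i f m. of_nat (Poly_Mapping.lookup m i + 1) * f (m + Poly_Mapping.single i 1)" .


section \<open>n-Lie algebras and their modules\<close>

text \<open>
  An \<open>n\<close>-ary bracket takes a list of length \<open>n\<close>.  The underlying space is a subspace \<open>V\<close> of an ambient
  vector space, and only the values of the bracket on \<open>tuples n V\<close> matter.
\<close>

definition tuples :: "nat \<Rightarrow> 'v set \<Rightarrow> 'v list set"
  where "tuples n V = {xs. length xs = n \<and> set xs \<subseteq> V}"

locale n_Lie_algebra = vector_space scale
  for scale :: "'a::field \<Rightarrow> 'v::ab_group_add \<Rightarrow> 'v" +
  fixes n :: nat and V :: "'v set" and br :: "'v list \<Rightarrow> 'v"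
  assumes subspace_V: "subspace V"
    and br_closed: "xs \<in> tuples n V \<Longrightarrow> br xs \<in> V"
    and br_add: "\<lbrakk>xs \<in> tuples n V; i < n; u \<in> V; v \<in> V\<rbrakk>
      \<Longrightarrow> br (xs[i := u + v]) = br (xs[i := u]) + br (xs[i := v])"
    and br_scale: "\<lbrakk>xs \<in> tuples n V; i < n; v \<in> V\<rbrakk>
      \<Longrightarrow> br (xs[i := scale c v]) = scale c (br (xs[i := v]))"
    and br_alternating: "\<lbrakk>xs \<in> tuples n V; i < j; j < n; xs ! i = xs ! j\<rbrakk> \<Longrightarrow> br xs = 0"
    and fundamental_identity: "\<lbrakk>as \<in> tuples (n - 1) V; bs \<in> tuples n V\<rbrakk>
      \<Longrightarrow> br (as @ [br bs]) = (\<Sum>i<n. br (bs[i := br (as @ [bs ! i])]))"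

definition scale_pair :: "('a \<Rightarrow> 'v \<Rightarrow> 'v) \<Rightarrow> ('a \<Rightarrow> 'm \<Rightarrow> 'm) \<Rightarrow> 'a \<Rightarrow> 'v \<times> 'm \<Rightarrow> 'v \<times> 'm"
  where "scale_pair s t c p = (s c (fst p), t c (snd p))"

text \<open>
  The module \<open>M\<close> is the whole type \<open>'m\<close>, and \<open>B\<close> is the bracket on \<open>V \<oplus> M = V \<times> UNIV\<close>.  The two ideal
  conditions say that \<open>M = {0} \<times> UNIV\<close> is an abelian ideal.
\<close>

locale n_Lie_module =
  sum: n_Lie_algebra "scale_pair scaleV scaleM" n "V \<times> UNIV" B +
  M: vector_space scaleM
  for scaleV :: "'a::field \<Rightarrow> 'v::ab_group_add \<Rightarrow> 'v" and n :: nat and V :: "'v set"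
    and br :: "'v list \<Rightarrow> 'v"
    and scaleM :: "'a \<Rightarrow> 'm::ab_group_add \<Rightarrow> 'm" and B :: "('v \<times> 'm) list \<Rightarrow> 'v \<times> 'm" +
  assumes subalgebra: "vs \<in> tuples n V \<Longrightarrow> B (map (\<lambda>v. (v, 0)) vs) = (br vs, 0)"
    and ideal: "\<lbrakk>xs \<in> tuples n (V \<times> UNIV); i < n; fst (xs ! i) = 0\<rbrakk> \<Longrightarrow> fst (B xs) = 0"
    and abelian: "\<lbrakk>xs \<in> tuples n (V \<times> UNIV); i < j; j < n; fst (xs ! i) = 0; fst (xs ! j) = 0\<rbrakk>
      \<Longrightarrow> B xs = 0"

text \<open>\<open>module_act B [v\<^sub>1, \<dots>, v\<^sub>n\<^sub>-\<^sub>1] m\<close> is \<open>[v\<^sub>1, \<dots>, v\<^sub>n\<^sub>-\<^sub>1, m]\<close>.\<close>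

definition module_act :: "(('v \<times> 'm) list \<Rightarrow> 'v \<times> 'm) \<Rightarrow> 'v::zero list \<Rightarrow> 'm::zero \<Rightarrow> 'm"
  where "module_act B vs m = snd (B (map (\<lambda>v. (v, 0)) vs @ [(0, m)]))"

definition irreducible_under :: "('a::field \<Rightarrow> 'm::ab_group_add \<Rightarrow> 'm) \<Rightarrow> ('m \<Rightarrow> 'm) set \<Rightarrow> bool"
  where "irreducible_under scaleM T \<longleftrightarrow> (UNIV :: 'm set) \<noteq> {0} \<and>
    (\<forall>N. module.subspace scaleM N \<and> (\<forall>t\<in>T. \<forall>m\<in>N. t m \<in> N) \<longrightarrow> N = {0} \<or> N = UNIV)"

text \<open>
  The irreducible module structures on a fixed vector space.  Extensionality fixes the irrelevant
  values of the bracket, so that a structure is a unique element of this set.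
\<close>

definition n_Lie_irreps :: "('a::field \<Rightarrow> 'v::ab_group_add \<Rightarrow> 'v) \<Rightarrow> nat \<Rightarrow> 'v set \<Rightarrow> ('v list \<Rightarrow> 'v)
    \<Rightarrow> ('a \<Rightarrow> 'm::ab_group_add \<Rightarrow> 'm) \<Rightarrow> (('v \<times> 'm) list \<Rightarrow> 'v \<times> 'm) set"
  where "n_Lie_irreps scaleV n V br scaleM =
    {B \<in> extensional (tuples n (V \<times> UNIV)).
       n_Lie_module scaleV n V br scaleM B \<and>
       irreducible_under scaleM (module_act B ` tuples (n - 1) V)}"

definition n_Lie_module_iso :: "('a::field \<Rightarrow> 'm::ab_group_add \<Rightarrow> 'm) \<Rightarrow> nat \<Rightarrow> 'v::zero set
    \<Rightarrow> (('v \<times> 'm) list \<Rightarrow> 'v \<times> 'm) \<Rightarrow> (('v \<times> 'm) list \<Rightarrow> 'v \<times> 'm) \<Rightarrow> bool"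
  where "n_Lie_module_iso scaleM n V B B' \<longleftrightarrow>
    (\<exists>T. Vector_Spaces.linear scaleM scaleM T \<and> bij T \<and>
       (\<forall>vs\<in>tuples (n - 1) V. \<forall>m. T (module_act B vs m) = module_act B' vs (T m)))"


section \<open>Universal enveloping algebras\<close>

text \<open>
  The free associative algebra on the set \<open>L\<close>: finitely supported functions on the words over \<open>L\<close>,
  multiplied by concatenation of words.
\<close>

definition free_algebra :: "'l set \<Rightarrow> ('l list \<Rightarrow> 'a::comm_ring_1) ring"
  where "free_algebra L =
    \<lparr>carrier = {p. finite {w. p w \<noteq> 0} \<and> (\<forall>w. p w \<noteq> 0 \<longrightarrow> set w \<subseteq> L)},
     mult = (\<lambda>p q w. \<Sum>k\<le>length w. p (take k w) * q (drop k w)),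
     one = (\<lambda>w. if w = [] then 1 else 0),
     zero = (\<lambda>w. 0),
     add = (\<lambda>p q w. p w + q w)\<rparr>"

definition free_gen :: "'l \<Rightarrow> 'l list \<Rightarrow> 'a::comm_ring_1"
  where "free_gen x = (\<lambda>w. if w = [x] then 1 else 0)"

definition free_const :: "'a::comm_ring_1 \<Rightarrow> 'l list \<Rightarrow> 'a"
  where "free_const c = (\<lambda>w. if w = [] then c else 0)"

lemma free_algebra_conv_assoc: fixes p q r :: "'l list \<Rightarrow> 'a::comm_ring_1"
  shows "(\<Sum>k\<le>length w. (\<Sum>j\<le>length (take k w). p (take j (take k w)) * q (drop j (take k w))) * r (drop k w))
   = (\<Sum>k\<le>length w. p (take k w) * (\<Sum>j\<le>length (drop k w). q (take j (drop k w)) * r (drop j (drop k w))))"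
proof -
  have "(\<Sum>k\<le>length w. (\<Sum>j\<le>length (take k w). p (take j (take k w)) * q (drop j (take k w))) * r (drop k w))
    = (\<Sum>(k,j)\<in>(SIGMA k:{..length w}. {..k}). p (take j w) * q (drop j (take k w)) * r (drop k w))"
    by (auto simp: sum_distrib_right sum.Sigma[symmetric] min_def intro!: sum.cong)
  also have "\<dots> = (\<Sum>(k,j)\<in>(SIGMA k:{..length w}. {..length w - k}). p (take k w) * (q (take j (drop k w)) * r (drop j (drop k w))))"
    by (rule sum.reindex_bij_witness[of _ "\<lambda>(k,j). (k + j, k)" "\<lambda>(k,j). (j, k - j)"])
       (auto simp: drop_take add.commute mult.assoc)
  also have "\<dots> = (\<Sum>k\<le>length w. p (take k w) * (\<Sum>j\<le>length (drop k w). q (take j (drop k w)) * r (drop j (drop k w))))"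
    by (simp add: sum_distrib_left sum.Sigma[symmetric])
  finally show ?thesis .
qed
lemma free_algebra_mult_closed:
  fixes p q :: "'l list \<Rightarrow> 'a::comm_ring_1"
  assumes "p \<in> carrier (free_algebra L)" "q \<in> carrier (free_algebra L)"
  shows "p \<otimes>\<^bsub>free_algebra L\<^esub> q \<in> carrier (free_algebra L)"
proof -
  let ?r = "\<lambda>w. \<Sum>k\<le>length w. p (take k w) * q (drop k w)"
  have nz: "\<exists>u v. w = u @ v \<and> p u \<noteq> 0 \<and> q v \<noteq> 0" if "?r w \<noteq> 0" for w
  proof -
    obtain k where "p (take k w) * q (drop k w) \<noteq> 0"
      using \<open>?r w \<noteq> 0\<close> by (meson sum.neutral)
    then show ?thesis by (intro exI[of _ "take k w"] exI[of _ "drop k w"]) auto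
  qed
  have "{w. ?r w \<noteq> 0} \<subseteq> (\<lambda>(u, v). u @ v) ` ({u. p u \<noteq> 0} \<times> {v. q v \<noteq> 0})"
    using nz by fastforce
  then have "finite {w. ?r w \<noteq> 0}"
    by (rule finite_subset) (use assms in \<open>auto simp: free_algebra_def\<close>)
  moreover have "set w \<subseteq> L" if "?r w \<noteq> 0" for w
    using nz[OF that] assms by (fastforce simp: free_algebra_def)
  ultimately show ?thesis by (simp add: free_algebra_def)
qed

lemma ring_free_algebra: "ring (free_algebra L :: ('l list \<Rightarrow> 'a::comm_ring_1) ring)"
proof (rule ringI)
  show "abelian_group (free_algebra L :: ('l list \<Rightarrow> 'a) ring)"
  proof (rule abelian_groupI)
    fix p q :: "'l list \<Rightarrow> 'a"
    assume "p \<in> carrier (free_algebra L)" "q \<in> carrier (free_algebra L)"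
    moreover have "{w. p w + q w \<noteq> 0} \<subseteq> {w. p w \<noteq> 0} \<union> {w. q w \<noteq> 0}" by auto
    ultimately show "p \<oplus>\<^bsub>free_algebra L\<^esub> q \<in> carrier (free_algebra L)"
      by (auto simp: free_algebra_def intro: finite_subset)
  next
    fix p :: "'l list \<Rightarrow> 'a"
    assume "p \<in> carrier (free_algebra L)"
    then show "\<exists>q\<in>carrier (free_algebra L). q \<oplus>\<^bsub>free_algebra L\<^esub> p = \<zero>\<^bsub>free_algebra L\<^esub>"
      by (intro bexI[of _ "\<lambda>w. - p w"]) (auto simp: free_algebra_def)
  qed (auto simp: free_algebra_def fun_eq_iff algebra_simps)
  have one: "(\<Sum>k\<le>length w. (if take k w = [] then 1 else 0) * p (drop k w)) = p w" 
    for p :: "'l list \<Rightarrow> 'a" and w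
  proof -
    have "(\<Sum>k\<le>length w. (if take k w = [] then 1 else 0) * p (drop k w)) = (\<Sum>k\<in>{0}. p (drop k w))"
      by (rule sum.mono_neutral_cong_right) (auto split: if_splits)
    then show ?thesis by simp
  qed
  have one': "(\<Sum>k\<le>length w. p (take k w) * (if drop k w = [] then 1 else 0)) = p w" 
    for p :: "'l list \<Rightarrow> 'a" and w
  proof -
    have "(\<Sum>k\<le>length w. p (take k w) * (if drop k w = [] then 1 else 0)) = (\<Sum>k\<in>{length w}. p (take k w))"
      by (rule sum.mono_neutral_cong_right) (auto split: if_splits)
    then show ?thesis by simp
  qed
  show "Group.monoid (free_algebra L :: ('l list \<Rightarrow> 'a) ring)"
  proof (rule monoidI)
    fix p q r :: "'l list \<Rightarrow> 'a"
    show "p \<otimes>\<^bsub>free_algebra L\<^esub> q \<otimes>\<^bsub>free_algebra L\<^esub> r = p \<otimes>\<^bsub>free_algebra L\<^esub> (q \<otimes>\<^bsub>free_algebra L\<^esub> r)"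
      unfolding free_algebra_def monoid.simps ring.simps by (rule ext, rule free_algebra_conv_assoc)
  next
    fix p :: "'l list \<Rightarrow> 'a"
    show "\<one>\<^bsub>free_algebra L\<^esub> \<otimes>\<^bsub>free_algebra L\<^esub> p = p"
      unfolding free_algebra_def monoid.simps ring.simps by (rule ext, rule one)
    show "p \<otimes>\<^bsub>free_algebra L\<^esub> \<one>\<^bsub>free_algebra L\<^esub> = p"
      unfolding free_algebra_def monoid.simps ring.simps by (rule ext, rule one')
  next
    show "\<one>\<^bsub>free_algebra L\<^esub> \<in> carrier (free_algebra L :: ('l list \<Rightarrow> 'a) ring)"
      by (auto simp: free_algebra_def)
  qed (rule free_algebra_mult_closed)
qed (auto simp: free_algebra_def fun_eq_iff distrib_left distrib_right sum.distrib)

text \<open>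
  \<open>L\<close> is a Lie algebra with bracket \<open>br\<close>; dividing by the linear relations turns the free algebra on
  the set \<open>L\<close> into the tensor algebra of the vector space \<open>L\<close>, and the last relations give
  \<open>xy - yx = [x, y]\<close>.
\<close>

definition uea_relations :: "'l::ab_group_add set \<Rightarrow> ('a::comm_ring_1 \<Rightarrow> 'l \<Rightarrow> 'l) \<Rightarrow> ('l \<Rightarrow> 'l \<Rightarrow> 'l)
    \<Rightarrow> ('l list \<Rightarrow> 'a) set"
  where "uea_relations L scale br = (let A = free_algebra L in
      {free_gen (x + y) \<ominus>\<^bsub>A\<^esub> (free_gen x \<oplus>\<^bsub>A\<^esub> free_gen y) | x y. x \<in> L \<and> y \<in> L}
    \<union> {free_gen (scale c x) \<ominus>\<^bsub>A\<^esub> (free_const c \<otimes>\<^bsub>A\<^esub> free_gen x) | c x. x \<in> L}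
    \<union> {(free_gen x \<otimes>\<^bsub>A\<^esub> free_gen y \<ominus>\<^bsub>A\<^esub> free_gen y \<otimes>\<^bsub>A\<^esub> free_gen x) \<ominus>\<^bsub>A\<^esub> free_gen (br x y)
        | x y. x \<in> L \<and> y \<in> L})"

definition uea_ideal :: "'l::ab_group_add set \<Rightarrow> ('a::comm_ring_1 \<Rightarrow> 'l \<Rightarrow> 'l) \<Rightarrow> ('l \<Rightarrow> 'l \<Rightarrow> 'l)
    \<Rightarrow> ('l list \<Rightarrow> 'a) set"
  where "uea_ideal L scale br = Idl\<^bsub>free_algebra L\<^esub> (uea_relations L scale br)"

definition uea :: "'l::ab_group_add set \<Rightarrow> ('a::comm_ring_1 \<Rightarrow> 'l \<Rightarrow> 'l) \<Rightarrow> ('l \<Rightarrow> 'l \<Rightarrow> 'l)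
    \<Rightarrow> ('l list \<Rightarrow> 'a) set ring"
  where "uea L scale br = free_algebra L Quot uea_ideal L scale br"

lemma uea_relations_carrier:
  assumes "\<And>x y. x \<in> L \<Longrightarrow> y \<in> L \<Longrightarrow> x + y \<in> L" "\<And>c x. x \<in> L \<Longrightarrow> scale c x \<in> L"
    and "\<And>x y. x \<in> L \<Longrightarrow> y \<in> L \<Longrightarrow> br x y \<in> L"
  shows "uea_relations L scale br \<subseteq> carrier (free_algebra L :: ('l::ab_group_add list \<Rightarrow> 'a::comm_ring_1) ring)"
proof -
  interpret A: ring "free_algebra L :: ('l list \<Rightarrow> 'a) ring" by (rule ring_free_algebra)
  have [simp]: "free_gen x \<in> carrier (free_algebra L :: ('l list \<Rightarrow> 'a) ring)" if "x \<in> L" for x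
    using that by (auto simp: free_algebra_def free_gen_def)
  have [simp]: "free_const c \<in> carrier (free_algebra L :: ('l list \<Rightarrow> 'a) ring)" for c
    by (auto simp: free_algebra_def free_const_def)
  show ?thesis using assms by (auto simp: uea_relations_def Let_def)
qed

lemma ring_uea:
  assumes "\<And>x y. x \<in> L \<Longrightarrow> y \<in> L \<Longrightarrow> x + y \<in> L" "\<And>c x. x \<in> L \<Longrightarrow> scale c x \<in> L"
    and "\<And>x y. x \<in> L \<Longrightarrow> y \<in> L \<Longrightarrow> br x y \<in> L"
  shows "ring (uea L (scale :: 'a::comm_ring_1 \<Rightarrow> 'l::ab_group_add \<Rightarrow> 'l) br)"
  unfolding uea_def uea_ideal_def
  by (intro ideal.quotient_is_ring ring.genideal_ideal ring_free_algebra uea_relations_carrier assms)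

definition uea_gen :: "'l::ab_group_add set \<Rightarrow> ('a::comm_ring_1 \<Rightarrow> 'l \<Rightarrow> 'l) \<Rightarrow> ('l \<Rightarrow> 'l \<Rightarrow> 'l)
    \<Rightarrow> 'l \<Rightarrow> ('l list \<Rightarrow> 'a) set"
  where "uea_gen L scale br x = uea_ideal L scale br +>\<^bsub>free_algebra L\<^esub> free_gen x"

definition uea_const :: "'l::ab_group_add set \<Rightarrow> ('a::comm_ring_1 \<Rightarrow> 'l \<Rightarrow> 'l) \<Rightarrow> ('l \<Rightarrow> 'l \<Rightarrow> 'l)
    \<Rightarrow> 'a \<Rightarrow> ('l list \<Rightarrow> 'a) set"
  where "uea_const L scale br c = uea_ideal L scale br +>\<^bsub>free_algebra L\<^esub> free_const c"

definition endo_ring :: "('a::field \<Rightarrow> 'm::ab_group_add \<Rightarrow> 'm) \<Rightarrow> ('m \<Rightarrow> 'm) ring"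
  where "endo_ring scaleM =
    \<lparr>carrier = {T. Vector_Spaces.linear scaleM scaleM T}, mult = (\<circ>), one = id,
     zero = (\<lambda>_. 0), add = (\<lambda>S T m. S m + T m)\<rparr>"

text \<open>
  Irreducible representations of the enveloping algebra on a fixed vector space: unital
  homomorphisms of algebras over the ground field (hence the condition on constants) into the
  endomorphisms, again normalised outside the carrier, annihilated by the set \<open>Q\<close>.
\<close>

definition uea_irreps_killing :: "'l::ab_group_add set \<Rightarrow> ('a::field \<Rightarrow> 'l \<Rightarrow> 'l) \<Rightarrow> ('l \<Rightarrow> 'l \<Rightarrow> 'l)
    \<Rightarrow> ('l list \<Rightarrow> 'a) set set \<Rightarrow> ('a \<Rightarrow> 'm::ab_group_add \<Rightarrow> 'm)
    \<Rightarrow> (('l list \<Rightarrow> 'a) set \<Rightarrow> 'm \<Rightarrow> 'm) set"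
  where "uea_irreps_killing L scale br Q scaleM =
    {\<rho> \<in> extensional (carrier (uea L scale br)).
       \<rho> \<in> ring_hom (uea L scale br) (endo_ring scaleM) \<and>
       (\<forall>c. \<rho> (uea_const L scale br c) = scaleM c) \<and>
       irreducible_under scaleM (\<rho> ` carrier (uea L scale br)) \<and>
       (\<forall>q\<in>Q. \<rho> q = (\<lambda>_. 0))}"

definition uea_module_iso :: "'l::ab_group_add set \<Rightarrow> ('a::field \<Rightarrow> 'l \<Rightarrow> 'l) \<Rightarrow> ('l \<Rightarrow> 'l \<Rightarrow> 'l)
    \<Rightarrow> ('a \<Rightarrow> 'm::ab_group_add \<Rightarrow> 'm)
    \<Rightarrow> (('l list \<Rightarrow> 'a) set \<Rightarrow> 'm \<Rightarrow> 'm) \<Rightarrow> (('l list \<Rightarrow> 'a) set \<Rightarrow> 'm \<Rightarrow> 'm) \<Rightarrow> bool"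
  where "uea_module_iso L scale br scaleM \<rho> \<rho>' \<longleftrightarrow>
    (\<exists>T. Vector_Spaces.linear scaleM scaleM T \<and> bij T \<and>
       (\<forall>u\<in>carrier (uea L scale br). \<forall>m. T (\<rho> u m) = \<rho>' u (T m)))"


section \<open>The n-Lie algebra of power series and its Lie algebra of inner derivations\<close>

definition jacobian_bracket :: "nat \<Rightarrow> 'a::comm_ring_1 mfps list \<Rightarrow> 'a mfps"
  where "jacobian_bracket n fs = det (mat n n (\<lambda>(i, j). pderiv_at i (fs ! j)))"

text \<open>
  Derivations of \<open>mfps_in n\<close> are represented as maps extended by zero to all of \<open>'a mfps\<close>; pointwise
  addition and composition of such maps are then the correct operations.
\<close>

definition S_Lie :: "nat \<Rightarrow> ('a::comm_ring_1 mfps \<Rightarrow> 'a mfps) set"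
  where "S_Lie n = {X. \<exists>f. (\<forall>i<n. f i \<in> mfps_in n) \<and> (\<Sum>i<n. pderiv_at i (f i)) = 0 \<and>
    X = (\<lambda>g. if g \<in> mfps_in n then \<Sum>i<n. f i * pderiv_at i g else 0)}"

definition S_scale :: "'a::comm_ring_1 \<Rightarrow> ('a mfps \<Rightarrow> 'a mfps) \<Rightarrow> 'a mfps \<Rightarrow> 'a mfps"
  where "S_scale c X = (\<lambda>g. mfps_scale c (X g))"

definition commutator :: "('a::comm_ring_1 mfps \<Rightarrow> 'a mfps) \<Rightarrow> ('a mfps \<Rightarrow> 'a mfps) \<Rightarrow> 'a mfps \<Rightarrow> 'a mfps"
  where "commutator X Y = (\<lambda>g. X (Y g) - Y (X g))"

definition ad :: "nat \<Rightarrow> 'a::comm_ring_1 mfps list \<Rightarrow> 'a mfps \<Rightarrow> 'a mfps"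
  where "ad n fs = (\<lambda>g. if g \<in> mfps_in n then jacobian_bracket n (fs @ [g]) else 0)"

definition U_S :: "nat \<Rightarrow> (('a::field mfps \<Rightarrow> 'a mfps) list \<Rightarrow> 'a) set ring"
  where "U_S n = uea (S_Lie n) S_scale commutator"

definition U_ad :: "nat \<Rightarrow> 'a::field mfps list \<Rightarrow> (('a mfps \<Rightarrow> 'a mfps) list \<Rightarrow> 'a) set"
  where "U_ad n fs = uea_gen (S_Lie n) S_scale commutator (ad n fs)"

text \<open>
  Here \<open>hs = [f\<^sub>1, \<dots>, f\<^sub>n]\<close> and \<open>ts = [f\<^sub>n\<^sub>+\<^sub>1, \<dots>, f\<^sub>2\<^sub>n\<^sub>-\<^sub>2]\<close>; the index \<open>i\<close> counts from 1, so \<open>f\<^sub>i\<close> is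
  \<open>hs ! (i - 1)\<close> and \<open>take (i - 1) hs @ drop i hs\<close> omits it.
\<close>

definition Q_gen :: "nat \<Rightarrow> 'a::field mfps list \<Rightarrow> 'a mfps list
    \<Rightarrow> (('a mfps \<Rightarrow> 'a mfps) list \<Rightarrow> 'a) set"
  where "Q_gen n hs ts =
    U_ad n (jacobian_bracket n hs # ts) \<ominus>\<^bsub>U_S n\<^esub>
    (\<Oplus>\<^bsub>U_S n\<^esub>i\<in>{1..n}. (\<ominus>\<^bsub>U_S n\<^esub> \<one>\<^bsub>U_S n\<^esub>) [^]\<^bsub>U_S n\<^esub> (i + n) \<otimes>\<^bsub>U_S n\<^esub>
       (U_ad n (take (i - 1) hs @ drop i hs) \<otimes>\<^bsub>U_S n\<^esub> U_ad n (hs ! (i - 1) # ts)))"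

definition Q_ideal :: "nat \<Rightarrow> (('a::field mfps \<Rightarrow> 'a mfps) list \<Rightarrow> 'a) set set"
  where "Q_ideal n = Idl\<^bsub>U_S n\<^esub> {Q_gen n hs ts | hs ts.
    hs \<in> tuples n (mfps_in n) \<and> ts \<in> tuples (n - 2) (mfps_in n) \<and> 1 \<notin> set hs}"

definition S_nLie_irreps :: "nat \<Rightarrow> ('a::field \<Rightarrow> 'm::ab_group_add \<Rightarrow> 'm)
    \<Rightarrow> (('a mfps \<times> 'm) list \<Rightarrow> 'a mfps \<times> 'm) set"
  where "S_nLie_irreps n scaleM = n_Lie_irreps mfps_scale n (mfps_in n) (jacobian_bracket n) scaleM"

definition U_S_irreps :: "nat \<Rightarrow> ('a::field \<Rightarrow> 'm::ab_group_add \<Rightarrow> 'm)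
    \<Rightarrow> ((('a mfps \<Rightarrow> 'a mfps) list \<Rightarrow> 'a) set \<Rightarrow> 'm \<Rightarrow> 'm) set"
  where "U_S_irreps n scaleM = uea_irreps_killing (S_Lie n) S_scale commutator (Q_ideal n) scaleM"

end

theory Submission
  imports Defs
begin

text \<open>
  Write \<open>\<rho>(f\<^sub>1, \<dots>, f\<^sub>n\<^sub>-\<^sub>1)\<close> for the operators of a module \<open>M\<close> over \<open>S\<^sup>n\<close>.  The axioms of a module amount to
  two identities: the commutator of two such operators is given by the derivation rule of
  \<open>ad\<close>, and \<open>\<rho>\<close> satisfies the quadratic relation that defines \<open>Q(S\<^sup>n)\<close> (for an entry \<open>f\<^sub>i = 1\<close> with
  \<open>i \<le> n\<close> it holds trivially as soon as \<open>\<rho>\<close> factors through \<open>ad\<close>).  So everything depends on \<open>\<rho>\<close> factoring through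
  \<open>ad\<close> when \<open>M\<close> is irreducible.

  If \<open>\<Sum>ad(a\<^sub>k) = 0\<close>, then \<open>\<Sum>\<rho>(a\<^sub>k)\<close> commutes with all operators, and by Schur's lemma it is zero or injective.
  For tuples that contain all but three of the coordinates, this concerns the elements
  \<open>P(f, p) - \<Sum>\<^sub>i P(f D\<^sub>i p, x\<^sub>i)\<close>, where \<open>P(f, g)\<close> is the operator of \<open>f\<close>, \<open>g\<close> and these coordinates; the quadratic
  relation shows that an injective element of this form would force \<open>P = 0\<close>.  Brackets with
  divergence-free fields reach all other tuples: such a field may send one coordinate to any
  given series while it kills all other coordinates but one.
\<close>

section \<open>Three free slots\<close>

text \<open>Schur's lemma over an arbitrary field gives only cancellation, so a product annihilated
  by every defect is needed. Its source is the family \<open>e u = P u x1\<close>, which represents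
  the Poisson bracket in \<open>x2\<close>, \<open>x3\<close>, with \<open>x1\<close> as a Casimir
  function. A factor \<open>x1\<close> can be moved from one \<open>e\<close> to another;
  \<open>C\<close> measures the error of moving it from an \<open>e\<close> to a general
  \<open>P\<close>, and the combination of such errors that has the shape of a defect is a sum of
  defects times operators. Commuting it with the operators of \<open>D3\<close> and
  \<open>D1\<close> gives \<open>defect g p * (P x3 x1 * P x1 x2) = 0\<close>, while
  \<open>P x3 x1 * P x1 x2 = 0\<close> already implies \<open>P = 0\<close>.

  Vanishing defects only rewrite tuples by standard ones, a series followed by \<open>n - 2\<close>
  coordinates; a relation among standard tuples needs a second argument. Integrated in one variable,
  a vanishing field becomes a field with coefficients independent of that variable, which is also a
  sum over series independent of it. The difference of the two sums is central, and its commutator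
  with the partial derivative returns the original relation.\<close>

text \<open>\<open>P f g\<close> is the operator of a tuple \<open>f, g\<close> followed by the coordinates other than \<open>x1, x2, x3\<close>, and
  \<open>br\<close> is the Jacobian bracket with these coordinates inserted; \<open>I1\<close> and \<open>I2\<close> integrate.\<close>

locale three_bracket =
  fixes D1 D2 D3 I1 I2 :: "'v::comm_ring_1 \<Rightarrow> 'v" and x1 x2 x3 :: 'v
    and P :: "'v \<Rightarrow> 'v \<Rightarrow> 'r::ring" and br :: "'v \<Rightarrow> 'v \<Rightarrow> 'v \<Rightarrow> 'v"
  assumes D_add: "D1 (f + g) = D1 f + D1 g" "D2 (f + g) = D2 f + D2 g" "D3 (f + g) = D3 f + D3 g"
    and D_mult: "D1 (f * g) = D1 f * g + f * D1 g" "D2 (f * g) = D2 f * g + f * D2 g"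
      "D3 (f * g) = D3 f * g + f * D3 g"
    and D_comm: "D1 (D2 f) = D2 (D1 f)" "D1 (D3 f) = D3 (D1 f)" "D2 (D3 f) = D3 (D2 f)"
    and D_x: "D1 x1 = 1" "D1 x2 = 0" "D1 x3 = 0" "D2 x1 = 0" "D2 x2 = 1" "D2 x3 = 0"
      "D3 x1 = 0" "D3 x2 = 0" "D3 x3 = 1"
    and D_I: "D1 (I1 f) = f" "D2 (I2 f) = f"
    and P_add_left: "P (f + g) h = P f h + P g h"
    and P_add_right: "P h (f + g) = P h f + P h g"
    and P_same: "P f f = 0"
    and P_one: "P 1 f = 0"
    and torsion_free: "r + r = 0 \<Longrightarrow> r = (0::'r)" "r + r + r = 0 \<Longrightarrow> r = (0::'r)"
    and br_def: "br u v s = D1 u * (D2 v * D3 s - D3 v * D2 s) - D2 u * (D1 v * D3 s - D3 v * D1 s)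
    + D3 u * (D1 v * D2 s - D2 v * D1 s)"
    and quadratic: "P u v * P s t - P u s * P v t + P v s * P u t = P (br u v s) t"
    and lie: "P u v * P s t - P s t * P u v = P (br u v s) t + P s (br u v t)"
begin

lemma sum3_zero: "a + b + c = 0 \<Longrightarrow> - a - b = (c::'r)"
proof -
  assume "a + b + c = 0"
  then have "- (a + b) = c" by (rule minus_unique)
  then show "- a - b = c" by simp
qed

lemma P_zero [simp]: "P 0 f = 0" "P f 0 = 0"
  using P_add_left[of 0 0 f] P_add_right[of f 0 0] by simp_all

lemma P_minus_left: "P (- f) g = - P f g"
proof -
  have "P (- f + f) g = P (- f) g + P f g" by (rule P_add_left)
  then show ?thesis by (simp add: eq_neg_iff_add_eq_0)
qed

lemma P_minus_right: "P g (- f) = - P g f"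
proof -
  have "P g (- f + f) = P g (- f) + P g f" by (rule P_add_right)
  then show ?thesis by (simp add: eq_neg_iff_add_eq_0)
qed

lemma P_diff_left: "P (f - g) h = P f h - P g h"
  using P_add_left[of f "- g" h] by (simp add: P_minus_left)

lemma P_diff_right: "P h (f - g) = P h f - P h g"
  using P_add_right[of h f "- g"] by (simp add: P_minus_right)

lemmas P_lin = P_add_left P_add_right P_minus_left P_minus_right P_diff_left P_diff_right

lemma P_double: "P (f * 2) h = P f h + P f h"
  unfolding mult_2_right P_add_left ..

lemma P_swap: "P g f = - P f g"
proof -
  have "P (f + g) (f + g) = P f g + P g f"
    unfolding P_add_left P_add_right by (simp add: P_same)
  then show ?thesis by (simp add: P_same eq_neg_iff_add_eq_0 add.commute)
qed

lemma P_one_right [simp]: "P f 1 = 0" "P 1 f = 0"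
  using P_swap[of f 1] P_one by auto

lemma D_zero [simp]: "D1 0 = 0" "D2 0 = 0" "D3 0 = 0" 
  using D_add(1)[of 0 0] D_add(2)[of 0 0] D_add(3)[of 0 0] by simp_all
lemma D_one [simp]: "D1 1 = 0" "D2 1 = 0" "D3 1 = 0" 
  using D_mult(1)[of 1 1] D_mult(2)[of 1 1] D_mult(3)[of 1 1] by simp_all

lemma D_minus: "D1 (- f) = - D1 f" "D2 (- f) = - D2 f" "D3 (- f) = - D3 f"
  using D_add(1)[of "- f" f] D_add(2)[of "- f" f] D_add(3)[of "- f" f] 
  by (simp_all add: eq_neg_iff_add_eq_0)

lemma D_diff: "D1 (f - g) = D1 f - D1 g" "D2 (f - g) = D2 f - D2 g" "D3 (f - g) = D3 f - D3 g"
  using D_add(1)[of f "- g"] D_add(2)[of f "- g"] D_add(3)[of f "- g"] by (simp_all add: D_minus)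

lemmas D_rules = D_add D_mult D_x D_I D_minus D_diff

lemma br_alt: "br u u s = 0" "br u v u = 0" "br u v v = 0"
  unfolding br_def by (simp_all add: algebra_simps)

lemma br_mult: "br u v (f * g) = br u v f * g + f * br u v g"
  unfolding br_def by (simp add: D_rules algebra_simps)

lemma br_coord: "br x1 x2 f = D3 f" "br x2 x3 f = D1 f" "br x3 x1 f = D2 f"
  "br x2 x1 f = - D3 f" "br x3 x2 f = - D1 f" "br x1 x3 f = - D2 f"
  unfolding br_def by (simp_all add: D_rules)

section \<open>The cyclic relation d(fg) dh + d(gh) df + d(hf) dg = 0 of two-forms, for
  \<open>P\<close> in place of the wedge\<close>

definition cyc where "cyc f g h = P (f * g) h + P (g * h) f + P (h * f) g"

lemma cyc_perm: "cyc f g h = cyc g h f" "cyc f g h = cyc g f h"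
  unfolding cyc_def by (simp_all add: ac_simps)

text \<open>By \<open>lie\<close>, the commutator with \<open>P s t\<close> depends only on the
  fields \<open>br (f * g) h\<close> and its cyclic analogues, and these three fields add up to zero
  by the product rule.\<close>

lemma cyc_central: "cyc f g h * P s t = P s t * cyc f g h"
proof -
  have "br (f * g) h s + br (g * h) f s + br (h * f) g s = 0" for s
    unfolding br_def by (simp add: D_rules algebra_simps)
  note b = this
  have "cyc f g h * P s t - P s t * cyc f g h
     = (P (f * g) h * P s t - P s t * P (f * g) h) + (P (g * h) f * P s t - P s t * P (g * h) f)
      + (P (h * f) g * P s t - P s t * P (h * f) g)"
    unfolding cyc_def by (simp only: distrib_left distrib_right) simp
  also have "\<dots> = P (br (f * g) h s + br (g * h) f s + br (h * f) g s) t + P s (br (f * g) h t + br (g * h) f t + br (h * f) g t)"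
    unfolding lie P_lin by (simp only: ac_simps)
  finally have "cyc f g h * P s t - P s t * cyc f g h
     = P (br (f * g) h s + br (g * h) f s + br (h * f) g s) t + P s (br (f * g) h t + br (g * h) f t + br (h * f) g t)" .
  then show ?thesis unfolding b by simp
qed

text \<open>Since \<open>br s t\<close> is a derivation, the commutator of \<open>P s t\<close> with
  the cyclic sum is obtained by applying \<open>br s t\<close> to the three arguments in turn. The
  cyclic sum is central, so the result is zero.\<close>

lemma cyc_invariant: "cyc (br s t f) g h + cyc f (br s t g) h + cyc f g (br s t h) = 0"
proof -
  have "cyc (br s t f) g h + cyc f (br s t g) h + cyc f g (br s t h) = P s t * cyc f g h - cyc f g h * P s t"
  proof -
    have "P s t * cyc f g h - cyc f g h * P s t
      = (P s t * P (f * g) h - P (f * g) h * P s t) + (P s t * P (g * h) f - P (g * h) f * P s t)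
      + (P s t * P (h * f) g - P (h * f) g * P s t)"
      unfolding cyc_def by (simp only: distrib_left distrib_right) simp
    then show ?thesis
      unfolding lie cyc_def br_mult P_lin by (simp only: ac_simps)
  qed
  then show ?thesis by (simp add: cyc_central)
qed

text \<open>\<open>D1 = br x2 x3\<close> kills \<open>x3\<close>, so invariance gives \<open>cyc x3 x3 h = 0\<close>; the fields \<open>br (I1 f) x2\<close>, which
  send \<open>x3\<close> to \<open>f\<close>, then replace the two \<open>x3\<close> one after the other.\<close>

lemma cyc_zero: "cyc f g h = 0"
proof -
  have c1: "cyc 1 f g = 0" for f g
    unfolding cyc_def using P_swap[of f g] by simp
  have "cyc x3 x3 h = 0" for h
  proof -
    have "cyc 1 x3 (I1 h) = 0" by (rule c1)
    show ?thesis
      using cyc_invariant[of x2 x3 x3 x3 "I1 h"] 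
      by (simp add: br_coord D_rules) (simp add: cyc_def)
  qed
  note c33 = this
  have br3: "br (I1 f) x2 x3 = f" for f
    unfolding br_def by (simp add: D_rules)
  have c3: "cyc f x3 h = 0" for f h
  proof -
    have "cyc f x3 h + cyc x3 f h = 0"
      using cyc_invariant[of "I1 f" x2 x3 x3 h] by (simp add: br3 c33)
    then show ?thesis unfolding cyc_perm(2)[of x3 f h] by (rule torsion_free(1))
  qed
  show ?thesis
    using cyc_invariant[of "I1 g" x2 f x3 h] by (simp add: br3 c3)
qed

lemma P_cyc: "P (f * g) h + P (g * h) f + P (h * f) g = 0"
  using cyc_zero[of f g h] unfolding cyc_def .

section \<open>Chain-rule defects: the failure of \<open>P f p\<close> to follow from f dp = sum of
  (f D_i p) dx_i\<close>

definition defect where "defect f p = P f p - P (f * D1 p) x1 - P (f * D2 p) x2 - P (f * D3 p) x3"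

text \<open>The quadratic relation turns each product \<open>P u v * P s t\<close> into an
  antisymmetrised product plus a single linear term. The linear terms of the four summands cancel,
  because the defect corresponds to the zero field.\<close>

lemma defect_quad: "defect f p * P s t = P f s * P p t - P p s * P f t
   - (P (f * D1 p) s * P x1 t - P x1 s * P (f * D1 p) t)
   - (P (f * D2 p) s * P x2 t - P x2 s * P (f * D2 p) t)
   - (P (f * D3 p) s * P x3 t - P x3 s * P (f * D3 p) t)"
proof -
  define R where "R u v = P u s * P v t - P v s * P u t" for u v
  have q: "P u v * P s t = R u v + P (br u v s) t" for u v
    using quadratic[of u v s t] unfolding R_def by (simp add: algebra_simps)
  have b: "br f p s - br (f * D1 p) x1 s - br (f * D2 p) x2 s - br (f * D3 p) x3 s = 0"
    unfolding br_def by (simp add: D_rules D_comm algebra_simps)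
  have "P (br f p s) t - P (br (f * D1 p) x1 s) t - P (br (f * D2 p) x2 s) t - P (br (f * D3 p) x3 s) t = 0"
    using arg_cong[OF b, of "\<lambda>h. P h t"] unfolding P_lin by simp
  moreover have "defect f p * P s t = (R f p - R (f * D1 p) x1 - R (f * D2 p) x2 - R (f * D3 p) x3)
    + (P (br f p s) t - P (br (f * D1 p) x1 s) t - P (br (f * D2 p) x2 s) t - P (br (f * D3 p) x3 s) t)"
    unfolding defect_def left_diff_distrib q by simp
  ultimately show ?thesis
    unfolding R_def by simp
qed

text \<open>As for the cyclic sum: the field belonging to the defect is zero by the chain rule, and
  commutators depend only on the field.\<close>

lemma defect_central: "defect f p * P s t = P s t * defect f p"
proof -
  have b: "br f p s - br (f * D1 p) x1 s - br (f * D2 p) x2 s - br (f * D3 p) x3 s = 0" for s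
    unfolding br_def by (simp add: D_rules D_comm algebra_simps)
  have "defect f p * P s t - P s t * defect f p = (P f p * P s t - P s t * P f p)
     - (P (f * D1 p) x1 * P s t - P s t * P (f * D1 p) x1) - (P (f * D2 p) x2 * P s t - P s t * P (f * D2 p) x2)
     - (P (f * D3 p) x3 * P s t - P s t * P (f * D3 p) x3)"
    unfolding defect_def by (simp only: left_diff_distrib right_diff_distrib) simp
  also have "\<dots> = P (br f p s - br (f * D1 p) x1 s - br (f * D2 p) x2 s - br (f * D3 p) x3 s) t
     + P s (br f p t - br (f * D1 p) x1 t - br (f * D2 p) x2 t - br (f * D3 p) x3 t)"
    unfolding lie P_lin by simp
  finally have "defect f p * P s t - P s t * defect f p = P (br f p s - br (f * D1 p) x1 s - br (f * D2 p) x2 s - br (f * D3 p) x3 s) t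
     + P s (br f p t - br (f * D1 p) x1 t - br (f * D2 p) x2 t - br (f * D3 p) x3 t)" .
  then show ?thesis unfolding b by simp
qed

text \<open>The product rule for \<open>D3 (x3 * p)\<close> contributes one extra term
  \<open>P (g * p) x3\<close>, and the cyclic relation for \<open>x3\<close>, \<open>p\<close>,
  \<open>g\<close> absorbs it. A factor \<open>x3\<close> can thus pass from one argument to the
  other.\<close>

lemma defect_balance: "defect g (x3 * p) = defect (x3 * g) p"
proof -
  have 1: "defect g (x3 * p) = P g (x3 * p) - P (g * x3 * D1 p) x1 - P (g * x3 * D2 p) x2 - P (g * x3 * D3 p) x3 - P (g * p) x3"
    unfolding defect_def by (simp add: D_rules algebra_simps P_add_left)
  have 2: "defect (x3 * g) p = P (g * x3) p - P (g * x3 * D1 p) x1 - P (g * x3 * D2 p) x2 - P (g * x3 * D3 p) x3"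
    unfolding defect_def by (simp add: algebra_simps)
  have "P g (x3 * p) - P (g * p) x3 = P (g * x3) p"
    using sum3_zero[OF P_cyc[of x3 p g]] P_swap[of g "x3 * p"] by (simp add: mult.commute)
  moreover have "A - B = D \<Longrightarrow> A - a - b - c - B = D - a - b - c" for A B D a b c :: 'r
    by (simp add: algebra_simps)
  ultimately show ?thesis unfolding 1 2 by blast
qed

text \<open>The only nonzero derivative of \<open>x3 * x3\<close> is \<open>x3 + x3\<close>, and the
  cyclic relation for \<open>x3\<close>, \<open>x3\<close>, \<open>g\<close> evaluates
  \<open>P g (x3 * x3)\<close> to the matching double term.\<close>

lemma defect_square: "defect g (x3 * x3) = 0"
proof -
  have D: "D1 (x3 * x3) = 0" "D2 (x3 * x3) = 0" "D3 (x3 * x3) = x3 + x3"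
    using D_mult(1)[of x3 x3] D_mult(2)[of x3 x3] D_mult(3)[of x3 x3] unfolding D_x by auto
  have "P g (x3 * x3) - P (x3 * g) x3 = P (g * x3) x3"
    using sum3_zero[OF P_cyc[of x3 x3 g]] P_swap[of g "x3 * x3"] by simp
  then show ?thesis
    unfolding defect_def D distrib_left P_add_left by (simp add: mult.commute diff_eq_eq)
qed

section \<open>The operators with \<open>x1\<close> in one slot, and the moves of a factor
  \<open>x1\<close> between operators\<close>

definition e where "e u = P u x1"

text \<open>All three terms of the cyclic relation for \<open>x1\<close>, \<open>x1\<close>,
  \<open>x1\<close> coincide.\<close>

lemma e_x1_square: "e (x1 * x1) = 0"
  unfolding e_def by (rule torsion_free(2)[OF P_cyc])

text \<open>The error made when a factor \<open>x1\<close> is moved from the left operator to the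
  right one. For \<open>t = x1\<close> it vanishes by \<open>e_exchange\<close>; for general
  \<open>t\<close> it will be tied to the defects.\<close>

definition C where "C u v t = e (x1 * u) * P v t - e u * P (x1 * v) t"

lemma e_lin: "e (f + g) = e f + e g" "e (- f) = - e f" "e (f - g) = e f - e g" "e 0 = 0" "e 1 = 0"
  unfolding e_def P_lin by simp_all

lemma C_lin: "C (f + g) v t = C f v t + C g v t" "C u (f + g) t = C u f t + C u g t"
  "C 0 v t = 0" "C x1 v t = 0" "C 1 v t = 0"
proof -
  show "C x1 v t = 0" unfolding C_def e_x1_square by (simp add: e_def P_same)
  show "C 1 v t = 0" unfolding C_def by (simp add: e_def P_same)
qed (simp_all add: C_def e_lin algebra_simps P_lin)

lemma C_zero: "C u 0 t = 0"
  by (simp add: C_def)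

lemma P_square: "P f (x1 * x1) = e (x1 * f) + e (x1 * f)"
proof -
  have "P (x1 * x1) f + (P (x1 * f) x1 + P (x1 * f) x1) = 0"
    using P_cyc[of x1 x1 f] by (simp add: add.assoc mult.commute)
  then show ?thesis
    unfolding e_def P_swap[of f "x1 * x1"] by (rule minus_unique)
qed

lemma double_cancel: "r + r = s + s \<Longrightarrow> r = (s::'r)"
proof -
  assume "r + r = s + s"
  moreover have "(r - s) + (r - s) = (r + r) - (s + s)" by simp
  ultimately have "(r - s) + (r - s) = 0" by simp
  then have "r - s = 0" by (rule torsion_free(1))
  then show "r = s" by simp
qed

text \<open>In the quadratic relation for \<open>x1 * x1\<close>, \<open>x1\<close>,
  \<open>u\<close> one product contains \<open>e (x1 * x1) = 0\<close> and the bracket vanishes, so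
  two products must agree. By \<open>P_square\<close> each of them is twice a side of the
  claim.\<close>

lemma e_exchange: "e (x1 * u) * e v = e u * e (x1 * v)"
proof -
  note e_x1_square
  moreover have "br (x1 * x1) x1 u = 0" unfolding br_def by (simp add: D_rules algebra_simps)
  ultimately have "P (x1 * x1) u * P x1 v = P x1 u * P (x1 * x1) v"
    using quadratic[of "x1 * x1" x1 u v] unfolding e_def by (simp add: algebra_simps eq_neg_iff_add_eq_0)
  then have "P u (x1 * x1) * e v = e u * P v (x1 * x1)"
    unfolding e_def using P_swap[of u "x1 * x1"] P_swap[of v "x1 * x1"] P_swap[of v x1] P_swap[of u x1] by simp
  then show ?thesis
    unfolding P_square by (intro double_cancel[of "e (x1 * u) * e v"]) (simp add: algebra_simps)
qed

text \<open>Equal to \<open>D3 s * D2 u - D2 s * D3 u\<close>, the Poisson bracket in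
  \<open>x2\<close>, \<open>x3\<close> normalised by \<open>pb x3 x2 = 1\<close>; multiplication by
  \<open>x1\<close> commutes with it.\<close>

definition pb where "pb s u = br s x1 u"

lemma e_comm: "e s * e u = e u * e s + e (pb s u)" 
   "e (x1 * s) * e u = e u * e (x1 * s) + e (x1 * pb s u)"
proof -
  show "e s * e u = e u * e s + e (pb s u)"
    using lie[of s x1 u x1] unfolding e_def pb_def by (simp add: br_alt algebra_simps)
  have "br (x1 * s) x1 u = x1 * br s x1 u" unfolding br_def by (simp add: D_rules algebra_simps)
  then show "e (x1 * s) * e u = e u * e (x1 * s) + e (x1 * pb s u)"
    using lie[of "x1 * s" x1 u x1] unfolding e_def pb_def by (simp add: br_alt algebra_simps)
qed

text \<open>Both products in \<open>C\<close> begin with an \<open>e\<close>, so \<open>e s\<close>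
  can be carried past it by the commutation rules. In the first product \<open>e_exchange\<close>
  also shifts the factor \<open>x1\<close> from \<open>u\<close> to \<open>s\<close>, which makes
  \<open>s\<close> the new first argument of \<open>C\<close>.\<close>

lemma e_C: "e s * C u v t = e u * C s v t + C (pb s u) v t"
proof -
  have "e s * C u v t = (e s * e (x1 * u)) * P v t - (e s * e u) * P (x1 * v) t"
    unfolding C_def by (simp add: algebra_simps)
  also have "\<dots> = (e u * e (x1 * s) + e (x1 * pb s u)) * P v t - (e u * e s + e (pb s u)) * P (x1 * v) t"
    unfolding e_comm(2)[symmetric] e_comm(1)[symmetric] e_exchange ..
  finally show ?thesis unfolding C_def by (simp add: algebra_simps)
qed

text \<open>The combination of errors built like a defect of \<open>g\<close> and \<open>p\<close>.
  The summand for \<open>x1\<close> is absent because \<open>C x1 v t = 0\<close>.\<close>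

definition T where "T p g t = C p g t - C x2 (g * D2 p) t - C x3 (g * D3 p) t"

lemma double_diff: "(a + a) * p - (b + b) * q = (a * p - b * q) + (a * p - b * q)" for a b p q :: 'r
  by (simp add: distrib_right)

lemma double_sum: "k * X + k * X = - (a - b - c - d) + - (a - b - c - d)"
  if "k * Y = (a + a) - (b + b) - (c + c) - (d + d)" "Y = - (X + X)" for k X Y a b c d :: 'r
proof -
  have "k * X + k * X = - (k * Y)" unfolding that(2) by (simp add: distrib_left right_diff_distrib)
  then show ?thesis unfolding that(1) by simp
qed

text \<open>Both products on the right are expanded by \<open>defect_quad\<close>, with
  \<open>x1\<close> and with \<open>x1 * x1\<close> as the inserted argument; the latter gives
  everything twice, by \<open>P_square\<close>. On adding, the terms that begin with
  \<open>e (x1 * g)\<close> cancel, and errors \<open>C\<close> remain.\<close>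

lemma T_defect: "T p g t = defect (x1 * g) p * P x1 t + defect g p * e (x1 * t)"
proof -
  define E where "E u v = e (x1 * u) * P v t - e (x1 * v) * P u t" for u v
  have E: "P u (x1 * x1) * P v t - P v (x1 * x1) * P u t = E u v + E u v" for u v
    unfolding P_square double_diff E_def ..
  have "defect g p * P (x1 * x1) t = (E g p + E g p) - (E (g * D1 p) x1 + E (g * D1 p) x1)
    - (E (g * D2 p) x2 + E (g * D2 p) x2) - (E (g * D3 p) x3 + E (g * D3 p) x3)"
    unfolding defect_quad E ..
  moreover have "P (x1 * x1) t = - (e (x1 * t) + e (x1 * t))"
    using P_swap[of "x1 * x1" t] P_square[of t] by simp
  ultimately have "defect g p * e (x1 * t) + defect g p * e (x1 * t)
    = - (E g p - E (g * D1 p) x1 - E (g * D2 p) x2 - E (g * D3 p) x3)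
      + - (E g p - E (g * D1 p) x1 - E (g * D2 p) x2 - E (g * D3 p) x3)"
    by (rule double_sum)
  then have k2: "defect g p * e (x1 * t) = - (E g p - E (g * D1 p) x1 - E (g * D2 p) x2 - E (g * D3 p) x3)"
    by (rule double_cancel)
  define F where "F u v = e u * P (x1 * v) t" for u v
  have F: "P (x1 * u) x1 * P v t - P v x1 * P (x1 * u) t = e (x1 * u) * P v t - F v u" for u v
    unfolding e_def F_def ..
  have k1: "defect (x1 * g) p * P x1 t = (e (x1 * g) * P p t - F p g)
   - (e (x1 * (g * D1 p)) * P x1 t - F x1 (g * D1 p))
   - (e (x1 * (g * D2 p)) * P x2 t - F x2 (g * D2 p))
   - (e (x1 * (g * D3 p)) * P x3 t - F x3 (g * D3 p))"
    unfolding defect_quad mult.assoc F ..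
  note 0 = e_x1_square
  have 00: "F x1 v = 0" for v by (simp add: e_def P_same F_def)
  show ?thesis unfolding k1 k2 T_def C_def 00 E_def 0 F_def[symmetric] by (simp add: algebra_simps)
qed

text \<open>\<open>T (x3 * x3) v t\<close> is a combination of defects in \<open>x3 * x3\<close>,
  which are zero, and only the derivative \<open>D3\<close> contributes to its definition.\<close>

lemma C_square: "C (x3 * x3) v t = C x3 (x3 * v) t + C x3 (x3 * v) t"
proof -
  have "T (x3 * x3) v t = 0"
    unfolding T_defect defect_square by simp
  then have "C (x3 * x3) v t = C x3 (v * (x3 + x3)) t"
    unfolding T_def by (simp add: D_mult D_x C_zero)
  then show ?thesis
    unfolding distrib_left C_lin by (simp add: mult.commute)
qed

text \<open>Three moves: \<open>e (x3 * x3)\<close> changes places with \<open>p\<close>, the square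
  in the first argument of \<open>C\<close> is split by \<open>C_square\<close>, and
  \<open>e p\<close> changes places with \<open>e x3\<close>. The two extra terms are the Poisson
  brackets of the outer moves.\<close>

lemma e_sq_C: "e (x3 * x3) * C p g t = (e x3 * C p (x3 * g) t - C (D2 p) (x3 * g) t + C (x3 * D2 p) g t) +
   (e x3 * C p (x3 * g) t - C (D2 p) (x3 * g) t + C (x3 * D2 p) g t)"
proof -
  have pb: "pb x3 p = D2 p" "pb (x3 * x3) p = x3 * D2 p + x3 * D2 p"
    unfolding pb_def br_def by (simp_all add: D_rules algebra_simps)
  show ?thesis
    unfolding e_C[of "x3 * x3"] e_C[of x3] pb C_square C_lin by (simp add: algebra_simps)
qed

text \<open>The extra terms of \<open>e_sq_C\<close> cancel in the combination \<open>T\<close>,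
  because a factor \<open>x3\<close> can be moved between the arguments of a defect.\<close>

lemma e_sq_T: "e (x3 * x3) * T p g t = e x3 * T p (x3 * g) t + e x3 * T p (x3 * g) t"
proof -
  have "defect g (x3 * q) = defect (x3 * g) q" "defect (x1 * g) (x3 * q) = defect (x1 * (x3 * g)) q" for q
    using defect_balance[of g q] defect_balance[of "x1 * g" q] by (simp_all add: ac_simps)
  \<comment> \<open>By \<open>T_defect\<close> the balance of the defects carries over to
    \<open>T\<close>.\<close>
  then have T0: "T (x3 * D2 p) g t = T (D2 p) (x3 * g) t"
    unfolding T_defect by simp
  have *: "C (x3 * D2 p) g t - C (D2 p) (x3 * g) t = C x3 (g * D2 p) t"
    using T0 unfolding T_def D_rules D_comm
    by (simp add: C_lin algebra_simps)
  have 1: "e (x3 * x3) * C x2 v t = (e x3 * C x2 (x3 * v) t + C x3 v t) + (e x3 * C x2 (x3 * v) t + C x3 v t)"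
     "e (x3 * x3) * C x3 v t = (e x3 * C x3 (x3 * v) t) + (e x3 * C x3 (x3 * v) t)" for v
    unfolding e_sq_C D_rules by (simp_all add: C_lin)
  have 2: "e (x3 * x3) * C p g t = (e x3 * C p (x3 * g) t + C x3 (g * D2 p) t) + (e x3 * C p (x3 * g) t + C x3 (g * D2 p) t)"
    unfolding e_sq_C *[symmetric] by (simp add: algebra_simps)
  show ?thesis
    unfolding T_def right_diff_distrib 1 2 by (simp add: algebra_simps)
qed

text \<open>The operator \<open>P x1 x2\<close>, which acts by \<open>D3\<close>, commutes with
  every \<open>T' g\<close> and with \<open>e x3\<close>, but has commutator \<open>2 e x3\<close>
  with \<open>e (x3 * x3)\<close>. Commuting it with \<open>e_sq_T\<close> therefore gives
  \<open>e x3 * T' g = 0\<close>. The operator \<open>P x2 x3\<close>, which acts by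
  \<open>D1\<close>, then removes the factor \<open>x1\<close> inside \<open>T' g\<close> and leaves
  a single defect.\<close>

lemma defect_p2_p3: "defect g p * (P x3 x1 * P x1 x2) = 0"
proof -
  define T' where "T' g = defect (x1 * g) p * P x1 x2 + defect g p * e (x1 * x2)" for g
  have "br x1 x2 (x1 * x2) = 0" "br x1 x2 (x3 * x3) = x3 + x3"
    "br x2 x3 (x1 * x2) = x2"
    unfolding br_def by (simp_all add: D_rules)
  note br = this
  let ?p = "P x1 x2"
  have c1: "?p * e (x1 * x2) = e (x1 * x2) * ?p"
    using lie[of x1 x2 "x1 * x2" x1] unfolding e_def by (simp add: br br_alt)
  have cT: "?p * T' g = T' g * ?p" for g
  proof -
    have "?p * T' g = (?p * defect (x1 * g) p) * ?p + (?p * defect g p) * e (x1 * x2)"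
      unfolding T'_def by (simp add: algebra_simps)
    also have "\<dots> = defect (x1 * g) p * ?p * ?p + defect g p * (?p * e (x1 * x2))"
      unfolding defect_central[symmetric] by (simp add: algebra_simps)
    also have "\<dots> = T' g * ?p"
      unfolding c1 T'_def by (simp add: algebra_simps)
    finally show ?thesis .
  qed
  have c2: "?p * e x3 = e x3 * ?p"
    using lie[of x1 x2 x3 x1] unfolding e_def by (simp add: br_coord D_rules)
  have c3: "?p * e (x3 * x3) = e (x3 * x3) * ?p + (e x3 + e x3)"
    using lie[of x1 x2 "x3 * x3" x1] unfolding e_def by (simp add: br br_alt P_lin P_double algebra_simps)
  have eT: "e (x3 * x3) * T' g = e x3 * T' (x3 * g) + e x3 * T' (x3 * g)" for g
    using e_sq_T[of p g x2] unfolding T_defect T'_def .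
  have "?p * (e (x3 * x3) * T' g) = (?p * e (x3 * x3)) * T' g" for g
    by (simp add: mult.assoc)
  also have "\<dots> g = (e (x3 * x3) * T' g) * ?p + (e x3 * T' g + e x3 * T' g)" for g
    unfolding c3 by (simp add: algebra_simps cT)
  finally have *: "?p * (e (x3 * x3) * T' g) = (e (x3 * x3) * T' g) * ?p + (e x3 * T' g + e x3 * T' g)" for g .
  have "?p * (e x3 * T' h) = e x3 * T' h * ?p" for h
    using cT[of h] c2 by (metis mult.assoc)
  then have "?p * (e (x3 * x3) * T' g) = (e (x3 * x3) * T' g) * ?p" for g
    unfolding eT by (simp add: algebra_simps)
  with * have "e x3 * T' g + e x3 * T' g = 0" for g
    by simp
  then have "e x3 * T' g = 0" for g by (rule torsion_free(1))
  note eT0 = this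
  \<comment> \<open>This operator commutes with \<open>e x3\<close> and with \<open>P x1 x2\<close>;
    its only nonzero commutator here is with \<open>e (x1 * x2)\<close>, where \<open>D1\<close>
    turns \<open>x1 * x2\<close> into \<open>x2\<close>.\<close>
  let ?q = "P x2 x3"
  have d1: "?q * e (x1 * x2) = e (x1 * x2) * ?q - ?p"
    using lie[of x2 x3 "x1 * x2" x1] P_swap[of x1 x2] unfolding e_def 
    by (simp add: br br_coord D_rules algebra_simps eq_neg_iff_add_eq_0)
  have d2: "?q * e x3 = e x3 * ?q"
    using lie[of x2 x3 x3 x1] unfolding e_def by (simp add: br_coord D_rules)
  have d3: "?q * ?p = ?p * ?q"
    using lie[of x2 x3 x1 x2] by (simp add: br_coord D_rules)
  have dT: "?q * T' g = T' g * ?q - defect g p * ?p"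
  proof -
    have "?q * T' g = (?q * defect (x1 * g) p) * ?p + (?q * defect g p) * e (x1 * x2)"
      unfolding T'_def by (simp add: algebra_simps)
    also have "\<dots> = defect (x1 * g) p * (?q * ?p) + defect g p * (?q * e (x1 * x2))"
      unfolding defect_central[symmetric] by (simp add: algebra_simps)
    also have "\<dots> = T' g * ?q - defect g p * ?p"
      unfolding d1 d3 T'_def by (simp add: algebra_simps)
    finally show ?thesis .
  qed
  have "0 = ?q * (e x3 * T' g)" by (simp add: eT0)
  also have "\<dots> = e x3 * (?q * T' g)" using d2 by (metis mult.assoc)
  also have "\<dots> = e x3 * T' g * ?q - e x3 * defect g p * ?p"
    unfolding dT by (simp add: algebra_simps)
  also have "\<dots> = - (defect g p * (e x3 * ?p))"
    unfolding eT0 unfolding e_def defect_central[symmetric] by (simp add: mult.assoc)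
  finally show ?thesis unfolding e_def by simp
qed

text \<open>The hypothesis, commuted with a suitable operator, makes \<open>P x1 x2\<close> square
  to zero. A square-zero operator that differentiates powers of \<open>x3\<close> inside
  \<open>e\<close> forces \<open>e x3 = 0\<close>, and commutators with \<open>e x3\<close> and with
  quadratic-free fields reach all of \<open>P\<close>.\<close>

lemma P_zero_if: 
  assumes "P x3 x1 * P x1 x2 = 0"
  shows "P f g = 0"
proof -
  let ?p = "P x1 x2"
  have "br x1 (x2 * x2) x3 = x2 + x2" "br x1 (x2 * x2) x1 = 0" "br x1 (x2 * x2) x2 = 0"
    unfolding br_def by (simp_all add: D_rules)
  note br = this
  \<comment> \<open>Its field sends \<open>x3\<close> to \<open>2 x2\<close> and kills
    \<open>x1\<close> and \<open>x2\<close>, so its commutator turns the factor \<open>e x3\<close>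
    into a multiple of \<open>P x1 x2\<close>.\<close>
  let ?Q = "P x1 (x2 * x2)"
  have "?Q * e x3 = e x3 * ?Q + (P x2 x1 + P x2 x1)"
    using lie[of x1 "x2 * x2" x3 x1] unfolding e_def by (simp add: br P_lin P_double algebra_simps)
  then have 1: "?Q * e x3 = e x3 * ?Q - (?p + ?p)"
    using P_swap[of x1 x2] by (simp add: algebra_simps)
  have 2: "?Q * ?p = ?p * ?Q"
    using lie[of x1 "x2 * x2" x1 x2] by (simp add: br)
  have z: "e x3 * ?p = 0" using assms unfolding e_def .
  have "0 = ?Q * (e x3 * ?p)" by (simp add: z)
  also have "\<dots> = (?Q * e x3) * ?p" by (simp add: mult.assoc)
  also have "\<dots> = e x3 * (?Q * ?p) - (?p * ?p + ?p * ?p)" unfolding 1 by (simp add: algebra_simps)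
  also have "\<dots> = - (?p * ?p + ?p * ?p)"
    unfolding 2 using z by (simp flip: mult.assoc)
  finally have "- (?p * ?p + ?p * ?p) = 0" by (rule sym)
  then have "?p * ?p + ?p * ?p = 0" by (simp only: neg_equal_0_iff_equal)
  then have pp: "?p * ?p = 0" by (rule torsion_free(1))
  \<comment> \<open>This is the commutator of \<open>?p * ?p = 0\<close> with \<open>P s t\<close>:
    each of the two factors is commuted in turn.\<close>
  have anti: "?p * P (D3 s) t + P (D3 s) t * ?p = 0" if "D3 t = 0" for s t
  proof -
    have "?p * P s t = P s t * ?p + P (D3 s) t"
      using lie[of x1 x2 s t] that by (simp add: br_coord algebra_simps)
    note 3 = this
    have "0 = (?p * ?p) * P s t" by (simp add: pp)
    also have "\<dots> = ?p * (P s t * ?p + P (D3 s) t)" unfolding 3[symmetric] by (simp add: mult.assoc)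
    also have "\<dots> = (?p * P s t) * ?p + ?p * P (D3 s) t" by (simp add: algebra_simps)
    also have "\<dots> = P s t * (?p * ?p) + P (D3 s) t * ?p + ?p * P (D3 s) t" unfolding 3 by (simp add: algebra_simps)
    finally show ?thesis by (simp add: pp algebra_simps)
  qed
  have D3sq: "D3 (x3 * x3) = x3 + x3" "D3 (x3 * x3 * x3) = x3 * x3 + x3 * x3 + x3 * x3"
    "D3 (x3 * x3 * x3 * x3) = x3 * x3 * x3 + x3 * x3 * x3 + x3 * x3 * x3 + x3 * x3 * x3"
    by (simp_all add: D_rules algebra_simps)
  have l: "?p * e s - e s * ?p = e (D3 s)" for s
    using lie[of x1 x2 s x1] unfolding e_def by (simp add: br_coord D_rules)
  \<comment> \<open>The third and fourth powers of \<open>x3\<close> are used so that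
    \<open>?p\<close> anticommutes with \<open>e\<close> of the square and of the cube. Combined
    with the commutators this gives \<open>?p * e (x3^2) = e x3\<close> and
    \<open>2 ?p * e (x3^3) = 3 e (x3^2)\<close>, hence
    \<open>3 e x3 = 2 ?p^2 * e (x3^3) = 0\<close>.\<close>
  have "(?p * e (x3 * x3) + e (x3 * x3) * ?p) + (?p * e (x3 * x3) + e (x3 * x3) * ?p)
      + (?p * e (x3 * x3) + e (x3 * x3) * ?p) = 0"
    using anti[of x1 "x3 * x3 * x3"] unfolding e_def D3sq P_add_left by (simp add: D_x distrib_left distrib_right ac_simps)
  then have a2: "?p * e (x3 * x3) + e (x3 * x3) * ?p = 0" by (rule torsion_free(2))
  have "(?p * e (x3 * x3 * x3) + e (x3 * x3 * x3) * ?p) + (?p * e (x3 * x3 * x3) + e (x3 * x3 * x3) * ?p) + 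
     ((?p * e (x3 * x3 * x3) + e (x3 * x3 * x3) * ?p) + (?p * e (x3 * x3 * x3) + e (x3 * x3 * x3) * ?p)) = 0"
    using anti[of x1 "x3 * x3 * x3 * x3"] unfolding e_def D3sq P_add_left by (simp add: D_x distrib_left distrib_right ac_simps)
  then have a3: "?p * e (x3 * x3 * x3) + e (x3 * x3 * x3) * ?p = 0"
    by (rule torsion_free(1)[OF torsion_free(1)])
  have ll: "?p * e s + ?p * e s = e (D3 s)" if "?p * e s + e s * ?p = 0" for s
  proof -
    have "?p * e s + ?p * e s = (?p * e s - e s * ?p) + (?p * e s + e s * ?p)" by simp
    then show ?thesis unfolding that l by simp
  qed
  have "?p * e (x3 * x3) + ?p * e (x3 * x3) = e x3 + e x3"
    using ll[OF a2] unfolding D3sq e_lin .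
  then have b2: "?p * e (x3 * x3) = e x3" by (rule double_cancel)
  have b3: "?p * e (x3 * x3 * x3) + ?p * e (x3 * x3 * x3) = e (x3 * x3) + e (x3 * x3) + e (x3 * x3)"
    using ll[OF a3] unfolding D3sq e_lin .
  have "e x3 + e x3 + e x3 = ?p * (e (x3 * x3) + e (x3 * x3) + e (x3 * x3))"
    by (simp add: b2 algebra_simps)
  also have "\<dots> = (?p * ?p) * (e (x3 * x3 * x3) + e (x3 * x3 * x3))"
    unfolding b3[symmetric] by (simp add: algebra_simps)
  finally have "e x3 + e x3 + e x3 = 0" unfolding pp by simp
  then have p2: "e x3 = 0" by (rule torsion_free(2))
  \<comment> \<open>The field of \<open>P x3 x1\<close> is \<open>D2\<close>, so every
    \<open>e s\<close> is the commutator of \<open>e x3\<close> with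
    \<open>e (I2 s)\<close>.\<close>
  have e0: "e s = 0" for s
    using lie[of x3 x1 "I2 s" x1] p2 unfolding e_def by (simp add: br_coord D_rules)
  \<comment> \<open>This field sends \<open>x1\<close> to \<open>f\<close>; commuting its operator
    with \<open>P g x1 = 0\<close> replaces the coordinate by an arbitrary series.\<close>
  have "br (I2 f) x3 x1 = f" unfolding br_def by (simp add: D_rules)
  then have "P g f = 0"
    using lie[of "I2 f" x3 g x1] e0 unfolding e_def by simp
  then show ?thesis unfolding P_swap[of f g] by simp
qed

theorem defect_zero:
  assumes "\<And>f p r. defect f p * r = 0 \<Longrightarrow> defect f p = 0 \<or> r = 0"
  shows "defect f p = 0"
proof (rule ccontr)
  assume "defect f p \<noteq> 0"
  then have "P x3 x1 * P x1 x2 = 0"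
    using assms defect_p2_p3 by blast
  from P_zero_if[OF this] \<open>defect f p \<noteq> 0\<close> show False unfolding defect_def by simp
qed

end

section \<open>Formal power series\<close>

abbreviation mono1 :: "nat \<Rightarrow> (nat \<Rightarrow>\<^sub>0 nat)" where "mono1 i \<equiv> Poly_Mapping.single i 1"

lemma mcoeff_simps [simp]:
  "mcoeff 0 m = 0" "mcoeff (f + g) m = mcoeff f m + mcoeff g m" "mcoeff (- f) m = - mcoeff f m"
  "mcoeff (f - g) m = mcoeff f m - mcoeff g m" "mcoeff (mfps_scale c f) m = c * mcoeff f m"
  by (simp_all add: zero_mfps.rep_eq plus_mfps.rep_eq uminus_mfps.rep_eq minus_mfps.rep_eq mfps_scale.rep_eq)

lemma mcoeff_mult: "mcoeff (f * g) m = (\<Sum>(a, b)\<in>splits m. mcoeff f a * mcoeff g b)"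
  by (simp add: times_mfps.rep_eq)

lemma mcoeff_pderiv: "mcoeff (pderiv_at i f) m = of_nat (Poly_Mapping.lookup m i + 1) * mcoeff f (m + mono1 i)"
  by (simp add: pderiv_at.rep_eq)

lemma lookup_mono1: "Poly_Mapping.lookup (mono1 i) j = (if i = j then 1 else 0)"
  "Poly_Mapping.lookup (Poly_Mapping.single i (Suc 0)) j = (if i = j then 1 else 0)"
  by (simp_all add: lookup_single when_def)

text \<open>The weight is zero unless the left factor contains the variable, and such splittings of
  \<open>m + mono1 i\<close> arise from those of \<open>m\<close> by raising the exponent in the
  left factor.\<close>

lemma sum_splits_left:
  "(\<Sum>(a, b)\<in>splits (m + mono1 i). of_nat (Poly_Mapping.lookup a i) * (f a * g b))
   = (\<Sum>(a, b)\<in>splits m. of_nat (Poly_Mapping.lookup a i + 1) * f (a + mono1 i) * g b :: 'a::comm_ring_1)"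
proof -
  let ?h = "\<lambda>(a, b). (a + mono1 i, b)"
  have inj: "inj_on ?h (splits m)" by (auto simp: inj_on_def)
  have "(\<Sum>(a, b)\<in>splits m. of_nat (Poly_Mapping.lookup a i + 1) * f (a + mono1 i) * g b)
     = (\<Sum>(a, b)\<in>?h ` splits m. of_nat (Poly_Mapping.lookup a i) * (f a * g b))"
    by (subst sum.reindex[OF inj]) 
       (auto intro!: sum.cong simp: lookup_add lookup_mono1 mult.assoc)
  also have "\<dots> = (\<Sum>(a, b)\<in>splits (m + mono1 i). of_nat (Poly_Mapping.lookup a i) * (f a * g b))"
  proof (rule sum.mono_neutral_left)
    show "?h ` splits m \<subseteq> splits (m + mono1 i)" by (auto simp: mem_splits ac_simps)
    show "\<forall>x\<in>splits (m + mono1 i) - ?h ` splits m. (case x of (a, b) \<Rightarrow> of_nat (Poly_Mapping.lookup a i) * (f a * g b)) = 0"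
    proof (clarify)
      fix a b assume ab: "(a, b) \<in> splits (m + mono1 i)" "(a, b) \<notin> ?h ` splits m"
      have "Poly_Mapping.lookup a i = 0"
      proof (rule ccontr)
        assume "Poly_Mapping.lookup a i \<noteq> 0"
        then have a: "a - mono1 i + mono1 i = a"
          by (intro poly_mapping_eqI) (auto simp: lookup_add lookup_minus lookup_mono1)
        then have "(a - mono1 i + b) + mono1 i = m + mono1 i"
          using ab(1) by (metis add.assoc add.commute mem_splits)
        then have "(a - mono1 i, b) \<in> splits m" by (simp add: mem_splits)
        then have "(a, b) \<in> ?h ` splits m" using a by force
        then show False using ab by simp
      qed
      then show "of_nat (Poly_Mapping.lookup a i) * (f a * g b) = 0" by simp
    qed
  qed simp
  finally show ?thesis ..
qed

lemma sum_splits_swap: "(\<Sum>(a, b)\<in>splits m. h a b) = (\<Sum>(a, b)\<in>splits m. h b a)"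
  by (rule sum.reindex_bij_witness[of _ prod.swap prod.swap]) (auto simp: mem_splits add.commute)

lemma pderiv_mult: "pderiv_at i (f * g) = pderiv_at i f * g + f * pderiv_at i g" for f g :: "'a::comm_ring_1 mfps"
proof (rule mfps_eqI)
  fix m
  let ?f = "mcoeff f" and ?g = "mcoeff g" and ?l = "\<lambda>a. of_nat (Poly_Mapping.lookup a i) :: 'a"
  have "mcoeff (pderiv_at i (f * g)) m
      = (\<Sum>(a, b)\<in>splits (m + mono1 i). of_nat (Poly_Mapping.lookup m i + 1) * (?f a * ?g b))"
    by (simp add: mcoeff_pderiv mcoeff_mult sum_distrib_left case_prod_unfold)
  \<comment> \<open>The exponent of the variable in the product is the sum of its exponents in the
    two factors; this is where the two terms of the product rule separate.\<close>
  also have "\<dots> = (\<Sum>(a, b)\<in>splits (m + mono1 i). ?l a * (?f a * ?g b) + ?l b * (?f a * ?g b))"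
  proof (rule sum.cong[OF refl], clarify)
    fix a b assume "(a, b) \<in> splits (m + mono1 i)"
    then have "Poly_Mapping.lookup (a + b) i = Poly_Mapping.lookup (m + mono1 i) i" by (simp add: mem_splits)
    then have "Poly_Mapping.lookup m i + 1 = Poly_Mapping.lookup a i + Poly_Mapping.lookup b i"
      by (simp add: lookup_add lookup_mono1)
    then show "of_nat (Poly_Mapping.lookup m i + 1) * (?f a * ?g b) = ?l a * (?f a * ?g b) + ?l b * (?f a * ?g b)"
      by (simp only: of_nat_add distrib_right)
  qed
  also have "\<dots> = (\<Sum>(a, b)\<in>splits (m + mono1 i). ?l a * (?f a * ?g b)) + (\<Sum>(a, b)\<in>splits (m + mono1 i). ?l b * (?f a * ?g b))"
    by (simp add: case_prod_unfold sum.distrib)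
  also have "(\<Sum>(a, b)\<in>splits (m + mono1 i). ?l b * (?f a * ?g b)) = (\<Sum>(a, b)\<in>splits (m + mono1 i). ?l a * (?g a * ?f b))"
    by (subst sum_splits_swap) (simp add: mult.commute)
  also have "(\<Sum>(a, b)\<in>splits (m + mono1 i). ?l a * (?f a * ?g b)) + \<dots>
     = mcoeff (pderiv_at i f * g) m + mcoeff (pderiv_at i g * f) m"
    unfolding sum_splits_left by (simp add: mcoeff_mult mcoeff_pderiv)
  finally show "mcoeff (pderiv_at i (f * g)) m = mcoeff (pderiv_at i f * g + f * pderiv_at i g) m"
    by (simp add: mult.commute)
qed

lemma pderiv_add [simp]: "pderiv_at i (f + g) = pderiv_at i f + pderiv_at i g"
  by (rule mfps_eqI) (simp add: mcoeff_pderiv distrib_left)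

lemma pderiv_zero [simp]: "pderiv_at i 0 = 0"
  by (rule mfps_eqI) (simp add: mcoeff_pderiv)

lemma pderiv_uminus [simp]: "pderiv_at i (- f) = - pderiv_at i f"
  by (rule mfps_eqI) (simp add: mcoeff_pderiv)

lemma pderiv_diff [simp]: "pderiv_at i (f - g) = pderiv_at i f - pderiv_at i g"
  by (rule mfps_eqI) (simp add: mcoeff_pderiv right_diff_distrib)

lemma pderiv_sum: "pderiv_at i (sum f A) = (\<Sum>a\<in>A. pderiv_at i (f a))"
  by (induction A rule: infinite_finite_induct) auto

lemma pderiv_scale [simp]: "pderiv_at i (mfps_scale c f) = mfps_scale c (pderiv_at i f)"
  by (rule mfps_eqI) (simp add: mcoeff_pderiv)

lemma pderiv_comm: "pderiv_at i (pderiv_at j f) = pderiv_at j (pderiv_at i f)"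
proof (cases "i = j")
  case False
  then show ?thesis
    by (intro mfps_eqI) (auto simp: mcoeff_pderiv lookup_add lookup_mono1 ac_simps)
qed simp

lemma pderiv_one [simp]: "pderiv_at i 1 = 0"
  using pderiv_mult[of i 1 1] by simp

lemma mfps_scale_mult: "mfps_scale c f * g = mfps_scale c (f * g)" "f * mfps_scale c g = mfps_scale c (f * g)"
  by (rule mfps_eqI, simp add: mcoeff_mult sum_distrib_left case_prod_unfold mult.assoc mult.left_commute)+

lemma mfps_scale_one [simp]: "mfps_scale 1 f = f" "mfps_scale (- 1) f = - f" "mfps_scale 0 f = 0"
  by (rule mfps_eqI, simp)+

lemma mfps_double_zero: "f + f = 0 \<Longrightarrow> f = (0 :: 'a::field_char_0 mfps)"
proof (rule mfps_eqI)
  fix m assume "f + f = 0"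
  then have "mcoeff f m + mcoeff f m = 0" by (metis mcoeff_simps(1,2))
  then have "2 * mcoeff f m = 0" by simp
  then show "mcoeff f m = mcoeff 0 m" by simp
qed

section \<open>Coordinates, and right inverses of the partial derivatives in characteristic
  zero\<close>

definition fvar :: "nat \<Rightarrow> 'a::comm_ring_1 mfps" where
  "fvar j = Abs_mfps (\<lambda>m. if m = mono1 j then 1 else 0)"

lemma mcoeff_fvar: "mcoeff (fvar j) m = (if m = mono1 j then 1 else 0)"
  by (simp add: fvar_def Abs_mfps_inverse)

lemma pderiv_fvar [simp]: "pderiv_at i (fvar j) = (if i = j then 1 else 0)"
proof (rule mfps_eqI)
  fix m
  have 1: "m + mono1 i = mono1 j \<longleftrightarrow> i = j \<and> m = 0"
  proof
    assume a: "m + mono1 i = mono1 j"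
    then have "Poly_Mapping.lookup (m + mono1 i) i = Poly_Mapping.lookup (mono1 j) i" by simp
    then have "i = j" by (auto simp: lookup_add lookup_mono1 split: if_splits)
    with a show "i = j \<and> m = 0" by simp
  qed simp
  show "mcoeff (pderiv_at i (fvar j)) m = mcoeff (if i = j then 1 else 0) m"
    unfolding mcoeff_pderiv mcoeff_fvar 1 by (auto simp: one_mfps.rep_eq)
qed

definition integ :: "nat \<Rightarrow> 'a::field_char_0 mfps \<Rightarrow> 'a mfps" where
  "integ i f = Abs_mfps (\<lambda>m. if Poly_Mapping.lookup m i = 0 then 0 
      else mcoeff f (m - mono1 i) / of_nat (Poly_Mapping.lookup m i))"

lemma mcoeff_integ: "mcoeff (integ i f) m = (if Poly_Mapping.lookup m i = 0 then 0 
      else mcoeff f (m - mono1 i) / of_nat (Poly_Mapping.lookup m i))"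
  by (simp add: integ_def Abs_mfps_inverse)

lemma pderiv_integ [simp]: "pderiv_at i (integ i f) = f"
  by (rule mfps_eqI) (simp add: mcoeff_pderiv mcoeff_integ lookup_add lookup_mono1 del: of_nat_Suc)

lemma pderiv_integ_other:
  assumes "i \<noteq> j"
  shows "pderiv_at j (integ i f) = integ i (pderiv_at j f)"
proof (rule mfps_eqI)
  fix m
  show "mcoeff (pderiv_at j (integ i f)) m = mcoeff (integ i (pderiv_at j f)) m"
  proof (cases "Poly_Mapping.lookup m i = 0")
    case False
    then have "m + mono1 j - mono1 i = m - mono1 i + mono1 j"
      using assms by (intro poly_mapping_eqI) (auto simp: lookup_add lookup_minus lookup_mono1)
    then show ?thesis using assms False
      by (simp add: mcoeff_pderiv mcoeff_integ lookup_add lookup_minus lookup_mono1)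
  qed (use assms in \<open>simp add: mcoeff_pderiv mcoeff_integ lookup_add lookup_mono1\<close>)
qed

lemma integ_zero [simp]: "integ i 0 = 0"
  by (rule mfps_eqI) (simp add: mcoeff_integ)

lemma keys_plus_nat: "Poly_Mapping.keys (a + b) = Poly_Mapping.keys a \<union> Poly_Mapping.keys (b :: nat \<Rightarrow>\<^sub>0 nat)"
  by (auto simp: in_keys_iff lookup_add)

lemma keys_mono1 [simp]: "Poly_Mapping.keys (mono1 i) = {i}"
  by simp

section \<open>The retraction onto series in \<open>n\<close> variables, which sets all further
  variables to zero\<close>

definition trunc :: "nat \<Rightarrow> 'a::comm_ring_1 mfps \<Rightarrow> 'a mfps" where
  "trunc n f = Abs_mfps (\<lambda>m. if Poly_Mapping.keys m \<subseteq> {..<n} then mcoeff f m else 0)"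

lemma mcoeff_trunc: "mcoeff (trunc n f) m = (if Poly_Mapping.keys m \<subseteq> {..<n} then mcoeff f m else 0)"
  by (simp add: trunc_def Abs_mfps_inverse)

lemma trunc_in [simp]: "trunc n f \<in> mfps_in n"
  by (simp add: mfps_in_def mcoeff_trunc)

lemma trunc_ident: "f \<in> mfps_in n \<Longrightarrow> trunc n f = f"
  by (rule mfps_eqI) (auto simp: mfps_in_def mcoeff_trunc)

lemma mfps_in_iff: "f \<in> mfps_in n \<longleftrightarrow> trunc n f = f"
  by (metis trunc_ident trunc_in)

lemma trunc_add [simp]: "trunc n (f + g) = trunc n f + trunc n g"
  and trunc_uminus [simp]: "trunc n (- f) = - trunc n f"
  and trunc_diff [simp]: "trunc n (f - g) = trunc n f - trunc n g"
  and trunc_zero [simp]: "trunc n 0 = 0"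
  and trunc_one [simp]: "trunc n 1 = 1"
  and trunc_scale [simp]: "trunc n (mfps_scale c f) = mfps_scale c (trunc n f)"
  by (rule mfps_eqI, simp add: mcoeff_trunc one_mfps.rep_eq)+

lemma trunc_mult [simp]: "trunc n (f * g) = trunc n f * trunc n g"
proof (rule mfps_eqI)
  fix m
  show "mcoeff (trunc n (f * g)) m = mcoeff (trunc n f * trunc n g) m"
  proof (cases "Poly_Mapping.keys m \<subseteq> {..<n}")
    case True
    have "mcoeff (trunc n f) a * mcoeff (trunc n g) b = mcoeff f a * mcoeff g b" if "(a, b) \<in> splits m" for a b
      using True that by (auto simp: mcoeff_trunc mem_splits keys_plus_nat)
    then show ?thesis using True
      by (auto simp: mcoeff_trunc[of n "f * g"] mcoeff_mult intro!: sum.cong)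
  next
    case False
    have "mcoeff (trunc n f) a * mcoeff (trunc n g) b = 0" if "(a, b) \<in> splits m" for a b
      using False that by (auto simp: mcoeff_trunc mem_splits keys_plus_nat)
    then show ?thesis using False
      by (subst mcoeff_mult, subst sum.neutral) (auto simp: mcoeff_trunc)
  qed
qed

lemma trunc_pderiv: "i < n \<Longrightarrow> trunc n (pderiv_at i f) = pderiv_at i (trunc n f)"
  by (rule mfps_eqI) (auto simp: mcoeff_trunc mcoeff_pderiv keys_plus_nat)

lemma trunc_fvar [simp]: "i < n \<Longrightarrow> trunc n (fvar i) = fvar i"
  by (rule mfps_eqI) (auto simp: mcoeff_trunc mcoeff_fvar)

lemma mfps_in_closed [intro, simp]:
  "f \<in> mfps_in n \<Longrightarrow> g \<in> mfps_in n \<Longrightarrow> f + g \<in> mfps_in n"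
  "f \<in> mfps_in n \<Longrightarrow> g \<in> mfps_in n \<Longrightarrow> f - g \<in> mfps_in n"
  "f \<in> mfps_in n \<Longrightarrow> g \<in> mfps_in n \<Longrightarrow> f * g \<in> mfps_in n"
  "f \<in> mfps_in n \<Longrightarrow> - f \<in> mfps_in n" "0 \<in> mfps_in n" "1 \<in> mfps_in n"
  "f \<in> mfps_in n \<Longrightarrow> mfps_scale c f \<in> mfps_in n"
  "i < n \<Longrightarrow> f \<in> mfps_in n \<Longrightarrow> pderiv_at i f \<in> mfps_in n"
  "i < n \<Longrightarrow> fvar i \<in> mfps_in n"
  by (simp_all add: mfps_in_iff trunc_pderiv)

lemma mfps_in_sum: "(\<And>a. a \<in> A \<Longrightarrow> f a \<in> mfps_in n) \<Longrightarrow> sum f A \<in> mfps_in n"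
  by (induction A rule: infinite_finite_induct) auto

section \<open>Alternating maps\<close>

definition omit :: "nat \<Rightarrow> 'a list \<Rightarrow> 'a list" where "omit i xs = take i xs @ drop (Suc i) xs"

text \<open>Signs are applied as group operations, so that they make sense in additive groups and in
  rings without a chosen unit.\<close>

definition signed :: "nat \<Rightarrow> 'r::ab_group_add \<Rightarrow> 'r" where "signed k r = (if even k then r else - r)"

lemma signed_simps [simp]: "signed 0 r = r" "signed (Suc k) r = - signed k r" "signed k 0 = 0"
  "signed k (signed k r) = r"
  by (auto simp: signed_def)

lemma signed_add: "signed k (a + b) = signed k a + signed k b"
  by (simp add: signed_def)

lemma signed_minus: "signed k (- a) = - signed k a"
  by (simp add: signed_def)

lemma signed_signed: "signed k (signed l r) = signed (k + l) r"
  by (auto simp: signed_def)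

lemma signed_sum: "signed k (sum f A) = (\<Sum>a\<in>A. signed k (f a))"
  by (simp add: signed_def sum_negf)

lemma signed_cong: "even k = even l \<Longrightarrow> signed k r = signed l r"
  by (simp add: signed_def)

lemma length_omit [simp]: "i < length xs \<Longrightarrow> length (omit i xs) = length xs - 1"
  by (simp add: omit_def)

lemma nth_omit: "i < length xs \<Longrightarrow> j < length xs - 1 \<Longrightarrow> omit i xs ! j = (if j < i then xs ! j else xs ! Suc j)"
  by (auto simp: omit_def nth_append)

lemma omit_in_tuples: "xs \<in> tuples n W \<Longrightarrow> i < n \<Longrightarrow> omit i xs \<in> tuples (n - 1) W"
  by (auto simp: tuples_def omit_def dest: in_set_takeD in_set_dropD)

lemma omit_update_same: "i < length xs \<Longrightarrow> omit i (xs[i := u]) = omit i xs"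
  by (simp add: omit_def)

lemma omit_update_less: "j < i \<Longrightarrow> i < length xs \<Longrightarrow> omit i (xs[j := u]) = (omit i xs)[j := u]"
  by (rule nth_equalityI) (auto simp: nth_omit nth_list_update)

lemma omit_update_greater: "i < j \<Longrightarrow> j < length xs \<Longrightarrow> omit i (xs[j := u]) = (omit i xs)[j - 1 := u]"
  by (rule nth_equalityI) (auto simp: nth_omit nth_list_update)

lemma map_omit: "map f (omit i xs) = omit i (map f xs)"
  by (simp add: omit_def take_map drop_map)

lemma tuples_update: "xs \<in> tuples n W \<Longrightarrow> u \<in> W \<Longrightarrow> xs[i := u] \<in> tuples n W"
  by (auto simp: tuples_def dest: set_update_subset_insert[THEN subsetD])

lemma tuples_nth: "xs \<in> tuples n W \<Longrightarrow> i < n \<Longrightarrow> xs ! i \<in> W"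
  by (auto simp: tuples_def)

lemma tuples_length: "xs \<in> tuples n W \<Longrightarrow> length xs = n"
  by (simp add: tuples_def)

lemma sum_skip: "k < n \<Longrightarrow> (\<Sum>i<n. f i) = f k + (\<Sum>i<n - 1. f (if i < k then i else Suc i) :: 'r::ab_group_add)"
proof -
  assume k: "k < n"
  have "(\<Sum>i<n. f i) = f k + (\<Sum>i\<in>{..<n} - {k}. f i)"
    using k by (simp add: sum.remove)
  also have "(\<Sum>i\<in>{..<n} - {k}. f i) = (\<Sum>i<n - 1. f (if i < k then i else Suc i))"
    by (rule sum.reindex_bij_witness[of _ "\<lambda>i. if i < k then i else Suc i" "\<lambda>i. if i < k then i else i - 1"])
       (use k in auto)
  finally show ?thesis .
qed

locale alt_map =
  fixes n :: nat and W :: "'w::ab_group_add set" and F :: "'w list \<Rightarrow> 'r::ab_group_add"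
  assumes W_add: "u \<in> W \<Longrightarrow> v \<in> W \<Longrightarrow> u + v \<in> W"
    and F_add: "\<lbrakk>xs \<in> tuples n W; i < n; u \<in> W; v \<in> W\<rbrakk> \<Longrightarrow> F (xs[i := u + v]) = F (xs[i := u]) + F (xs[i := v])"
    and F_alt: "\<lbrakk>xs \<in> tuples n W; i < j; j < n; xs ! i = xs ! j\<rbrakk> \<Longrightarrow> F xs = 0"
begin

lemma F_alt': "\<lbrakk>xs \<in> tuples n W; i \<noteq> j; i < n; j < n; xs ! i = xs ! j\<rbrakk> \<Longrightarrow> F xs = 0"
  using F_alt[of xs i j] F_alt[of xs j i] by (cases i j rule: linorder_cases) auto

lemma F_swap:
  assumes xs: "xs \<in> tuples n W" and ij: "i < n" "j < n" "i \<noteq> j"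
  shows "F (xs[i := xs ! j, j := xs ! i]) = - F xs"
proof -
  let ?a = "xs ! i" and ?b = "xs ! j"
  have W: "?a \<in> W" "?b \<in> W" "?a + ?b \<in> W" using xs ij by (auto intro: tuples_nth W_add)
  have len: "length xs = n" using xs by (rule tuples_length)
  have [simp]: "xs[i := u, j := v] \<in> tuples n W" if "u \<in> W" "v \<in> W" for u v
    using xs that by (intro tuples_update)
  have z: "F (xs[i := u, j := u]) = 0" if "u \<in> W" for u
    using that ij len by (intro F_alt'[of _ i j]) (auto simp: nth_list_update)
  have sw: "xs[i := u, j := v] = xs[j := v, i := u]" for u v
    using ij by (rule_tac list_update_swap)
  have "0 = F (xs[i := ?a + ?b, j := ?a + ?b])" using z W by simp
  also have "\<dots> = F (xs[i := ?a + ?b, j := ?a]) + F (xs[i := ?a + ?b, j := ?b])"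
    using xs W ij by (intro F_add tuples_update)
  also have "\<dots> = F (xs[i := ?a, j := ?a]) + F (xs[i := ?b, j := ?a]) + (F (xs[i := ?a, j := ?b]) + F (xs[i := ?b, j := ?b]))"
    unfolding sw using ij W xs by (simp only: F_add tuples_update)
  also have "\<dots> = F (xs[i := ?b, j := ?a]) + F xs"
    using z[OF W(1)] z[OF W(2)] by simp
  finally show ?thesis by (simp add: eq_neg_iff_add_eq_0)
qed

text \<open>The entry reaches the end by \<open>n - 1 - i\<close> exchanges of neighbours.\<close>

lemma F_move_last:
  assumes "xs \<in> tuples n W" "i < n"
  shows "F (omit i xs @ [xs ! i]) = signed (n - 1 - i) (F xs)"
  using assms
proof (induction "n - 1 - i" arbitrary: i xs)
  case 0
  then have "i = n - 1" "length xs = n" by (auto simp: tuples_length)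
  then have "omit i xs @ [xs ! i] = xs"
    using 0(3) by (intro nth_equalityI) (auto simp: nth_append nth_omit less_Suc_eq_le intro: arg_cong[of _ _ "(!) xs"])
  then show ?case using 0 by simp
next
  case (Suc k)
  then have i: "Suc i < n" by auto
  have len: "length xs = n" using Suc by (auto simp: tuples_length)
  define ys where "ys = xs[i := xs ! Suc i, Suc i := xs ! i]"
  have ys: "ys \<in> tuples n W" unfolding ys_def using Suc i by (intro tuples_update) (auto intro: tuples_nth)
  have "omit (Suc i) ys @ [ys ! Suc i] = omit i xs @ [xs ! i]"
    using i len by (intro nth_equalityI) (auto simp: ys_def nth_append nth_omit nth_list_update less_Suc_eq_le)
  moreover have "F (omit (Suc i) ys @ [ys ! Suc i]) = signed (n - 1 - Suc i) (F ys)"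
    using Suc i ys by (intro Suc.hyps(1)) auto
  moreover have "F ys = - F xs" unfolding ys_def using i Suc by (intro F_swap) auto
  moreover have "n - 1 - i = Suc (n - 1 - Suc i)" using i by simp
  ultimately show ?case by (simp add: signed_minus)
qed

lemma F_zero:
  assumes "xs \<in> tuples n W" "i < n" "0 \<in> W"
  shows "F (xs[i := 0]) = 0"
  using F_add[of xs i 0 0] assms by simp

text \<open>Two omissions that leave the same entries differ by a cyclic permutation.\<close>

lemma F_omit_equal:
  assumes xs: "xs \<in> tuples (Suc n) W" and ij: "i < j" "j < Suc n" and eq: "xs ! i = xs ! j"
  shows "signed (n - i) (F (omit i xs)) + signed (n - j) (F (omit j xs)) = 0"
proof -
  have len: "length xs = Suc n" using xs by (rule tuples_length)
  have t: "omit i xs \<in> tuples n W" "omit j xs \<in> tuples n W"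
    using omit_in_tuples[OF xs, of i] omit_in_tuples[OF xs, of j] ij by auto
  have "omit (j - 1) (omit i xs) @ [omit i xs ! (j - 1)] = omit i (omit j xs) @ [omit j xs ! i]"
    using ij len eq by (intro nth_equalityI) (auto simp: nth_append nth_omit)
  then have "signed (n - 1 - (j - 1)) (F (omit i xs)) = signed (n - 1 - i) (F (omit j xs))"
    using F_move_last[OF t(1), of "j - 1"] F_move_last[OF t(2), of i] ij by simp
  moreover have "n - 1 - (j - 1) = n - j" using ij by simp
  ultimately have *: "signed (n - j) (F (omit i xs)) = signed (n - 1 - i) (F (omit j xs))" by simp
  have "signed (n - i) (F (omit i xs)) = signed ((n - i) + (n - j)) (signed (n - j) (F (omit i xs)))"
    unfolding signed_signed by (rule signed_cong) auto
  also have "\<dots> = signed ((n - i) + (n - j) + (n - 1 - i)) (F (omit j xs))" unfolding * signed_signed ..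
  also have "\<dots> = signed (Suc (n - j)) (F (omit j xs))"
  proof (rule signed_cong)
    have "n - i = Suc (n - 1 - i)" using ij by simp
    moreover have "even (Suc a + b + a) = even (Suc b)" for a b :: nat by presburger
    ultimately show "even (n - i + (n - j) + (n - 1 - i)) = even (Suc (n - j))" by presburger
  qed
  finally show ?thesis by simp
qed

end

section \<open>The Jacobian bracket\<close>

text \<open>Coefficient of the \<open>r\<close>-th partial derivative of entry \<open>k\<close> in
  the Jacobian bracket. It does not see entry \<open>k\<close> itself, so the bracket depends on
  that entry through a first-order operator with fixed coefficients.\<close>

definition jcof :: "nat \<Rightarrow> 'a::comm_ring_1 mfps list \<Rightarrow> nat \<Rightarrow> nat \<Rightarrow> 'a mfps" where
  "jcof n fs k r = cofactor (mat n n (\<lambda>(i, j). pderiv_at i (fs ! j))) r k"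

lemma jcof_update: 
  assumes "k < n" "r < n" "length fs = n"
  shows "jcof n (fs[k := f]) k r = jcof n fs k r"
proof -
  have "mat_delete (mat n n (\<lambda>(i, j). pderiv_at i (fs[k := f] ! j))) r k
     = mat_delete (mat n n (\<lambda>(i, j). pderiv_at i (fs ! j))) r k"
    using assms by (intro eq_matI) (auto simp: mat_delete_def nth_list_update)
  then show ?thesis unfolding jcof_def cofactor_def by simp
qed

lemma jac_jcof:
  assumes "k < n" "length fs = n"
  shows "jacobian_bracket n (fs[k := f]) = (\<Sum>r<n. pderiv_at r f * jcof n fs k r)"
proof -
  have "jacobian_bracket n (fs[k := f]) = (\<Sum>r<n. mat n n (\<lambda>(i, j). pderiv_at i (fs[k := f] ! j)) $$ (r, k) * jcof n (fs[k := f]) k r)"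
    unfolding jacobian_bracket_def jcof_def by (rule laplace_expansion_column) (use assms in auto)
  then show ?thesis using assms by (simp add: jcof_update)
qed

lemma jac_fvar: "k < n \<Longrightarrow> length fs = n \<Longrightarrow> r < n \<Longrightarrow> jacobian_bracket n (fs[k := fvar r]) = jcof n fs k r"
  by (simp add: jac_jcof if_distrib if_distribR sum.delta cong: if_cong)

lemma jac_chain:
  assumes "k < n" "length fs = n"
  shows "jacobian_bracket n (fs[k := f]) = (\<Sum>r<n. pderiv_at r f * jacobian_bracket n (fs[k := fvar r]))"
  using assms by (simp add: jac_jcof[of k n fs f] jac_fvar)

lemma jac_add: "k < n \<Longrightarrow> length fs = n \<Longrightarrow>
   jacobian_bracket n (fs[k := f + g]) = jacobian_bracket n (fs[k := f]) + jacobian_bracket n (fs[k := g])"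
  by (simp add: jac_jcof distrib_right sum.distrib)

lemma mfps_scale_add: "mfps_scale c (f + g) = mfps_scale c f + mfps_scale c g"
  by (rule mfps_eqI) (simp add: distrib_left)

lemma sum_scale: "mfps_scale c (sum f A) = (\<Sum>a\<in>A. mfps_scale c (f a))"
  by (induction A rule: infinite_finite_induct) (auto simp: mfps_scale_add intro: mfps_eqI)

lemma jac_scale: "k < n \<Longrightarrow> length fs = n \<Longrightarrow>
   jacobian_bracket n (fs[k := mfps_scale c f]) = mfps_scale c (jacobian_bracket n (fs[k := f]))"
  by (simp add: jac_jcof sum_scale mfps_scale_mult)

lemma jac_one: "k < n \<Longrightarrow> length fs = n \<Longrightarrow> jacobian_bracket n (fs[k := 1]) = 0"
  by (simp add: jac_jcof)

lemma jac_alt: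
  assumes "i < n" "j < n" "i \<noteq> j" "length fs = n" "fs ! i = fs ! j"
  shows "jacobian_bracket n fs = 0"
  unfolding jacobian_bracket_def
  by (rule det_identical_columns[of _ n i j]) (use assms in \<open>auto intro!: eq_vecI\<close>)

lemma trunc_jac:
  assumes "length fs = n" 
  shows "trunc n (jacobian_bracket n fs) = jacobian_bracket n (map (trunc n) fs)"
proof -
  interpret comm_ring_hom "trunc n :: 'a mfps \<Rightarrow> 'a mfps"
    by unfold_locales auto
  show ?thesis
    unfolding jacobian_bracket_def hom_det[symmetric] using assms
    by (intro arg_cong[of _ _ det] eq_matI) (auto simp: trunc_pderiv)
qed

lemma jac_in: "set fs \<subseteq> mfps_in n \<Longrightarrow> length fs = n \<Longrightarrow> jacobian_bracket n fs \<in> mfps_in n"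
proof -
  assume a: "set fs \<subseteq> mfps_in n" "length fs = n"
  then have "map (trunc n) fs = fs" by (intro map_idI trunc_ident) auto
  then show ?thesis using trunc_jac[OF a(2)] by (simp add: mfps_in_iff)
qed

section \<open>Divergence-free vector fields\<close>

definition vf :: "nat \<Rightarrow> (nat \<Rightarrow> 'a::comm_ring_1 mfps) \<Rightarrow> 'a mfps \<Rightarrow> 'a mfps" where
  "vf n c g = (\<Sum>r<n. c r * pderiv_at r g)"

definition vdiv :: "nat \<Rightarrow> (nat \<Rightarrow> 'a::comm_ring_1 mfps) \<Rightarrow> 'a mfps" where
  "vdiv n c = (\<Sum>r<n. pderiv_at r (c r))"

lemma vf_fvar: "i < n \<Longrightarrow> vf n c (fvar i) = c i"
  by (simp add: vf_def if_distrib[of "(*) _"] sum.delta' cong: if_cong)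

lemma vf_add: "vf n c (f + g) = vf n c f + vf n c g"
  by (simp add: vf_def distrib_left sum.distrib)

lemma pderiv_prod:
  "finite S \<Longrightarrow> pderiv_at r (prod h S) = (\<Sum>k\<in>S. \<Prod>j\<in>S. if j = k then pderiv_at r (h j) else h j)"
proof (induction S rule: finite_induct)
  case (insert x S)
  have 1: "(\<Prod>j\<in>S. if j = x then pderiv_at r (h j) else h j) = prod h S"
    using insert(2) by (intro prod.cong) auto
  have 2: "(\<Prod>j\<in>insert x S. if j = k then pderiv_at r (h j) else h j)
     = h x * (\<Prod>j\<in>S. if j = k then pderiv_at r (h j) else h j)" if "k \<in> S" for k
    using insert(1,2) that by (subst prod.insert) auto
  have "pderiv_at r (prod h (insert x S)) = pderiv_at r (h x) * prod h S + h x * pderiv_at r (prod h S)"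
    using insert by (simp add: pderiv_mult)
  also have "\<dots> = (\<Prod>j\<in>insert x S. if j = x then pderiv_at r (h j) else h j) 
     + (\<Sum>k\<in>S. \<Prod>j\<in>insert x S. if j = k then pderiv_at r (h j) else h j)"
    using insert(1,2) 1 by (simp add: insert.IH sum_distrib_left 2 del: prod.insert)
        (simp add: insert(1,2) 1)
  finally show ?case using insert by simp
qed simp

lemma jac_leibniz:
  "jacobian_bracket n fs = (\<Sum>p | p permutes {0..<n}. signof p * (\<Prod>j<n. pderiv_at (p j) (fs ! j)))"
proof -
  have "jacobian_bracket n fs = (\<Sum>p | p permutes {0..<n}. signof p * (\<Prod>j<n. mat n n (\<lambda>(i, j). pderiv_at i (fs ! j)) $$ (p j, j)))"
    unfolding jacobian_bracket_def by (rule det_col) simp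
  also have "\<dots> = (\<Sum>p | p permutes {0..<n}. signof p * (\<Prod>j<n. pderiv_at (p j) (fs ! j)))"
    by (intro sum.cong prod.cong arg_cong2[of _ _ _ _ "(*)"] refl) (auto dest: permutes_in_image)
  finally show ?thesis .
qed

lemma pderiv_jac:
  assumes "length fs = n"
  shows "pderiv_at r (jacobian_bracket n fs) = (\<Sum>k<n. jacobian_bracket n (fs[k := pderiv_at r (fs ! k)]))"
proof -
  have s: "pderiv_at r (signof p * g) = signof p * pderiv_at r g" for p :: "nat \<Rightarrow> nat" and g
    by (cases "signof p = (1 :: 'a mfps)") (auto simp: sign_def)
  have "pderiv_at r (jacobian_bracket n fs) = (\<Sum>p | p permutes {0..<n}. signof p *
      (\<Sum>k<n. \<Prod>j<n. if j = k then pderiv_at r (pderiv_at (p j) (fs ! j)) else pderiv_at (p j) (fs ! j)))"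
    unfolding jac_leibniz by (simp add: pderiv_sum s pderiv_prod)
  also have "\<dots> = (\<Sum>p | p permutes {0..<n}. signof p * (\<Sum>k<n. \<Prod>j<n. pderiv_at (p j) (fs[k := pderiv_at r (fs ! k)] ! j)))"
    using assms by (intro sum.cong prod.cong arg_cong2[of _ _ _ _ "(*)"] refl) (auto simp: nth_list_update pderiv_comm[of r])
  also have "\<dots> = (\<Sum>k<n. jacobian_bracket n (fs[k := pderiv_at r (fs ! k)]))"
    unfolding jac_leibniz sum_distrib_left by (rule sum.swap)
  finally show ?thesis .
qed

lemma jcof_adjugate:
  assumes "r < n" "s < n"
  shows "(\<Sum>k<n. pderiv_at r (fs ! k) * jcof n fs k s) = (if r = s then jacobian_bracket n fs else 0)"
proof -
  let ?A = "mat n n (\<lambda>(i, j). pderiv_at i (fs ! j))"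
  have "(?A * adj_mat ?A) $$ (r, s) = (det ?A \<cdot>\<^sub>m 1\<^sub>m n) $$ (r, s)"
    using adj_mat(2)[of ?A n] by simp
  then show ?thesis using assms
    by (simp add: scalar_prod_def adj_mat_def jcof_def jacobian_bracket_def lessThan_atLeast0 row_def col_def)
qed

text \<open>On the right, derivatives fall on the coefficients of the field or on the entries once
  more. The first kind collapses, by the adjugate identity, to the divergence times the bracket; the
  second is the derivative of the determinant.\<close>

lemma vf_jac:
  assumes "vdiv n c = 0" "length bs = n"
  shows "vf n c (jacobian_bracket n bs) = (\<Sum>i<n. jacobian_bracket n (bs[i := vf n c (bs ! i)]))"
proof -
  have "(\<Sum>k<n. jacobian_bracket n (bs[k := vf n c (bs ! k)]))
     = (\<Sum>k<n. \<Sum>s<n. \<Sum>r<n. pderiv_at s (c r) * (pderiv_at r (bs ! k) * jcof n bs k s))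
     + (\<Sum>k<n. \<Sum>s<n. \<Sum>r<n. c r * (pderiv_at s (pderiv_at r (bs ! k)) * jcof n bs k s))"
    using assms(2) by (simp add: jac_jcof vf_def pderiv_sum pderiv_mult sum_distrib_right distrib_right sum.distrib mult.assoc)
  also have "(\<Sum>k<n. \<Sum>s<n. \<Sum>r<n. pderiv_at s (c r) * (pderiv_at r (bs ! k) * jcof n bs k s))
     = (\<Sum>s<n. \<Sum>r<n. pderiv_at s (c r) * (\<Sum>k<n. pderiv_at r (bs ! k) * jcof n bs k s))"
    unfolding sum_distrib_left
    by (subst sum.swap, rule sum.cong[OF refl], rule sum.swap)
  also have "\<dots> = (\<Sum>s<n. pderiv_at s (c s) * jacobian_bracket n bs)"
    by (intro sum.cong refl) (simp add: jcof_adjugate if_distrib[of "(*) _"] cong: if_cong)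
  also have "\<dots> = vdiv n c * jacobian_bracket n bs"
    unfolding vdiv_def sum_distrib_right ..
  also have "(\<Sum>k<n. \<Sum>s<n. \<Sum>r<n. c r * (pderiv_at s (pderiv_at r (bs ! k)) * jcof n bs k s))
     = (\<Sum>r<n. c r * (\<Sum>k<n. \<Sum>s<n. pderiv_at s (pderiv_at r (bs ! k)) * jcof n bs k s))"
    unfolding sum_distrib_left
    by (rule trans[OF sum.cong[OF refl sum.swap] sum.swap])
  also have "\<dots> = vf n c (jacobian_bracket n bs)"
    unfolding vf_def using assms(2) by (simp add: pderiv_jac jac_jcof)
  finally show ?thesis using assms(1) by simp
qed

interpretation jac: alt_map n UNIV "jacobian_bracket n :: 'a::comm_ring_1 mfps list \<Rightarrow> 'a mfps" for n
proof
  fix xs :: "'a mfps list" and i j assume "xs \<in> tuples n UNIV" "i < j" "j < n" "xs ! i = xs ! j"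
  then show "jacobian_bracket n xs = 0" by (intro jac_alt[of i n j]) (auto simp: tuples_def)
qed (auto simp: tuples_def jac_add)

definition jfield :: "nat \<Rightarrow> 'a::comm_ring_1 mfps list \<Rightarrow> nat \<Rightarrow> 'a mfps" where
  "jfield n as r = jacobian_bracket n (as @ [fvar r])"

lemma jac_snoc:
  assumes "length as = n - 1" "n \<ge> 1"
  shows "jacobian_bracket n (as @ [g]) = vf n (jfield n as) g"
proof -
  have 1: "(as @ [0])[n - 1 := h] = as @ [h]" for h
    using assms by (metis list_update_length)
  show ?thesis
    using jac_chain[of "n - 1" n "as @ [0]" g] assms unfolding 1 vf_def jfield_def by (simp add: mult.commute)
qed

text \<open>The Piola identity: differentiating an entry brings in symmetric second derivatives,
  while the remaining determinant changes sign when the two coordinates \<open>s\<close> and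
  \<open>r\<close> are exchanged. The double sum equals its negative.\<close>

lemma vdiv_jfield:
  fixes as :: "'a::field_char_0 mfps list"
  assumes "length as = n - 1" "n \<ge> 1"
  shows "vdiv n (jfield n as) = 0"
proof -
  let ?J = "\<lambda>k s r. jacobian_bracket n (as[k := fvar s] @ [fvar r])"
  have up: "(as @ [x])[k := y] = as[k := y] @ [x]" if "k < n - 1" for k x and y :: "'a mfps"
    using that assms by (simp add: list_update_append)
  have "pderiv_at r (jfield n as r) = (\<Sum>k<n - 1. \<Sum>s<n. pderiv_at s (pderiv_at r (as ! k)) * ?J k s r)" if "r < n" for r
  proof -
    have "pderiv_at r (jfield n as r) = (\<Sum>k<Suc (n - 1). jacobian_bracket n ((as @ [fvar r])[k := pderiv_at r ((as @ [fvar r]) ! k)]))"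
      unfolding jfield_def using assms by (subst pderiv_jac) auto
    also have "\<dots> = (\<Sum>k<n - 1. jacobian_bracket n ((as @ [fvar r])[k := pderiv_at r (as ! k)]))"
      unfolding sum.lessThan_Suc using assms by (simp add: nth_append jac_one)
    also have "\<dots> = (\<Sum>k<n - 1. \<Sum>s<n. pderiv_at s (pderiv_at r (as ! k)) * ?J k s r)"
    proof (rule sum.cong[OF refl])
      fix k assume "k \<in> {..<n - 1}"
      then show "jacobian_bracket n ((as @ [fvar r])[k := pderiv_at r (as ! k)]) = (\<Sum>s<n. pderiv_at s (pderiv_at r (as ! k)) * ?J k s r)"
        using assms by (subst jac_chain) (auto simp: up)
    qed
    finally show ?thesis .
  qed
  then have "vdiv n (jfield n as) = (\<Sum>r<n. \<Sum>k<n - 1. \<Sum>s<n. pderiv_at s (pderiv_at r (as ! k)) * ?J k s r)"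
    unfolding vdiv_def by simp
  also have "\<dots> = (\<Sum>k<n - 1. \<Sum>r<n. \<Sum>s<n. pderiv_at s (pderiv_at r (as ! k)) * ?J k s r)"
    by (rule sum.swap)
  also have "\<dots> = (\<Sum>k<n - 1. 0)"
  proof (rule sum.cong[OF refl])
    fix k assume k: "k \<in> {..<n - 1}"
    have sw: "?J k s r = - ?J k r s" for r s
    proof -
      let ?x = "as[k := fvar r] @ [fvar s]"
      have "?x[k := ?x ! (n - 1), n - 1 := ?x ! k] = as[k := fvar s] @ [fvar r]"
        using k assms by (intro nth_equalityI) (auto simp: nth_append nth_list_update)
      then show ?thesis
        using jac.F_swap[of ?x n k "n - 1"] k assms by (auto simp: tuples_def)
    qed
    have t: "pderiv_at r (pderiv_at s (as ! k)) * ?J k r s = - (pderiv_at s (pderiv_at r (as ! k)) * ?J k s r)" for r s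
      unfolding sw[of s r] pderiv_comm[of r s] by simp
    let ?S = "\<Sum>r<n. \<Sum>s<n. pderiv_at s (pderiv_at r (as ! k)) * ?J k s r"
    have "?S = (\<Sum>r<n. \<Sum>s<n. pderiv_at r (pderiv_at s (as ! k)) * ?J k r s)"
      by (rule sum.swap)
    also have "\<dots> = - ?S"
      unfolding sum_negf[symmetric] by (intro sum.cong refl t)
    finally have "?S + ?S = 0" by (simp add: eq_neg_iff_add_eq_0)
    then show "?S = 0" by (rule mfps_double_zero)
  qed
  finally show ?thesis by simp
qed

section \<open>Elementary fields, and the decomposition of divergence-free fields into them\<close>

lemma jac_fvars:
  assumes "distinct l" "length l = n" "set l \<subseteq> {..<n}"
  shows "jacobian_bracket n (map fvar l) = (1 :: 'a::comm_ring_1 mfps) \<or> jacobian_bracket n (map fvar l) = (- 1 :: 'a mfps)"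
proof -
  define p where "p i = (if i < n then l ! i else i)" for i
  have "p permutes {0..<n}"
  proof (rule bij_imp_permutes)
    have "set l = {..<n}"
      using assms by (metis card_lessThan card_subset_eq distinct_card finite_lessThan)
    then have "bij_betw ((!) l) {..<n} {..<n}"
      using bij_betw_nth[OF assms(1)] assms(2) by blast
    then show "bij_betw p {0..<n} {0..<n}"
      unfolding p_def lessThan_atLeast0[symmetric] by (subst bij_betw_cong[of _ _ "(!) l"]) auto
    show "p x = x" if "x \<notin> {0..<n}" for x using that by (auto simp: p_def)
  qed
  note p = this
  have l: "l ! i < n" if "i < n" for i using assms that by (auto simp: subset_eq)
  have "jacobian_bracket n (map fvar l) = det (transpose_mat (mat n n (\<lambda>(i, j). 1\<^sub>m n $$ (p i, j) :: 'a mfps)))"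
    unfolding jacobian_bracket_def
    by (intro arg_cong[of _ _ det] eq_matI) (use assms l in \<open>auto simp: p_def\<close>)
  also have "\<dots> = det (mat n n (\<lambda>(i, j). 1\<^sub>m n $$ (p i, j) :: 'a mfps))"
    by (rule det_transpose[of _ n]) simp
  also have "\<dots> = signof p * det (1\<^sub>m n)" by (rule det_permute_rows[of "1\<^sub>m n" n, OF _ p]) simp
  finally show ?thesis by (auto simp: sign_def)
qed

text \<open>The coordinates in the middle exhaust all directions except \<open>k\<close> and
  \<open>j\<close>, so only a two-by-two Jacobian of \<open>g\<close> and \<open>f\<close> is left,
  up to the sign of the arrangement.\<close>

lemma jac_elementary:
  fixes g f :: "'a::comm_ring_1 mfps"
  assumes I: "distinct (k # I @ [j])" "length I = n - 2" "set (k # I @ [j]) \<subseteq> {..<n}" "n \<ge> 2"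
  shows "jacobian_bracket n (g # map fvar I @ [f])
     = jacobian_bracket n (map fvar (k # I @ [j])) * (pderiv_at k g * pderiv_at j f - pderiv_at j g * pderiv_at k f)"
proof -
  let ?e = "jacobian_bracket n (map fvar (k # I @ [j])) :: 'a mfps"
  have n2: "Suc (Suc (n - 2)) = n" using I(4) by simp
  have len: "length (x # map fvar I @ [y]) = n" for x y :: "'a mfps" using I(2,4) by simp
  have U: "{..<n} = insert j (insert k (set I))"
  proof -
    have "card (set (k # I @ [j])) = n" using I by (subst distinct_card) auto
    then have "set (k # I @ [j]) = {..<n}" using I(3) by (intro card_subset_eq) auto
    then show ?thesis by auto
  qed
  have zero1: "jacobian_bracket n (fvar r # map fvar I @ [y]) = 0" if r: "r \<in> set I" for r and y :: "'a mfps"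
  proof -
    obtain q where "q < length I" "I ! q = r" using r by (auto simp: in_set_conv_nth)
    then show ?thesis using len I by (intro jac_alt[of 0 n "Suc q"]) (auto simp: nth_append)
  qed
  have zero2: "jacobian_bracket n (x # map fvar I @ [fvar r]) = 0" if r: "r \<in> set I" for r and x :: "'a mfps"
  proof -
    obtain q where "q < length I" "I ! q = r" using r by (auto simp: in_set_conv_nth)
    then show ?thesis using len I by (intro jac_alt[of "n - 1" n "Suc q"]) (auto simp: nth_append nth_Cons')
  qed
  have zero3: "jacobian_bracket n (x # map fvar I @ [x]) = 0" for x :: "'a mfps"
    using len I by (intro jac_alt[of "n - 1" n 0]) (auto simp: nth_append nth_Cons')
  have c1: "jacobian_bracket n (g # map fvar I @ [y]) = (\<Sum>r<n. pderiv_at r g * jacobian_bracket n (fvar r # map fvar I @ [y]))" for g y :: "'a mfps"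
    using jac_chain[of 0 n "g # map fvar I @ [y]" g] I by (simp add: n2)
  have u2: "(x # map fvar I @ [y])[n - 1 := z] = x # map fvar I @ [z]" for x y z :: "'a mfps"
  proof -
    have "n - 1 = length (x # map fvar I)" using I(2) n2 by simp
    then show ?thesis using list_update_length[of "x # map fvar I" y "[]" z] by simp
  qed
  have c2: "jacobian_bracket n (x # map fvar I @ [f]) = (\<Sum>r<n. pderiv_at r f * jacobian_bracket n (x # map fvar I @ [fvar r]))" for x f :: "'a mfps"
    using jac_chain[of "n - 1" n "x # map fvar I @ [f]" f] I unfolding u2 by (simp add: n2)
  have sum2: "(\<Sum>r<n. a r) = a j + a k" if "\<And>r. r \<in> set I \<Longrightarrow> a r = 0" for a :: "nat \<Rightarrow> 'a mfps"
    unfolding U using that I by (subst sum.insert) auto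
  have sw: "jacobian_bracket n (fvar j # map fvar I @ [fvar k]) = - ?e"
  proof -
    let ?x = "map fvar (k # I @ [j]) :: 'a mfps list"
    have n1: "n - 1 = length (fvar k # map fvar I :: 'a mfps list)" using I(2) n2 by simp
    have "?x ! (n - 1) = fvar j" unfolding n1 by (metis append_Cons list.simps(9) map_append nth_append_length list.map(1))
    moreover have "?x[0 := fvar j, n - 1 := fvar k] = fvar j # map fvar I @ [fvar k]"
      using u2[of "fvar j" "fvar j" "fvar k"] by simp
    ultimately have "?x[0 := ?x ! (n - 1), n - 1 := ?x ! 0] = fvar j # map fvar I @ [fvar k]" by simp
    then show ?thesis
      using jac.F_swap[of ?x n 0 "n - 1"] I by (auto simp: tuples_def n2)
  qed
  have k: "jacobian_bracket n (fvar k # map fvar I @ [f]) = pderiv_at j f * ?e"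
    by (subst c2, subst sum2) (simp_all add: zero2 zero3)
  have j: "jacobian_bracket n (fvar j # map fvar I @ [f]) = - (pderiv_at k f * ?e)"
    by (subst c2, subst sum2) (simp_all add: zero2 zero3 sw)
  show ?thesis
  proof -
    have "jacobian_bracket n (g # map fvar I @ [f])
      = pderiv_at j g * - (pderiv_at k f * ?e) + pderiv_at k g * (pderiv_at j f * ?e)"
      unfolding c1[of g f] j[symmetric] k[symmetric] by (rule sum2) (simp add: zero1)
    then show ?thesis by (simp add: algebra_simps)
  qed
qed

text \<open>The field with coefficient \<open>h\<close> in direction \<open>j\<close> needs a second
  coefficient to become divergence-free; integration in direction \<open>k\<close> provides it, and
  \<open>g\<close> is the integral of \<open>h\<close> in direction \<open>k\<close> up to sign. The
  clause on \<open>q\<close> records that no new variable other than \<open>k\<close>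
  enters.\<close>

lemma elementary_field:
  fixes h :: "'a::field_char_0 mfps"
  assumes "j < n" "k < n" "j \<noteq> k"
  shows "\<exists>g I. distinct I \<and> length I = n - 2 \<and> set I \<subseteq> {..<n} \<and>
     (\<forall>q. q \<noteq> k \<longrightarrow> pderiv_at q h = 0 \<longrightarrow> pderiv_at q g = 0) \<and>
     (\<forall>f. jacobian_bracket n (g # map fvar I @ [f]) = h * pderiv_at j f - integ k (pderiv_at j h) * pderiv_at k f)"
proof -
  define I where "I = filter (\<lambda>i. i \<noteq> j \<and> i \<noteq> k) [0..<n]"
  have "set I = {..<n} - {j, k}" unfolding I_def by auto
  moreover have d: "distinct I" by (simp add: I_def)
  ultimately have lI: "length I = n - 2"
    using assms by (metis card_Diff_subset card_lessThan card_2_iff distinct_card empty_subsetI finite.intros insert_subset lessThan_iff)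
  have dI: "distinct (k # I @ [j])" "set (k # I @ [j]) \<subseteq> {..<n}"
    using d assms by (auto simp: I_def)
  define \<epsilon> where "\<epsilon> = (jacobian_bracket n (map fvar (k # I @ [j])) :: 'a mfps)"
  have \<epsilon>: "\<epsilon> = 1 \<or> \<epsilon> = - 1"
    unfolding \<epsilon>_def using dI lI assms by (intro jac_fvars) auto
  have "jacobian_bracket n ((\<epsilon> * integ k h) # map fvar I @ [f]) = h * pderiv_at j f - integ k (pderiv_at j h) * pderiv_at k f" for f
    using jac_elementary[OF dI(1) lI dI(2), of "\<epsilon> * integ k h" f] \<epsilon> assms unfolding \<epsilon>_def[symmetric]
    by (auto simp: pderiv_integ_other)
  moreover have "pderiv_at q (\<epsilon> * integ k h) = 0" if "q \<noteq> k" "pderiv_at q h = 0" for q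
    using \<epsilon> that by (auto simp: pderiv_integ_other)
  ultimately show ?thesis
    using d lI dI(2) by (intro exI[of _ "\<epsilon> * integ k h"] exI[of _ I]) auto
qed

text \<open>Elementary fields take care of all coefficients but the last one, at the expense of
  changing that last one. What is left points in one direction and is again elementary.\<close>

lemma field_decomposition:
  fixes c :: "nat \<Rightarrow> 'a::field_char_0 mfps"
  assumes n: "n \<ge> 3" and div: "vdiv n c = 0"
  shows "\<exists>gs :: ('a mfps \<times> nat list) list.
    (\<forall>(g, I)\<in>set gs. distinct I \<and> length I = n - 2 \<and> set I \<subseteq> {..<n} \<and>
        ((\<forall>r<n. pderiv_at 1 (c r) = 0) \<longrightarrow> pderiv_at 1 g = 0)) \<and>
    (\<forall>f. vf n c f = (\<Sum>(g, I)\<leftarrow>gs. jacobian_bracket n (g # map fvar I @ [f])))"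
proof -
  \<comment> \<open>The integrations run along \<open>L\<close> and along \<open>0\<close>. Both
    differ from \<open>1\<close> because \<open>n\<close> is at least 3, so independence of the
    variable with index 1 survives.\<close>
  define L where "L = n - 1"
  have L: "L < n" "n = Suc L" "1 \<noteq> L" "0 \<noteq> L" using n by (auto simp: L_def)
  have "\<forall>i\<in>{..<L}. \<exists>g I. distinct I \<and> length I = n - 2 \<and> set I \<subseteq> {..<n} \<and>
     (\<forall>q. q \<noteq> L \<longrightarrow> pderiv_at q (c i) = 0 \<longrightarrow> pderiv_at q g = 0) \<and>
     (\<forall>f. jacobian_bracket n (g # map fvar I @ [f]) = c i * pderiv_at i f - integ L (pderiv_at i (c i)) * pderiv_at L f)"
    using L by (intro ballI elementary_field) auto
  then obtain g I where gI: "\<And>i. i < L \<Longrightarrow> distinct (I i) \<and> length (I i) = n - 2 \<and> set (I i) \<subseteq> {..<n} \<and>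
     (\<forall>q. q \<noteq> L \<longrightarrow> pderiv_at q (c i) = 0 \<longrightarrow> pderiv_at q (g i) = 0) \<and>
     (\<forall>f. jacobian_bracket n (g i # map fvar (I i) @ [f]) = c i * pderiv_at i f - integ L (pderiv_at i (c i)) * pderiv_at L f)"
    by (metis lessThan_iff)
  \<comment> \<open>The corrected last coefficient. Vanishing divergence says exactly that it does
    not depend on its own variable, so the correction term of its elementary field is zero.\<close>
  define u where "u = c L + (\<Sum>i<L. integ L (pderiv_at i (c i)))"
  have u: "pderiv_at L u = 0"
    using div unfolding u_def vdiv_def L(2) by (simp add: pderiv_sum add.commute)
  obtain g' I' where gI': "distinct I' \<and> length I' = n - 2 \<and> set I' \<subseteq> {..<n}"
     "\<And>q. q \<noteq> 0 \<Longrightarrow> pderiv_at q u = 0 \<Longrightarrow> pderiv_at q g' = 0"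
     "\<And>f. jacobian_bracket n (g' # map fvar I' @ [f]) = u * pderiv_at L f - integ 0 (pderiv_at L u) * pderiv_at 0 f"
    using elementary_field[of L n 0 u] L n by auto
  define gs where "gs = map (\<lambda>i. (g i, I i)) [0..<L] @ [(g', I')]"
  have "(\<Sum>(g, I)\<leftarrow>gs. jacobian_bracket n (g # map fvar I @ [f])) = vf n c f" for f
  proof -
    have "(\<Sum>(g, I)\<leftarrow>gs. jacobian_bracket n (g # map fvar I @ [f]))
       = (\<Sum>i<L. jacobian_bracket n (g i # map fvar (I i) @ [f])) + u * pderiv_at L f"
      unfolding gs_def by (simp add: gI' u interv_sum_list_conv_sum_set_nat lessThan_atLeast0 o_def)
    also have "(\<Sum>i<L. jacobian_bracket n (g i # map fvar (I i) @ [f]))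
      = (\<Sum>i<L. c i * pderiv_at i f - integ L (pderiv_at i (c i)) * pderiv_at L f)"
      using gI by (intro sum.cong) auto
    finally show ?thesis unfolding u_def vf_def L(2)
      by (simp add: sum_subtractf distrib_right sum_distrib_right)
  qed
  moreover have "pderiv_at 1 u = 0" if "\<forall>r<n. pderiv_at 1 (c r) = 0"
  proof -
    have "pderiv_at 1 (pderiv_at i (c i)) = 0" if "i < L" for i
      using \<open>\<forall>r<n. _\<close> that L by (subst pderiv_comm) simp
    then show ?thesis using that L unfolding u_def by (simp add: pderiv_sum pderiv_integ_other)
  qed
  then have "\<forall>(g, I)\<in>set gs. distinct I \<and> length I = n - 2 \<and> set I \<subseteq> {..<n} \<and>
        ((\<forall>r<n. pderiv_at 1 (c r) = 0) \<longrightarrow> pderiv_at 1 g = 0)"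
    unfolding gs_def using gI gI' L by auto
  ultimately show ?thesis by (intro exI[of _ gs]) auto
qed

text \<open>A divergence-free field can be chosen to send one coordinate to any given series and to kill all
  other coordinates but a spare one, so coordinates can be replaced by arbitrary series one by one.\<close>

lemma coordinate_extension:
  fixes G :: "'a::field_char_0 mfps list \<Rightarrow> 'r::ab_group_add"
  assumes act: "\<And>c fs. vdiv n c = 0 \<Longrightarrow> length fs = k \<Longrightarrow> G fs \<in> S \<Longrightarrow> (\<Sum>i<k. G (fs[i := vf n c (fs ! i)])) \<in> S"
    and zero: "\<And>fs i. length fs = k \<Longrightarrow> i < k \<Longrightarrow> G (fs[i := 0]) = 0"
    and S: "0 \<in> S" "\<And>a b. a \<in> S \<Longrightarrow> b \<in> S \<Longrightarrow> a - b \<in> S"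
    and js: "distinct js" "set js \<subseteq> {..<n}" "q < n" "q \<notin> set js"
    and base: "\<And>fs. length fs = r \<Longrightarrow> G (fs @ map fvar js) \<in> S"
    and k: "k = r + length js"
    and fs: "length fs = k"
  shows "G fs \<in> S"
  using js base k fs
proof (induction js arbitrary: r fs)
  case (Cons j js)
  have Splus: "a + b \<in> S" if "a \<in> S" "b \<in> S" for a b
    using S(2)[OF that(1) S(2)[OF S(1) that(2)]] by simp
  have Ssum: "sum a A \<in> S" if "\<And>i. i \<in> A \<Longrightarrow> a i \<in> S" for a and A :: "nat set"
    using that by (induction A rule: infinite_finite_induct) (auto intro: S Splus)
  have "G (gs @ map fvar js) \<in> S" if gs: "length gs = Suc r" for gs
  proof -
    obtain fs h where gs': "gs = fs @ [h]" "length fs = r"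
      using gs by (metis length_Suc_conv_rev)
    \<comment> \<open>The value in the spare direction \<open>q\<close> cancels the divergence
      caused by \<open>h\<close> in direction \<open>j\<close>.\<close>
    define c where "c i = (if i = j then h else if i = q then - integ q (pderiv_at j h) else 0)" for i
    have "j \<noteq> q" "j < n" using Cons.prems by auto
    then have "vdiv n c = pderiv_at j (c j) + pderiv_at q (c q)"
      unfolding vdiv_def using Cons.prems(3)
      by (subst sum.remove[of _ j], simp, simp, subst sum.remove[of _ q]) (auto simp: c_def intro!: sum.neutral)
    then have div: "vdiv n c = 0" using \<open>j \<noteq> q\<close> by (simp add: c_def)
    let ?x = "fs @ map fvar (j # js)"
    let ?t = "\<lambda>i. G (?x[i := vf n c (?x ! i)])"
    have len: "length ?x = k" using gs' Cons.prems by simp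
    have "(\<Sum>i<k. ?t i) \<in> S"
      using div len Cons.prems(5)[OF gs'(2)] by (rule act)
    \<comment> \<open>Slots beyond \<open>r\<close> hold coordinates killed by the field. The slots
      before \<open>r\<close> are arbitrary already and stay within the known case, so the term of
      slot \<open>r\<close>, where the coordinate becomes \<open>h\<close>, can be isolated.\<close>
    moreover have "(\<Sum>i<k. ?t i) = (\<Sum>i<r. ?t i) + ?t r"
    proof -
      have "(\<Sum>i<k. ?t i) = (\<Sum>i<Suc r. ?t i)"
      proof (rule sum.mono_neutral_right)
        show "\<forall>i\<in>{..<k} - {..<Suc r}. ?t i = 0"
        proof
          fix i assume i: "i \<in> {..<k} - {..<Suc r}"
          then have "?x ! i = fvar (js ! (i - Suc r))" "js ! (i - Suc r) \<in> set js"
            using gs' Cons.prems by (auto simp: nth_append nth_Cons')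
          then have "vf n c (?x ! i) = 0" using Cons.prems by (auto simp: vf_fvar c_def)
          then show "?t i = 0" using zero[OF len, of i] i by simp
        qed
      qed (use Cons.prems in auto)
      then show ?thesis by simp
    qed
    moreover have "(\<Sum>i<r. ?t i) \<in> S"
    proof (rule Ssum)
      fix i assume "i \<in> {..<r}"
      then have "?x[i := vf n c (?x ! i)] = fs[i := vf n c (?x ! i)] @ map fvar (j # js)"
        using gs' by (simp add: list_update_append)
      then show "?t i \<in> S" using Cons.prems(5) gs' by simp
    qed
    moreover have "?x[r := vf n c (?x ! r)] = gs @ map fvar js"
      using gs' \<open>j < n\<close> by (simp add: nth_append list_update_append vf_fvar c_def)
    ultimately have "G (gs @ map fvar js) = (\<Sum>i<k. ?t i) - (\<Sum>i<r. ?t i)" by simp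
    then show ?thesis
      using S(2)[OF \<open>(\<Sum>i<k. ?t i) \<in> S\<close> \<open>(\<Sum>i<r. ?t i) \<in> S\<close>] by simp
  qed
  note new_base = this
  show ?case
    using Cons.prems(1-4,6,7) by (intro Cons.IH[OF _ _ _ _ new_base]) auto
qed simp

section \<open>Operators attached to tuples of series\<close>

lemma sum_list_apply: "sum_list (map (\<lambda>a. F a) A) x = sum_list (map (\<lambda>a. F a x) A)"
  by (induction A) auto

lemma fst_sum_list: "fst (sum_list (map F A)) = sum_list (map (\<lambda>a. fst (F a)) A)"
  and snd_sum_list: "snd (sum_list (map F A)) = sum_list (map (\<lambda>a. snd (F a)) A)"
  by (induction A) auto

lemma sum_list_commutator: "p * sum_list (map F A) - sum_list (map F A) * p = sum_list (map (\<lambda>a. p * F a - F a * p :: 'r::ring) A)"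
  by (induction A) (auto simp: algebra_simps)

lemma vdiv_sum_list: "vdiv n (\<lambda>r. sum_list (map (\<lambda>a. c a r) A)) = sum_list (map (\<lambda>a. vdiv n (c a)) A)"
  by (induction A) (auto simp: vdiv_def sum.distrib)

lemma vf_sum_list: "vf n (\<lambda>r. sum_list (map (\<lambda>a. c a r) A)) f = sum_list (map (\<lambda>a. vf n (c a) f) A)"
  by (induction A) (auto simp: vf_def sum.distrib distrib_right)

lemma pderiv_sum_list: "pderiv_at i (sum_list (map f A)) = sum_list (map (\<lambda>a. pderiv_at i (f a)) A)"
  by (induction A) auto

text \<open>The identities satisfied by the operators of an irreducible module, for tuples of
  arbitrary series of the right length. Schur's lemma enters as a cancellation rule for sums of
  operators whose fields add up to zero.\<close>

locale nrep =
  fixes n :: nat and \<rho> :: "'a::field_char_0 mfps list \<Rightarrow> 'r::ring"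
  assumes n: "n \<ge> 3"
    and rho_add: "length fs = n - 1 \<Longrightarrow> i < n - 1 \<Longrightarrow> \<rho> (fs[i := f + g]) = \<rho> (fs[i := f]) + \<rho> (fs[i := g])"
    and rho_alt: "length fs = n - 1 \<Longrightarrow> i < j \<Longrightarrow> j < n - 1 \<Longrightarrow> fs ! i = fs ! j \<Longrightarrow> \<rho> fs = 0"
    and lie: "length as = n - 1 \<Longrightarrow> length bs = n - 1 \<Longrightarrow>
      \<rho> as * \<rho> bs - \<rho> bs * \<rho> as = (\<Sum>i<n - 1. \<rho> (bs[i := jacobian_bracket n (as @ [bs ! i])]))"
    and quadratic: "length ts = n - 2 \<Longrightarrow> length hs = n \<Longrightarrow>
      \<rho> (ts @ [jacobian_bracket n hs]) = (\<Sum>i<n. signed (n - 1 - i) (\<rho> (omit i hs) * \<rho> (ts @ [hs ! i])))"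
    and torsion_free: "r + r = 0 \<Longrightarrow> r = (0::'r)" "r + r + r = 0 \<Longrightarrow> r = (0::'r)"
    and schur: "(\<And>a. a \<in> set A \<Longrightarrow> length a = n - 1) \<Longrightarrow>
      (\<And>g. sum_list (map (\<lambda>a. jacobian_bracket n (a @ [g])) A) = 0) \<Longrightarrow>
      sum_list (map \<rho> A) * r = 0 \<Longrightarrow> sum_list (map \<rho> A) = 0 \<or> r = 0"
begin

sublocale rho: alt_map "n - 1" UNIV \<rho>
  by unfold_locales (auto simp: tuples_def rho_add intro: rho_alt)

lemma rho_zero: "length fs = n - 1 \<Longrightarrow> i < n - 1 \<Longrightarrow> \<rho> (fs[i := 0]) = 0"
  by (rule rho.F_zero) (auto simp: tuples_def)

lemma rho_minus: "length fs = n - 1 \<Longrightarrow> i < n - 1 \<Longrightarrow> \<rho> (fs[i := - f]) = - \<rho> (fs[i := f])"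
  using rho_add[of fs i "- f" f] rho_zero[of fs i] by (simp add: eq_neg_iff_add_eq_0)

lemma rho_sum_list: "length fs = n - 1 \<Longrightarrow> i < n - 1 \<Longrightarrow> \<rho> (fs[i := sum_list (map F A)]) = sum_list (map (\<lambda>a. \<rho> (fs[i := F a])) A)"
  by (induction A) (auto simp: rho_zero rho_add)

lemma rho_minus_Cons: "length fs = n - 2 \<Longrightarrow> \<rho> ((- f) # fs) = - \<rho> (f # fs)"
  using rho_minus[of "f # fs" 0 f] n by simp

lemma kernel_central:
  assumes "\<And>a. a \<in> set A \<Longrightarrow> length a = n - 1" "\<And>g. sum_list (map (\<lambda>a. jacobian_bracket n (a @ [g])) A) = 0"
    and b: "length b = n - 1"
  shows "sum_list (map \<rho> A) * \<rho> b = \<rho> b * sum_list (map \<rho> A)"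
proof -
  have "sum_list (map \<rho> A) * \<rho> b - \<rho> b * sum_list (map \<rho> A) = sum_list (map (\<lambda>a. \<rho> a * \<rho> b - \<rho> b * \<rho> a) A)"
    by (induction A) (auto simp: algebra_simps)
  also have "\<dots> = sum_list (map (\<lambda>a. \<Sum>i<n - 1. \<rho> (b[i := jacobian_bracket n (a @ [b ! i])])) A)"
    by (intro arg_cong[of _ _ sum_list] map_cong refl lie assms)
  also have "\<dots> = (\<Sum>i<n - 1. sum_list (map (\<lambda>a. \<rho> (b[i := jacobian_bracket n (a @ [b ! i])])) A))"
    by (induction A) (auto simp: sum.distrib)
  also have "\<dots> = (\<Sum>i<n - 1. \<rho> (b[i := sum_list (map (\<lambda>a. jacobian_bracket n (a @ [b ! i])) A)]))"
    using b by (intro sum.cong refl) (simp add: rho_sum_list)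
  also have "\<dots> = 0" using b by (simp add: assms(2) rho_zero)
  finally show ?thesis by simp
qed

text \<open>The operators of the tuples in a decomposition of the field are added up. Their sum is
  not yet known to be determined by the field, so only two properties that hold for any
  decomposition are recorded: its commutators, and that it commutes with the centraliser of all
  operators.\<close>

lemma field_element:
  assumes "vdiv n c = 0"
  obtains p where "\<And>b. length b = n - 1 \<Longrightarrow> p * \<rho> b - \<rho> b * p = (\<Sum>i<n - 1. \<rho> (b[i := vf n c (b ! i)]))"
    and "\<And>r. (\<And>b. length b = n - 1 \<Longrightarrow> r * \<rho> b = \<rho> b * r) \<Longrightarrow> r * p = p * r"
proof -
  obtain gs :: "('a mfps \<times> nat list) list" where gs: "\<forall>(g, I)\<in>set gs. distinct I \<and> length I = n - 2 \<and> set I \<subseteq> {..<n} \<and>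
        ((\<forall>r<n. pderiv_at 1 (c r) = 0) \<longrightarrow> pderiv_at 1 g = 0)"
    "\<forall>f. vf n c f = (\<Sum>(g, I)\<leftarrow>gs. jacobian_bracket n (g # map fvar I @ [f]))"
    using field_decomposition[OF n assms] by (elim exE conjE) rule
  define A where "A = map (\<lambda>(g, I). g # map fvar I) gs"
  have A: "length a = n - 1" if "a \<in> set A" for a using that gs(1) n by (auto simp: A_def)
  have vfA: "vf n c f = sum_list (map (\<lambda>a. jacobian_bracket n (a @ [f])) A)" for f
    unfolding gs(2)[rule_format] A_def by (simp add: o_def case_prod_unfold)
  define p where "p = sum_list (map \<rho> A)"
  have "p * \<rho> b - \<rho> b * p = (\<Sum>i<n - 1. \<rho> (b[i := vf n c (b ! i)]))" if b: "length b = n - 1" for b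
  proof -
    have "p * \<rho> b - \<rho> b * p = sum_list (map (\<lambda>a. \<rho> a * \<rho> b - \<rho> b * \<rho> a) A)"
      unfolding p_def by (induction A) (auto simp: algebra_simps)
    also have "\<dots> = sum_list (map (\<lambda>a. \<Sum>i<n - 1. \<rho> (b[i := jacobian_bracket n (a @ [b ! i])])) A)"
      by (intro arg_cong[of _ _ sum_list] map_cong refl lie A b)
    also have "\<dots> = (\<Sum>i<n - 1. sum_list (map (\<lambda>a. \<rho> (b[i := jacobian_bracket n (a @ [b ! i])])) A))"
      by (induction A) (auto simp: sum.distrib)
    also have "\<dots> = (\<Sum>i<n - 1. \<rho> (b[i := vf n c (b ! i)]))"
      using b unfolding vfA by (intro sum.cong refl) (simp add: rho_sum_list)
    finally show ?thesis .
  qed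
  moreover have "r * p = p * r" if r: "\<And>b. length b = n - 1 \<Longrightarrow> r * \<rho> b = \<rho> b * r" for r
    unfolding p_def using A by (induction A) (auto simp: algebra_simps r)
  ultimately show ?thesis using that by blast
qed

definition coord_field :: "nat \<Rightarrow> nat \<Rightarrow> 'a mfps" where "coord_field q r = (if r = q then 1 else 0)"

lemma coord_field: "q < n \<Longrightarrow> vf n (coord_field q) f = pderiv_at q f" "vdiv n (coord_field q) = 0"
  by (auto simp: vf_def vdiv_def coord_field_def if_distrib if_distribR sum.delta intro!: sum.neutral cong: if_cong)

text \<open>A tuple with an entry 1 has zero field, so its operator is central and in particular
  commutes with the elements of fields. The partial derivative with index 0 therefore gives zero
  when applied to the operator of a tuple with an integrated series, and that is the operator in
  question.\<close>

lemma rho_one_Cons: "length fs = n - 2 \<Longrightarrow> \<rho> (1 # fs) = 0"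
proof -
  assume len: "length fs = n - 2"
  let ?G = "\<lambda>fs. \<rho> (1 # fs)"
  have expand: "(\<Sum>i<n - 1. \<rho> ((1 # fs)[i := vf n c ((1 # fs) ! i)])) = (\<Sum>i<n - 2. ?G (fs[i := vf n c (fs ! i)]))"
    if "length fs = n - 2" for c fs
  proof -
    have n1: "n - 1 = Suc (n - 2)" using n by simp
    have "\<rho> (0 # fs) = 0" using rho_zero[of "1 # fs" 0] that n by simp
    moreover have "vf n c 1 = 0" by (simp add: vf_def)
    ultimately show ?thesis unfolding n1 sum.lessThan_Suc_shift by simp
  qed
  have "\<rho> (1 # fs) \<in> {0}"
  proof (rule coordinate_extension[where k = "n - 2" and r = 1 and js = "[3..<n]" and q = 0 and n = n and G = ?G])
    fix c :: "nat \<Rightarrow> 'a mfps" and fs assume c: "vdiv n c = 0" "length fs = n - 2" "?G fs \<in> {0}"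
    obtain p where "\<And>b. length b = n - 1 \<Longrightarrow> p * \<rho> b - \<rho> b * p = (\<Sum>i<n - 1. \<rho> (b[i := vf n c (b ! i)]))"
      using field_element[OF c(1)] by blast
    from this[of "1 # fs"] show "(\<Sum>i<n - 2. ?G (fs[i := vf n c (fs ! i)])) \<in> {0}"
      using c n unfolding expand[OF c(2)] by simp
  next
    fix fs :: "'a mfps list" and i assume "length fs = n - 2" "i < n - 2"
    then show "?G (fs[i := 0]) = 0" using rho_zero[of "1 # fs" "Suc i"] n by simp
  next
    fix fs :: "'a mfps list" assume "length fs = 1"
    then obtain g where g: "fs = [g]" by (auto simp: length_Suc_conv)
    \<comment> \<open>The coordinates from index 3 on are killed by the derivative with index 0, so
      only the series contributes to the commutator.\<close>
    let ?b = "integ 0 g # map fvar [3..<n]"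
    have lb: "length ?b = n - 2" using n by simp
    obtain p where p: "\<And>b. length b = n - 1 \<Longrightarrow> p * \<rho> b - \<rho> b * p = (\<Sum>i<n - 1. \<rho> (b[i := vf n (coord_field 0) (b ! i)]))"
      and pc: "\<And>r. (\<And>b. length b = n - 1 \<Longrightarrow> r * \<rho> b = \<rho> b * r) \<Longrightarrow> r * p = p * r"
      using field_element[OF coord_field(2)] by blast
    have "jacobian_bracket n (1 # ?b @ [f]) = 0" for f
      using jac_one[of 0 n "1 # ?b @ [f]"] n by simp
    then have "\<rho> (1 # ?b) * \<rho> b = \<rho> b * \<rho> (1 # ?b)" if "length b = n - 1" for b
      using kernel_central[of "[1 # ?b]" b] that n by simp
    then have "(\<Sum>i<n - 1. \<rho> ((1 # ?b)[i := vf n (coord_field 0) ((1 # ?b) ! i)])) = 0"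
      using p[of "1 # ?b"] pc[of "\<rho> (1 # ?b)"] n by simp
    then have "(\<Sum>i<n - 2. ?G (?b[i := vf n (coord_field 0) (?b ! i)])) = 0"
      unfolding expand[OF lb] .
    moreover have "n - 2 = Suc (n - 3)" using n by simp
    moreover have "?G (?b[Suc i := vf n (coord_field 0) (?b ! Suc i)]) = 0" if "i < n - 3" for i
    proof -
      have "vf n (coord_field 0) (?b ! Suc i) = 0" using that n by (simp add: coord_field)
      then show ?thesis using rho_zero[of "1 # ?b" "Suc (Suc i)"] n that by simp
    qed
    ultimately have "?G (?b[0 := vf n (coord_field 0) (?b ! 0)]) = 0"
      by (simp only: sum.lessThan_Suc_shift) simp
    then show "?G (fs @ map fvar [3..<n]) \<in> {0}" using n by (simp add: g coord_field)
  qed (use n len in auto)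
  then show ?thesis by simp
qed

lemma rho_one: 
  assumes "length fs = n - 1" "i < n - 1" "fs ! i = 1"
  shows "\<rho> fs = 0"
proof -
  define gs where "gs = 1 # omit i fs"
  have l: "length gs = n - 1" using assms n by (simp add: gs_def)
  have "signed (n - 1 - 1 - i) (\<rho> fs) = \<rho> (omit i fs @ [1])"
    using rho.F_move_last[of fs i] assms by (simp add: tuples_def)
  also have "\<dots> = signed (n - 1 - 1 - 0) (\<rho> gs)"
    using rho.F_move_last[of gs 0] l n by (simp add: tuples_def gs_def omit_def)
  also have "\<rho> gs = 0" unfolding gs_def using assms n by (intro rho_one_Cons) simp
  finally show ?thesis by (metis signed_simps(3,4))
qed

section \<open>Reduction to three free slots\<close>

lemma jac_three:
  assumes js: "length js = n - 3" "distinct (a # b # js @ [c])" "set (a # b # js @ [c]) \<subseteq> {..<n}"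
    and one: "jacobian_bracket n (map fvar (a # b # js @ [c])) = (1 :: 'a mfps)"
  shows "jacobian_bracket n (u # v # map fvar js @ [s]) =
    pderiv_at a u * (pderiv_at b v * pderiv_at c s - pderiv_at c v * pderiv_at b s)
    - pderiv_at b u * (pderiv_at a v * pderiv_at c s - pderiv_at c v * pderiv_at a s)
    + pderiv_at c u * (pderiv_at a v * pderiv_at b s - pderiv_at b v * pderiv_at a s :: 'a mfps)"
proof -
  define J where "J u v s = jacobian_bracket n (u # v # map fvar js @ [s :: 'a mfps])" for u v s
  have n3: "Suc (Suc (Suc (n - 3))) = n" using n by simp
  have lx: "length (u # v # map fvar js @ [s :: 'a mfps]) = n" for u v s using js n3 by simp
  have upl: "(u # v # map fvar js @ [s])[n - 1 := t] = u # v # map fvar js @ [t]" for u v s t :: "'a mfps"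
  proof -
    have "n - 1 = length (u # v # map fvar js)" using n3 js by simp
    then show ?thesis using list_update_length[of "u # v # map fvar js" s "[]" t] by simp
  qed
  have nl: "(u # v # map fvar js @ [s]) ! (n - 1) = s" for u v s :: "'a mfps"
  proof -
    have "n - 1 = length (u # v # map fvar js)" using n3 js by simp
    then show ?thesis using nth_append_length[of "u # v # map fvar js" s "[]"] by simp
  qed
  have sw1: "J v u s = - J u v s" for u v s
    using jac.F_swap[of "u # v # map fvar js @ [s]" n 0 1] n lx[of u v s] unfolding J_def by (simp add: tuples_def)
  have sw2: "J u s v = - J u v s" for u v s
  proof -
    have 1: "(u # v # map fvar js @ [s])[1 := s, n - 1 := v] = u # s # map fvar js @ [v]"
      using upl[of u s s v] by simp
    have 2: "(u # v # map fvar js @ [s]) ! 1 = v" by simp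
    have "jacobian_bracket n ((u # v # map fvar js @ [s])[1 := (u # v # map fvar js @ [s]) ! (n - 1),
        n - 1 := (u # v # map fvar js @ [s]) ! 1]) = - jacobian_bracket n (u # v # map fvar js @ [s])"
      by (rule jac.F_swap) (use n lx[of u v s] in \<open>auto simp: tuples_def\<close>)
    then show ?thesis unfolding nl 2 1 J_def .
  qed
  have same1: "J u u s = 0" for u s unfolding J_def using n lx[of u u s] by (intro jac_alt[of 0 n 1]) auto
  have same2: "J u v v = 0" for u v 
    using jac_alt[of 1 n "n - 1" "u # v # map fvar js @ [v]"] n lx[of u v v] nl[of u v v] unfolding J_def by simp
  have same3: "J u v u = 0" for u v
    using jac_alt[of 0 n "n - 1" "u # v # map fvar js @ [u]"] n lx[of u v u] nl[of u v u] unfolding J_def by simp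
  have zero: "J (fvar r) v s = 0" if r: "r \<in> set js" for r v s
  proof -
    obtain q where "q < length js" "js ! q = r" using r by (auto simp: in_set_conv_nth)
    then show ?thesis unfolding J_def using js n lx[of "fvar r" v s] by (intro jac_alt[of 0 n "Suc (Suc q)"]) (auto simp: nth_append)
  qed
  have zeros: "J v (fvar r) s = 0" "J v s (fvar r) = 0" if "r \<in> set js" for r v s
    using zero[OF that] sw1 sw2 by (metis neg_equal_0_iff_equal)+
  have U: "{..<n} = insert a (insert b (insert c (set js)))"
  proof -
    have "card (set (a # b # js @ [c])) = n" using js n3 by (subst distinct_card) auto
    then have "set (a # b # js @ [c]) = {..<n}" using js(3) by (intro card_subset_eq) auto
    then show ?thesis by auto
  qed
  have sum3: "(\<Sum>r<n. f r) = f a + f b + f c" if "\<And>r. r \<in> set js \<Longrightarrow> f r = 0" for f :: "nat \<Rightarrow> 'a mfps"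
    unfolding U using that js by (subst sum.insert, simp, simp, subst sum.insert, simp, simp, subst sum.insert) auto
  have c1: "J u v s = pderiv_at a u * J (fvar a) v s + pderiv_at b u * J (fvar b) v s + pderiv_at c u * J (fvar c) v s" for u v s
  proof -
    have "J u v s = (\<Sum>r<n. pderiv_at r u * J (fvar r) v s)"
      using jac_chain[of 0 n "u # v # map fvar js @ [s]" u] n lx[of u v s] unfolding J_def by simp
    then show ?thesis using sum3[of "\<lambda>r. pderiv_at r u * J (fvar r) v s"] zero by simp
  qed
  have c2: "J u v s = pderiv_at a v * J u (fvar a) s + pderiv_at b v * J u (fvar b) s + pderiv_at c v * J u (fvar c) s" for u v s
    using c1[of v u s] by (simp add: sw1[of u])
  have c3: "J u v s = pderiv_at a s * J u v (fvar a) + pderiv_at b s * J u v (fvar b) + pderiv_at c s * J u v (fvar c)" for u v s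
    using c2[of u s v] by (simp add: sw2[of u v])
  have abc: "J (fvar a) (fvar b) (fvar c) = 1" using one unfolding J_def by simp
  have J0: "J (fvar a) (fvar a) s = 0" "J (fvar b) (fvar b) s = 0" "J (fvar c) (fvar c) s = 0" for s
    by (rule same1)+
  have Jab: "J (fvar a) (fvar b) s = pderiv_at c s" using c3[of "fvar a" "fvar b" s] by (simp add: abc same2 same3)
  have Jba: "J (fvar b) (fvar a) s = - pderiv_at c s" using sw1[of "fvar b" "fvar a" s] Jab by simp
  have Jac: "J (fvar a) (fvar c) s = - pderiv_at b s" 
    using c3[of "fvar a" "fvar c" s] sw2[of "fvar a" "fvar c" "fvar b"] by (simp add: abc same2 same3)
  have Jca: "J (fvar c) (fvar a) s = pderiv_at b s" using sw1[of "fvar c" "fvar a" s] Jac by simp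
  have Jbc: "J (fvar b) (fvar c) s = pderiv_at a s" 
  proof -
    have "J (fvar b) (fvar c) (fvar a) = 1"
      using sw2[of "fvar b" "fvar a" "fvar c"] sw1[of "fvar a" "fvar b" "fvar c"] abc by simp
    then show ?thesis using c3[of "fvar b" "fvar c" s] by (simp add: same2 same3)
  qed
  have Jcb: "J (fvar c) (fvar b) s = - pderiv_at a s" using sw1[of "fvar c" "fvar b" s] Jbc by simp
  have "J u v s = pderiv_at a u * (pderiv_at b v * pderiv_at c s - pderiv_at c v * pderiv_at b s)
    - pderiv_at b u * (pderiv_at a v * pderiv_at c s - pderiv_at c v * pderiv_at a s)
    + pderiv_at c u * (pderiv_at a v * pderiv_at b s - pderiv_at b v * pderiv_at a s)"
    unfolding c1[of u v s] c2[of "fvar a" v s] c2[of "fvar b" v s] c2[of "fvar c" v s] J0 Jab Jba Jac Jca Jbc Jcb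
    by (simp add: algebra_simps)
  then show ?thesis unfolding J_def .
qed

lemma complement_triple:
  assumes "distinct js" "length js = n - 3" "set js \<subseteq> {..<n}"
  obtains a b c where "distinct (a # b # js @ [c])" "set (a # b # js @ [c]) \<subseteq> {..<n}"
    "jacobian_bracket n (map fvar (a # b # js @ [c])) = (1 :: 'a mfps)"
proof -
  have n3: "Suc (Suc (Suc (n - 3))) = n" using n by simp
  have "card ({..<n} - set js) = 3"
    using assms n by (subst card_Diff_subset) (auto simp: distinct_card)
  then obtain a b c where abc: "{..<n} - set js = {a, b, c}" "a \<noteq> b" "a \<noteq> c" "b \<noteq> c"
    by (auto simp: card_3_iff)
  then have "a \<in> {..<n} - set js" "b \<in> {..<n} - set js" "c \<in> {..<n} - set js" by auto
  then have d: "distinct (a # b # js @ [c])" "set (a # b # js @ [c]) \<subseteq> {..<n}"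
    "distinct (b # a # js @ [c])" "set (b # a # js @ [c]) \<subseteq> {..<n}"
    using abc(2-4) assms by auto
  let ?x = "map fvar (a # b # js @ [c]) :: 'a mfps list"
  have "jacobian_bracket n (?x[0 := ?x ! 1, 1 := ?x ! 0]) = - jacobian_bracket n ?x"
    using assms n n3 by (intro jac.F_swap) (auto simp: tuples_def)
  then have sw: "jacobian_bracket n (map fvar (b # a # js @ [c]) :: 'a mfps list) = - jacobian_bracket n ?x" by simp
  have "jacobian_bracket n ?x = 1 \<or> jacobian_bracket n ?x = - 1"
    using d assms n3 by (intro jac_fvars) auto
  then show ?thesis using that[of a b c] that[of b a c] d sw by auto
qed

text \<open>With the coordinates in \<open>js\<close> fixed, the operators satisfy all assumptions
  of \<open>three_bracket\<close>: the bracket kills these coordinates, so commutators never leave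
  the three free directions. The defects vanish by Schur's rule.\<close>

lemma three_slots:
  assumes "distinct js" "length js = n - 3" "set js \<subseteq> {..<n}"
  obtains a b c where "distinct (a # b # js @ [c])" "set (a # b # js @ [c]) \<subseteq> {..<n}"
    "\<And>f p. \<rho> (f # p # map fvar js) = \<rho> ((f * pderiv_at a p) # fvar a # map fvar js)
      + \<rho> ((f * pderiv_at b p) # fvar b # map fvar js) + \<rho> ((f * pderiv_at c p) # fvar c # map fvar js)"
    "\<And>f p (g :: 'a mfps). jacobian_bracket n (f # p # map fvar js @ [g]) = jacobian_bracket n ((f * pderiv_at a p) # fvar a # map fvar js @ [g])
      + jacobian_bracket n ((f * pderiv_at b p) # fvar b # map fvar js @ [g]) + jacobian_bracket n ((f * pderiv_at c p) # fvar c # map fvar js @ [g])"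
proof -
  have n3: "Suc (Suc (Suc (n - 3))) = n" "n - 1 = Suc (Suc (n - 3))" using n by simp_all
  obtain a b c where abc: "distinct (a # b # js @ [c])" "set (a # b # js @ [c]) \<subseteq> {..<n}"
    "jacobian_bracket n (map fvar (a # b # js @ [c])) = (1 :: 'a mfps)"
    using complement_triple[OF assms] .
  define P where "P f g = \<rho> (f # g # map fvar js)" for f g
  define br where "br u v s = jacobian_bracket n (u # v # map fvar js @ [s :: 'a mfps])" for u v s
  note br_eq = jac_three[OF assms(2) abc, folded br_def]
  have lP: "length (f # g # map fvar js :: 'a mfps list) = n - 1" for f g using assms n3 by simp
  have brz: "br u v (fvar r) = 0" if r: "r \<in> set js" for u v r
  proof -
    have "r \<noteq> a" "r \<noteq> b" "r \<noteq> c" using r abc(1) by auto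
    then show ?thesis unfolding br_eq by simp
  qed
  have lieP: "P u v * P s t - P s t * P u v = P (br u v s) t + P s (br u v t)" for u v s t
  proof -
    let ?B = "s # t # map fvar js"
    have "P u v * P s t - P s t * P u v = (\<Sum>i<Suc (Suc (n - 3)). \<rho> (?B[i := br u v (?B ! i)]))"
      unfolding P_def br_def using lie[OF lP lP, of u v s t] n3 by simp
    also have "\<dots> = \<rho> (?B[0 := br u v s]) + \<rho> (?B[1 := br u v t]) + (\<Sum>i<n - 3. \<rho> (?B[Suc (Suc i) := br u v (?B ! Suc (Suc i))]))"
      by (simp only: sum.lessThan_Suc_shift) (simp add: add.assoc)
    also have "(\<Sum>i<n - 3. \<rho> (?B[Suc (Suc i) := br u v (?B ! Suc (Suc i))])) = 0"
    proof (rule sum.neutral, clarify)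
      fix i assume "i < n - 3"
      then have "br u v (?B ! Suc (Suc i)) = 0" using assms by (auto intro: brz)
      then show "\<rho> (?B[Suc (Suc i) := br u v (?B ! Suc (Suc i))]) = 0"
        using rho_zero[OF lP, of "Suc (Suc i)" s t] \<open>i < n - 3\<close> n3 by simp
    qed
    finally show ?thesis by (simp add: P_def)
  qed
  \<comment> \<open>In the quadratic relation for these tuples every summand that singles out a
    coordinate of \<open>js\<close> contains a repeated entry. Three summands remain, and a common
    sign \<open>n - 2\<close> comes from moving the last entry to the front.\<close>
  have quadP: "P u v * P s t - P u s * P v t + P v s * P u t = P (br u v s) t" for u v s t
  proof -
    let ?ts = "t # map fvar js" and ?hs = "u # v # map fvar js @ [s]"
    define M where "M h t = \<rho> (t # map fvar js @ [h])" for h t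
    have M: "M h t = signed (n - 2) (P h t)" for h t
      using rho.F_move_last[of "h # t # map fvar js" 0] lP[of h t] n
      unfolding M_def P_def by (simp add: tuples_def omit_def numeral_2_eq_2)
    have Mz: "M (fvar r) t = 0" if r: "r \<in> set js" for r
    proof -
      obtain q where q: "q < length js" "js ! q = r" using r by (auto simp: in_set_conv_nth)
      have "P (fvar r) t = 0" unfolding P_def
        using lP[of "fvar r" t] n3 q assms by (intro rho_alt[of _ 0 "Suc (Suc q)"]) auto
      then show ?thesis by (simp add: M)
    qed
    have nth: "?hs ! Suc (Suc i) = fvar (js ! i)" if "i < n - 3" for i using that assms by (simp add: nth_append)
    have "M (br u v s) t = (\<Sum>i<n. signed (n - 1 - i) (\<rho> (omit i ?hs) * M (?hs ! i) t))"
    proof -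
      have l: "length ?ts = n - 2" "length ?hs = n" using assms n3 by simp_all
      show ?thesis using quadratic[OF l] unfolding M_def br_def by (simp only: append_Cons)
    qed
    also have "\<dots> = (\<Sum>i<Suc (Suc (Suc (n - 3))). signed (n - 1 - i) (\<rho> (omit i ?hs) * M (?hs ! i) t))"
      using n3 by simp
    also have "\<dots> = signed (n - 1) (\<rho> (omit 0 ?hs) * M u t) + signed (n - 2) (\<rho> (omit 1 ?hs) * M v t)
       + (\<Sum>i<n - 3. signed (n - 1 - Suc (Suc i)) (\<rho> (omit (Suc (Suc i)) ?hs) * M (?hs ! Suc (Suc i)) t))
       + \<rho> (omit (Suc (Suc (n - 3))) ?hs) * M (?hs ! Suc (Suc (n - 3))) t"
      unfolding sum.lessThan_Suc[of _ "Suc (Suc (n - 3))"] by (simp only: sum.lessThan_Suc_shift) (simp add: n3 add.assoc numeral_2_eq_2)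
    also have "(\<Sum>i<n - 3. signed (n - 1 - Suc (Suc i)) (\<rho> (omit (Suc (Suc i)) ?hs) * M (?hs ! Suc (Suc i)) t)) = 0"
    proof (rule sum.neutral, clarify)
      fix i assume "i < n - 3"
      then have "M (?hs ! Suc (Suc i)) t = 0" using assms unfolding nth[OF \<open>i < n - 3\<close>] by (auto intro: Mz)
      then show "signed (n - 1 - Suc (Suc i)) (\<rho> (omit (Suc (Suc i)) ?hs) * M (?hs ! Suc (Suc i)) t) = 0" by simp
    qed
    also have "omit 0 ?hs = v # map fvar js @ [s]" by (simp add: omit_def)
    also have "omit 1 ?hs = u # map fvar js @ [s]" by (simp add: omit_def)
    also have "omit (Suc (Suc (n - 3))) ?hs = u # v # map fvar js" using assms by (simp add: omit_def)
    also have "?hs ! Suc (Suc (n - 3)) = s" using assms by (simp add: nth_append)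
    finally have "M (br u v s) t = signed (n - 1) (M s v * M u t) + signed (n - 2) (M s u * M v t) + P u v * M s t"
      unfolding M_def[of s v, symmetric] M_def[of s u, symmetric] P_def[of u v, symmetric] by simp
    moreover have "n - 1 = Suc (n - 2)" using n by simp
    ultimately have "signed (n - 2) (P (br u v s) t) = signed (n - 2) (- (P s v * P u t) + P s u * P v t + P u v * P s t)"
      unfolding M by (auto simp: signed_def split: if_splits)
    then have "P (br u v s) t = - (P s v * P u t) + P s u * P v t + P u v * P s t"
      by (metis signed_simps(4))
    moreover have "P s x = - P x s" for x
      using rho.F_swap[of "x # s # map fvar js" 0 1] lP[of x s] n unfolding P_def by (simp add: tuples_def)
    ultimately show ?thesis by simp
  qed
  interpret T: three_bracket "pderiv_at a" "pderiv_at b" "pderiv_at c" "integ a" "integ b" "fvar a" "fvar b" "fvar c" P br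
  proof unfold_locales
    show "P (f + g) h = P f h + P g h" for f g h using rho_add[OF lP, of 0 f h f g] n unfolding P_def by simp
    show "P h (f + g) = P h f + P h g" for f g h using rho_add[OF lP, of 1 h f f g] n unfolding P_def by simp
    show "P f f = 0" for f using rho_alt[OF lP, of 0 1 f f] n unfolding P_def by simp
    show "P 1 f = 0" for f using rho_one[OF lP, of 0 1 f] n unfolding P_def by simp
    show "P u v * P s t - P u s * P v t + P v s * P u t = P (br u v s) t" for u v s t by (rule quadP)
    show "P u v * P s t - P s t * P u v = P (br u v s) t + P s (br u v t)" for u v s t by (rule lieP)
    show "r + r = 0 \<Longrightarrow> r = 0" "r + r + r = 0 \<Longrightarrow> r = 0" for r :: 'r by (rule torsion_free, assumption)+
    show "br u v s = pderiv_at a u * (pderiv_at b v * pderiv_at c s - pderiv_at c v * pderiv_at b s) - 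
      pderiv_at b u * (pderiv_at a v * pderiv_at c s - pderiv_at c v * pderiv_at a s)
    + pderiv_at c u * (pderiv_at a v * pderiv_at b s - pderiv_at b v * pderiv_at a s)" for u v s
      by (rule br_eq)
  qed (use abc in \<open>auto simp: pderiv_mult pderiv_comm\<close>)
  have brk: "br f p g = br (f * pderiv_at a p) (fvar a) g + br (f * pderiv_at b p) (fvar b) g + br (f * pderiv_at c p) (fvar c) g" for f p g
    using abc(1) unfolding br_eq by (auto simp: pderiv_mult pderiv_comm[of b a] pderiv_comm[of c a] pderiv_comm[of c b] algebra_simps)
  have "T.defect f p = 0" for f p
  proof (rule T.defect_zero)
    fix f p r assume z: "T.defect f p * r = 0"
    \<comment> \<open>The four summands of a defect as a formal sum of tuples, with the minus signs
      absorbed into the first entries.\<close>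
    define A where "A = [f # p # map fvar js, (- (f * pderiv_at a p)) # fvar a # map fvar js,
       (- (f * pderiv_at b p)) # fvar b # map fvar js, (- (f * pderiv_at c p)) # fvar c # map fvar js]"
    have neg: "br (- u) v g = - br u v g" for u v g
      unfolding br_eq by (simp add: algebra_simps)
    have "sum_list (map \<rho> A) = T.defect f p"
      unfolding A_def T.defect_def using assms n3 by (simp add: rho_minus_Cons P_def)
    moreover have "sum_list (map (\<lambda>a. jacobian_bracket n (a @ [g])) A) = 0" for g
      unfolding A_def using brk[of f p g] by (simp add: neg br_def[symmetric])
    moreover have "length x = n - 1" if "x \<in> set A" for x using that lP unfolding A_def by auto
    ultimately show "T.defect f p = 0 \<or> r = 0" using schur[of A r] z by simp
  qed
  then have "P f p = P (f * pderiv_at a p) (fvar a) + P (f * pderiv_at b p) (fvar b) + P (f * pderiv_at c p) (fvar c)" for f p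
  proof -
    have "P f p = T.defect f p + (P (f * pderiv_at a p) (fvar a) + P (f * pderiv_at b p) (fvar b) + P (f * pderiv_at c p) (fvar c))"
      unfolding T.defect_def by simp
    then show ?thesis using \<open>\<And>f p. T.defect f p = 0\<close> by simp
  qed
  note P_eq = this[unfolded P_def] and br_eq' = brk[unfolded br_def]
  show ?thesis by (rule that[OF abc(1,2)]) (rule P_eq, rule br_eq')
qed

end

section \<open>Well-definedness of the operator attached to a field\<close>

context nrep begin

definition G :: "'a mfps list \<Rightarrow> ('a mfps \<Rightarrow> 'a mfps) \<times> 'r" where
  "G fs = ((\<lambda>g. jacobian_bracket n (fs @ [g])), \<rho> fs)"

definition std :: "('a mfps \<times> nat list) list \<Rightarrow> bool" where
  "std gs \<longleftrightarrow> (\<forall>(g, I)\<in>set gs. distinct I \<and> length I = n - 2 \<and> set I \<subseteq> {..<n})"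

definition Gs :: "('a mfps \<times> nat list) list \<Rightarrow> ('a mfps \<Rightarrow> 'a mfps) \<times> 'r" where
  "Gs gs = sum_list (map (\<lambda>(g, I). G (g # map fvar I)) gs)"

text \<open>The relation between fields and operators spanned by standard tuples. The goal is that
  it contains the pair of every tuple and is the graph of a map.\<close>

definition R where "R = {Gs gs | gs. std gs}"

sublocale G: alt_map "n - 1" UNIV G
proof
  fix xs :: "'a mfps list" and i u v assume x: "xs \<in> tuples (n - 1) UNIV" "i < n - 1"
  then have l: "length (xs @ [g]) = n" "length xs = n - 1" for g using n by (auto simp: tuples_def)
  have "jacobian_bracket n (xs[i := u + v] @ [g]) = jacobian_bracket n (xs[i := u] @ [g]) + jacobian_bracket n (xs[i := v] @ [g])" for g
    using jac_add[OF _ l(1), of i g u v] x l by (simp add: list_update_append)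
  then show "G (xs[i := u + v]) = G (xs[i := u]) + G (xs[i := v])"
    using rho_add[OF l(2) x(2)] by (auto simp: G_def)
next
  fix xs :: "'a mfps list" and i j assume x: "xs \<in> tuples (n - 1) UNIV" "i < j" "j < n - 1" "xs ! i = xs ! j"
  then have l: "length (xs @ [g]) = n" "length xs = n - 1" for g using n by (auto simp: tuples_def)
  have "jacobian_bracket n (xs @ [g]) = 0" for g
    using x l by (intro jac_alt[of i n j]) (auto simp: nth_append)
  then show "G xs = 0" using rho_alt[OF l(2) x(2-4)] by (auto simp: G_def zero_prod_def)
qed simp

lemma R_zero: "0 \<in> R"
  unfolding R_def by (auto intro!: exI[of _ "[]"] simp: Gs_def std_def)

lemma R_add: "a \<in> R \<Longrightarrow> b \<in> R \<Longrightarrow> a + b \<in> R"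
proof -
  assume "a \<in> R" "b \<in> R"
  then obtain as bs where "a = Gs as" "std as" "b = Gs bs" "std bs" unfolding R_def by auto
  then have "a + b = Gs (as @ bs)" "std (as @ bs)" by (auto simp: Gs_def std_def)
  then show ?thesis unfolding R_def by blast
qed

lemma R_basic: "distinct I \<Longrightarrow> length I = n - 2 \<Longrightarrow> set I \<subseteq> {..<n} \<Longrightarrow> G (g # map fvar I) \<in> R"
  unfolding R_def by (auto intro!: exI[of _ "[(g, I)]"] simp: Gs_def std_def)

lemma G_minus_Cons: "length fs = n - 2 \<Longrightarrow> G ((- g) # fs) = - G (g # fs)"
proof -
  assume l: "length fs = n - 2"
  then have t: "g # fs \<in> tuples (n - 1) UNIV" using n by (simp add: tuples_def)
  have "G ((g # fs)[0 := - g + g]) = G ((g # fs)[0 := - g]) + G ((g # fs)[0 := g])"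
    using t n by (intro G.F_add) auto
  moreover have "G ((g # fs)[0 := 0]) = 0" using t n by (intro G.F_zero) auto
  ultimately show ?thesis by (simp add: eq_neg_iff_add_eq_0)
qed

lemma Gs_minus: "std gs \<Longrightarrow> - Gs gs = Gs (map (\<lambda>(g, I). (- g, I)) gs)"
  by (induction gs) (auto simp: Gs_def std_def G_minus_Cons)

lemma R_minus: "a \<in> R \<Longrightarrow> - a \<in> R"
proof -
  assume "a \<in> R"
  then obtain as where as: "a = Gs as" "std as" unfolding R_def by auto
  have "std (map (\<lambda>(g, I). (- g, I)) as)" using as(2) by (auto simp: std_def)
  then show ?thesis using Gs_minus[OF as(2)] as(1) unfolding R_def by auto
qed

lemma R_signed: "signed k a \<in> R \<longleftrightarrow> a \<in> R"
  using R_minus[of a] R_minus[of "- a"] by (auto simp: signed_def)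

lemma R_sum_list: "(\<And>a. a \<in> set A \<Longrightarrow> F a \<in> R) \<Longrightarrow> sum_list (map F A) \<in> R"
  by (induction A) (auto intro: R_zero R_add)

lemma R_sum: "(\<And>a. a \<in> A \<Longrightarrow> F a \<in> R) \<Longrightarrow> sum F A \<in> R"
  by (induction A rule: infinite_finite_induct) (auto intro: R_zero R_add)

lemma R_three:
  assumes js: "distinct js" "length js = n - 3" "set js \<subseteq> {..<n}"
  shows "G (f # p # map fvar js) \<in> R"
proof -
  obtain a b c where abc: "distinct (a # b # js @ [c])" "set (a # b # js @ [c]) \<subseteq> {..<n}"
    and eq: "\<And>f p. \<rho> (f # p # map fvar js) = \<rho> ((f * pderiv_at a p) # fvar a # map fvar js)
      + \<rho> ((f * pderiv_at b p) # fvar b # map fvar js) + \<rho> ((f * pderiv_at c p) # fvar c # map fvar js)"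
    "\<And>f p (g :: 'a mfps). jacobian_bracket n (f # p # map fvar js @ [g]) = jacobian_bracket n ((f * pderiv_at a p) # fvar a # map fvar js @ [g])
      + jacobian_bracket n ((f * pderiv_at b p) # fvar b # map fvar js @ [g]) + jacobian_bracket n ((f * pderiv_at c p) # fvar c # map fvar js @ [g])"
    using three_slots[OF js] by metis
  have "G (f # p # map fvar js) = G ((f * pderiv_at a p) # map fvar (a # js))
      + G ((f * pderiv_at b p) # map fvar (b # js)) + G ((f * pderiv_at c p) # map fvar (c # js))"
    unfolding G_def using eq[of f p] by (auto simp: fun_eq_iff)
  moreover have "Suc (n - 3) = n - 2" using n by simp
  ultimately show ?thesis using abc js by (auto intro!: R_add R_basic simp del: list.map)
qed

text \<open>A standard tuple with one coordinate replaced still contains \<open>n - 3\<close>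
  coordinates, so after a reordering it falls under the case of two free series.\<close>

lemma R_update:
  assumes I: "distinct I" "length I = n - 2" "set I \<subseteq> {..<n}" and i: "i < n - 1"
  shows "G ((g # map fvar I)[i := h]) \<in> R"
proof (cases i)
  case 0
  then show ?thesis using I by (auto intro: R_basic)
next
  case (Suc j)
  then have j: "j < n - 2" using i by simp
  let ?ys = "g # (map fvar I)[j := h]" and ?J = "omit j I"
  let ?xs = "g # h # map fvar ?J"
  have "set (take j I) \<inter> set (drop (Suc j) I) = {}"
    using I by (intro set_take_disj_set_drop_if_distinct) auto
  then have J: "distinct ?J" "length ?J = n - 3" "set ?J \<subseteq> {..<n}"
    using I j by (auto simp: omit_def dest: in_set_takeD in_set_dropD)
  have "G (omit 1 ?xs @ [?xs ! 1]) = signed (n - 1 - 1 - 1) (G ?xs)"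
    using J n by (intro G.F_move_last) (auto simp: tuples_def)
  moreover have "G (omit (Suc j) ?ys @ [?ys ! Suc j]) = signed (n - 1 - 1 - Suc j) (G ?ys)"
    using I n j by (intro G.F_move_last) (auto simp: tuples_def)
  moreover have "omit 1 ?xs @ [?xs ! 1] = omit (Suc j) ?ys @ [?ys ! Suc j]"
    using I j by (simp add: omit_def take_map drop_map)
  ultimately have "signed (n - 1 - 1 - Suc j) (G ?ys) \<in> R"
    using R_three[OF J, of g h] by (metis R_signed)
  then show ?thesis using Suc by (simp add: R_signed)
qed

text \<open>Applying the field to the slots one by one is the same as taking commutators in both
  components of the pair. The right-hand side is additive in the pair and no longer mentions the
  tuple, so it can be computed from any other expression of the pair.\<close>

lemma commutator_G:
  assumes c: "vdiv n c = 0" and p: "\<And>b. length b = n - 1 \<Longrightarrow> p * \<rho> b - \<rho> b * p = (\<Sum>i<n - 1. \<rho> (b[i := vf n c (b ! i)]))"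
    and b: "length b = n - 1"
  shows "(\<Sum>i<n - 1. G (b[i := vf n c (b ! i)])) = 
     ((\<lambda>g. vf n c (fst (G b) g) - fst (G b) (vf n c g)), p * snd (G b) - snd (G b) * p)"
proof -
  have n1: "n = Suc (n - 1)" using n by simp
  have "vf n c (jacobian_bracket n (b @ [g])) = (\<Sum>i<n - 1. jacobian_bracket n (b[i := vf n c (b ! i)] @ [g])) + jacobian_bracket n (b @ [vf n c g])" for g
  proof -
    have "vf n c (jacobian_bracket n (b @ [g])) = (\<Sum>i<n. jacobian_bracket n ((b @ [g])[i := vf n c ((b @ [g]) ! i)]))"
      using b n by (intro vf_jac c) auto
    also have "\<dots> = (\<Sum>i<Suc (n - 1). jacobian_bracket n ((b @ [g])[i := vf n c ((b @ [g]) ! i)]))"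
      using n1 by simp
    also have "\<dots> = (\<Sum>i<n - 1. jacobian_bracket n (b[i := vf n c (b ! i)] @ [g])) + jacobian_bracket n (b @ [vf n c g])"
      unfolding sum.lessThan_Suc using b by (simp add: nth_append list_update_append list_update_length[of b, unfolded b])
    finally show ?thesis .
  qed
  then have 1: "(\<Sum>i<n - 1. jacobian_bracket n (b[i := vf n c (b ! i)] @ [g])) = vf n c (jacobian_bracket n (b @ [g])) - jacobian_bracket n (b @ [vf n c g])" for g
    by simp
  have 2: "(\<Sum>i\<in>A. G (F i)) = ((\<lambda>g. \<Sum>i\<in>A. jacobian_bracket n (F i @ [g])), \<Sum>i\<in>A. \<rho> (F i))" for A :: "nat set" and F
    by (induction A rule: infinite_finite_induct) (auto simp: G_def zero_prod_def fun_eq_iff)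
  show ?thesis unfolding 2 1 p[OF b, symmetric] by (simp add: G_def)
qed

text \<open>By \<open>commutator_G\<close>, the action of a field on a pair in the span may be
  computed on its standard summands, where each term has a single replaced slot. The span is thus
  stable under all divergence-free fields, and coordinates can be exchanged for series.\<close>

lemma R_G: "length fs = n - 1 \<Longrightarrow> G fs \<in> R"
proof (rule coordinate_extension[where k = "n - 1" and r = 2 and js = "[3..<n]" and q = 0 and n = n])
  fix c :: "nat \<Rightarrow> 'a mfps" and b assume c: "vdiv n c = 0" "length b = n - 1" "G b \<in> R"
  obtain p where p: "\<And>b. length b = n - 1 \<Longrightarrow> p * \<rho> b - \<rho> b * p = (\<Sum>i<n - 1. \<rho> (b[i := vf n c (b ! i)]))"
    using field_element[OF c(1)] by blast
  define \<Theta> :: "('a mfps \<Rightarrow> 'a mfps) \<times> 'r \<Rightarrow> ('a mfps \<Rightarrow> 'a mfps) \<times> 'r" where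
    "\<Theta> x = ((\<lambda>g. vf n c (fst x g) - fst x (vf n c g)), p * snd x - snd x * p)" for x
  have v0: "vf n c 0 = 0" by (simp add: vf_def)
  have \<Theta>: "\<Theta> (sum_list (map F A)) = sum_list (map (\<lambda>a. \<Theta> (F a)) A)" for F and A :: "('a mfps \<times> nat list) list"
  proof -
    have "\<Theta> (x + y) = \<Theta> x + \<Theta> y" for x y
      by (auto simp: \<Theta>_def fun_eq_iff vf_add algebra_simps)
    moreover have "\<Theta> 0 = 0" by (auto simp: \<Theta>_def fun_eq_iff zero_prod_def v0)
    ultimately show ?thesis by (induction A) auto
  qed
  obtain gs where gs: "G b = Gs gs" "std gs" using c(3) unfolding R_def by auto
  have "(\<Sum>i<n - 1. G (b[i := vf n c (b ! i)])) = \<Theta> (G b)"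
    unfolding \<Theta>_def by (rule commutator_G[OF c(1) p c(2)])
  also have "\<dots> = sum_list (map (\<lambda>x. \<Theta> (case x of (g, I) \<Rightarrow> G (g # map fvar I))) gs)"
    unfolding gs Gs_def by (rule \<Theta>)
  also have "\<dots> \<in> R"
  proof (rule R_sum_list)
    fix x assume "x \<in> set gs"
    then obtain g I where x: "x = (g, I)" "distinct I" "length I = n - 2" "set I \<subseteq> {..<n}"
      using gs(2) unfolding std_def by auto
    have "\<Theta> (G (g # map fvar I)) = (\<Sum>i<n - 1. G ((g # map fvar I)[i := vf n c ((g # map fvar I) ! i)]))"
      unfolding \<Theta>_def using x n by (intro commutator_G[OF c(1) p, symmetric]) auto
    also have "\<dots> \<in> R" by (intro R_sum R_update x) auto
    finally show "\<Theta> (case x of (g, I) \<Rightarrow> G (g # map fvar I)) \<in> R" by (simp add: x)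
  qed
  finally show "(\<Sum>i<n - 1. G (b[i := vf n c (b ! i)])) \<in> R" .
next
  fix fs :: "'a mfps list" and i assume "length fs = n - 1" "i < n - 1"
  then show "G (fs[i := 0]) = 0" by (intro G.F_zero) (auto simp: tuples_def)
next
  show "0 \<in> R" by (rule R_zero)
next
  fix a b assume "a \<in> R" "b \<in> R"
  then show "a - b \<in> R" using R_add[OF _ R_minus, of a b] by simp
next
  fix fs :: "'a mfps list" assume "length fs = 2"
  then obtain f p where "fs = [f, p]" by (auto simp: length_Suc_conv numeral_2_eq_2)
  then show "G (fs @ map fvar [3..<n]) \<in> R" using n by (auto intro!: R_three simp del: map_upt_eqI)
qed (use n in auto)

text \<open>A partial derivative turns each coordinate into 0 or 1, and the operator of a tuple with
  such an entry is zero.\<close>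

lemma rho_coord_zero:
  assumes "length I = n - 2" "q < n" and p: "\<And>b. length b = n - 1 \<Longrightarrow> p * \<rho> b - \<rho> b * p = (\<Sum>i<n - 1. \<rho> (b[i := vf n (coord_field q) (b ! i)]))"
  shows "p * \<rho> (g # map fvar I) - \<rho> (g # map fvar I) * p = \<rho> (pderiv_at q g # map fvar I)"
proof -
  let ?b = "g # map fvar I"
  have l: "length ?b = n - 1" using assms n by simp
  have n1: "n - 1 = Suc (n - 2)" using n by simp
  have "p * \<rho> ?b - \<rho> ?b * p = (\<Sum>i<n - 1. \<rho> (?b[i := vf n (coord_field q) (?b ! i)]))" by (rule p[OF l])
  also have "\<dots> = \<rho> (?b[0 := vf n (coord_field q) (?b ! 0)]) + (\<Sum>i<n - 2. \<rho> (?b[Suc i := vf n (coord_field q) (?b ! Suc i)]))"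
    unfolding n1 sum.lessThan_Suc_shift ..
  also have "(\<Sum>i<n - 2. \<rho> (?b[Suc i := vf n (coord_field q) (?b ! Suc i)])) = 0"
  proof (rule sum.neutral, clarify)
    fix i assume "i < n - 2"
    then have "vf n (coord_field q) (?b ! Suc i) = (if q = I ! i then 1 else 0)" using assms by (simp add: coord_field)
    moreover have "\<rho> (?b[Suc i := 1]) = 0" using \<open>i < n - 2\<close> l by (intro rho_one[of _ "Suc i"]) auto
    moreover have "\<rho> (?b[Suc i := 0]) = 0" using \<open>i < n - 2\<close> l by (intro rho_zero) auto
    ultimately show "\<rho> (?b[Suc i := vf n (coord_field q) (?b ! Suc i)]) = 0" by auto
  qed
  finally show ?thesis using assms by (simp add: coord_field)
qed

text \<open>Integration of the series in the variable with index 1 gives a sum whose field has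
  coefficients independent of that variable. A second expression of this field uses only series
  independent of the variable. The difference is central, so both operators have the same commutator
  with the partial derivative: this is \<open>t\<close> for the first and zero for the
  second.\<close>

lemma R_graph:
  assumes "(0, t) \<in> R"
  shows "t = 0"
proof -
  obtain gs where gs: "(0, t) = Gs gs" "std gs" using assms unfolding R_def by auto
  have fstGs: "fst (Gs hs) f = (\<Sum>(g, I)\<leftarrow>hs. jacobian_bracket n (g # map fvar I @ [f]))" for hs f
    unfolding Gs_def by (induction hs) (auto simp: G_def)
  have sndGs: "snd (Gs hs) = (\<Sum>(g, I)\<leftarrow>hs. \<rho> (g # map fvar I))" for hs
    unfolding Gs_def by (induction hs) (auto simp: G_def)
  \<comment> \<open>The commutator with the derivative in the same variable will undo this
    integration.\<close>
  define bs where "bs = map (\<lambda>(g, I). (integ 1 g, I)) gs"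
  have bs: "std bs" using gs(2) by (auto simp: std_def bs_def)
  define c where "c r = sum_list (map (\<lambda>(g, I). jfield n (g # map fvar I) r) bs)" for r
  have c: "c = (\<lambda>r. sum_list (map (\<lambda>x. jfield n (fst x # map fvar (snd x)) r) bs))"
    unfolding c_def by (simp add: case_prod_unfold)
  have stdD: "length (fst x # map fvar (snd x) :: 'a mfps list) = n - 1" if "x \<in> set hs" "std hs" for x hs
    using that n unfolding std_def by auto
  have vfc: "vf n c f = fst (Gs bs) f" for f
  proof -
    have "vf n c f = sum_list (map (\<lambda>x. vf n (jfield n (fst x # map fvar (snd x))) f) bs)"
      unfolding c by (rule vf_sum_list)
    also have "\<dots> = sum_list (map (\<lambda>x. jacobian_bracket n ((fst x # map fvar (snd x)) @ [f])) bs)"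
      using stdD[OF _ bs] n by (intro arg_cong[of _ _ sum_list] map_cong refl jac_snoc[symmetric]) auto
    finally show ?thesis unfolding fstGs by (simp add: case_prod_unfold)
  qed
  have div: "vdiv n c = 0"
  proof -
    have "vdiv n c = sum_list (map (\<lambda>x. vdiv n (jfield n (fst x # map fvar (snd x)))) bs)"
      unfolding c by (rule vdiv_sum_list)
    also have "\<dots> = sum_list (map (\<lambda>x. 0) bs)"
      using stdD[OF _ bs] n by (intro arg_cong[of _ _ sum_list] map_cong refl vdiv_jfield) auto
    finally show ?thesis by simp
  qed
  obtain p where p: "\<And>b. length b = n - 1 \<Longrightarrow> p * \<rho> b - \<rho> b * p = (\<Sum>i<n - 1. \<rho> (b[i := vf n (coord_field 1) (b ! i)]))"
    and pc: "\<And>r. (\<And>b. length b = n - 1 \<Longrightarrow> r * \<rho> b = \<rho> b * r) \<Longrightarrow> r * p = p * r"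
    using field_element[OF coord_field(2)] by blast
  have D1: "1 < n" using n by simp
  have jac_coord: "pderiv_at 1 (jacobian_bracket n (g # map fvar I @ [fvar r])) = jacobian_bracket n (pderiv_at 1 g # map fvar I @ [fvar r])"
    if "length I = n - 2" for g I r
  proof -
    let ?x = "g # map fvar I @ [fvar r]"
    have l: "length ?x = n" using that n by simp
    have n1: "n = Suc (n - 1)" using n by simp
    have "pderiv_at 1 (jacobian_bracket n ?x) = (\<Sum>k<n. jacobian_bracket n (?x[k := pderiv_at 1 (?x ! k)]))"
      by (rule pderiv_jac[OF l])
    also have "\<dots> = (\<Sum>k<n. if k = 0 then jacobian_bracket n (?x[0 := pderiv_at 1 g]) else 0)"
    proof (rule sum.cong[OF refl])
      fix k assume k: "k \<in> {..<n}"
      show "jacobian_bracket n (?x[k := pderiv_at 1 (?x ! k)]) = (if k = 0 then jacobian_bracket n (?x[0 := pderiv_at 1 g]) else 0)"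
      proof (cases k)
        case (Suc j)
        then have "\<exists>q. ?x ! k = fvar q" using k that n1 by (cases "j < n - 2") (auto simp: nth_append less_Suc_eq)
        then have "pderiv_at 1 (?x ! k) = 0 \<or> pderiv_at 1 (?x ! k) = 1" by auto
        moreover have "jacobian_bracket n (?x[k := 0]) = 0" using k l by (intro jac.F_zero) (auto simp: tuples_def)
        moreover have "jacobian_bracket n (?x[k := 1]) = 0" using k l by (intro jac_one) auto
        ultimately show ?thesis using Suc by auto
      qed simp
    qed
    finally show ?thesis using n by simp
  qed
  have "pderiv_at 1 (c r) = fst (Gs gs) (fvar r)" for r
  proof -
    have "pderiv_at 1 (c r) = sum_list (map (\<lambda>(g, I). pderiv_at 1 (jacobian_bracket n (g # map fvar I @ [fvar r]))) bs)"
      unfolding c pderiv_sum_list by (simp add: jfield_def case_prod_unfold)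
    also have "\<dots> = sum_list (map (\<lambda>(g, I). jacobian_bracket n (pderiv_at 1 g # map fvar I @ [fvar r])) bs)"
      using bs by (intro arg_cong[of _ _ sum_list] map_cong refl) (auto simp: std_def jac_coord[unfolded One_nat_def])
    also have "\<dots> = fst (Gs gs) (fvar r)"
      unfolding fstGs bs_def by (simp add: o_def case_prod_unfold)
    finally show ?thesis .
  qed
  then have c0: "pderiv_at 1 (c r) = 0" for r using gs(1) by (metis fst_conv zero_fun_apply)
  \<comment> \<open>The coefficients of \<open>c\<close> have zero derivative in this variable, so
    the series of the new decomposition do too.\<close>
  obtain hs :: "('a mfps \<times> nat list) list" where hs: "\<forall>(g, I)\<in>set hs. distinct I \<and> length I = n - 2 \<and> set I \<subseteq> {..<n} \<and>
        ((\<forall>r<n. pderiv_at 1 (c r) = 0) \<longrightarrow> pderiv_at 1 g = 0)"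
    "\<forall>f. vf n c f = (\<Sum>(g, I)\<leftarrow>hs. jacobian_bracket n (g # map fvar I @ [f]))"
    using field_decomposition[OF n div] by (elim exE conjE) rule
  have hs1: "std hs" "\<And>g I. (g, I) \<in> set hs \<Longrightarrow> pderiv_at 1 g = 0" 
    using hs(1) c0 unfolding std_def by auto
  define A where "A = map (\<lambda>(g, I). g # map fvar I) (bs @ map (\<lambda>(g, I). (- g, I)) hs)"
  have "sum_list (map G A) = Gs (bs @ map (\<lambda>(g, I). (- g, I)) hs)"
    unfolding A_def Gs_def by (simp add: o_def case_prod_unfold)
  also have "\<dots> = Gs bs + Gs (map (\<lambda>(g, I). (- g, I)) hs)" by (simp add: Gs_def)
  also have "\<dots> = Gs bs - Gs hs" using Gs_minus[OF hs1(1)] by simp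
  finally have GA: "sum_list (map G A) = Gs bs - Gs hs" .
  have rhoA: "sum_list (map \<rho> A) = snd (Gs bs) - snd (Gs hs)"
    using arg_cong[OF GA, of snd] unfolding snd_sum_list by (simp add: G_def)
  have jacA: "sum_list (map (\<lambda>a. jacobian_bracket n (a @ [f])) A) = 0" for f
  proof -
    have "sum_list (map (\<lambda>a. jacobian_bracket n (a @ [f])) A) = fst (sum_list (map G A)) f"
      unfolding fst_sum_list by (simp add: G_def sum_list_apply)
    also have "\<dots> = fst (Gs bs) f - fst (Gs hs) f" unfolding GA by simp
    also have "\<dots> = 0" using vfc[of f] hs(2) fstGs[of hs f] by simp
    finally show ?thesis .
  qed
  have lA: "length a = n - 1" if "a \<in> set A" for a
    using that bs hs1(1) n unfolding A_def std_def by auto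
  have comm: "(snd (Gs bs) - snd (Gs hs)) * p = p * (snd (Gs bs) - snd (Gs hs))"
    using pc[of "sum_list (map \<rho> A)"] kernel_central[OF lA jacA] unfolding rhoA by blast
  have sc: "p * snd (Gs ks) - snd (Gs ks) * p = (\<Sum>(g, I)\<leftarrow>ks. \<rho> (pderiv_at 1 g # map fvar I))" if "std ks" for ks
  proof -
    have "p * snd (Gs ks) - snd (Gs ks) * p = sum_list (map (\<lambda>x. p * \<rho> (fst x # map fvar (snd x)) - \<rho> (fst x # map fvar (snd x)) * p) ks)"
      unfolding sndGs case_prod_unfold by (rule sum_list_commutator)
    also have "\<dots> = sum_list (map (\<lambda>x. \<rho> (pderiv_at 1 (fst x) # map fvar (snd x))) ks)"
      using that D1 by (intro arg_cong[of _ _ sum_list] map_cong refl rho_coord_zero p) (auto simp: std_def)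
    finally show ?thesis by (simp add: case_prod_unfold)
  qed
  have "(\<Sum>(g, I)\<leftarrow>hs. \<rho> (pderiv_at 1 g # map fvar I)) = sum_list (map (\<lambda>x. 0) hs)"
  proof (intro arg_cong[of _ _ sum_list] map_cong refl, clarify)
    fix g I assume "(g, I) \<in> set hs"
    then have "pderiv_at 1 g = 0" "length (g # map fvar I :: 'a mfps list) = n - 1" using hs1 n unfolding std_def by auto
    then show "\<rho> (pderiv_at 1 g # map fvar I) = 0"
      using rho_zero[of "g # map fvar I" 0] n by simp
  qed
  then have "p * snd (Gs hs) - snd (Gs hs) * p = 0" using sc[OF hs1(1)] by simp
  moreover have "p * snd (Gs bs) - snd (Gs bs) * p = t"
    using sc[OF bs] arg_cong[OF gs(1), of snd] unfolding sndGs bs_def by (simp add: o_def case_prod_unfold)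
  ultimately show ?thesis using comm by (simp add: algebra_simps)
qed

theorem kernel_zero:
  assumes "\<And>a. a \<in> set A \<Longrightarrow> length a = n - 1" "\<And>g. sum_list (map (\<lambda>a. jacobian_bracket n (a @ [g])) A) = 0"
  shows "sum_list (map \<rho> A) = 0"
proof (rule R_graph)
  have "sum_list (map G A) = (0, sum_list (map \<rho> A))"
    using assms(2) by (intro prod_eqI) (auto simp: fst_sum_list snd_sum_list G_def fun_eq_iff sum_list_apply)
  moreover have "sum_list (map G A) \<in> R" using assms(1) by (intro R_sum_list R_G)
  ultimately show "(0, sum_list (map \<rho> A)) \<in> R" by simp
qed

end

section \<open>The operators of a module\<close>

text \<open>The additive endomorphisms form a ring as a type, which makes the operators of a module an
  instance of the ring-valued maps in \<open>nrep\<close>.\<close>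

typedef (overloaded) 'm aend = "{f :: 'm::ab_group_add \<Rightarrow> 'm. \<forall>x y. f (x + y) = f x + f y}"
  morphisms app Aend
  by (rule exI[of _ "\<lambda>_. 0"]) simp

setup_lifting type_definition_aend

lemma app_zero_right [simp]: "app f 0 = 0"
proof -
  have "app f (0 + 0) = app f 0 + app f 0" using app[of f] by blast
  then show ?thesis by simp
qed

lemma app_add_right: "app f (x + y) = app f x + app f y"
  using app[of f] by blast

instantiation aend :: (ab_group_add) ring
begin

lift_definition zero_aend :: "'a aend" is "\<lambda>_. 0" by simp
lift_definition plus_aend :: "'a aend \<Rightarrow> 'a aend \<Rightarrow> 'a aend" is "\<lambda>f g x. f x + g x"
  by (simp add: algebra_simps)
lift_definition uminus_aend :: "'a aend \<Rightarrow> 'a aend" is "\<lambda>f x. - f x" by simp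
lift_definition minus_aend :: "'a aend \<Rightarrow> 'a aend \<Rightarrow> 'a aend" is "\<lambda>f g x. f x - g x"
  by (simp add: algebra_simps)
lift_definition times_aend :: "'a aend \<Rightarrow> 'a aend \<Rightarrow> 'a aend" is "\<lambda>f g x. f (g x)" by simp

instance
  by standard (transfer, simp add: fun_eq_iff algebra_simps)+

end

lemma app_simps [simp]:
  "app 0 x = 0" "app (f + g) x = app f x + app g x" "app (- f) x = - app f x"
  "app (f - g) x = app f x - app g x" "app (f * g) x = app f (app g x)"
  by (transfer, simp)+

lemma app_sum: "app (sum f A) x = (\<Sum>a\<in>A. app (f a) x)"
  by (induction A rule: infinite_finite_induct) auto

lemma app_sum_list: "app (sum_list (map f A)) x = sum_list (map (\<lambda>a. app (f a) x) A)"
  by (induction A) auto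

lemma app_signed: "app (signed k f) x = signed k (app f x)"
  by (simp add: signed_def)

lemma aend_eqI: "(\<And>x. app f x = app g x) \<Longrightarrow> f = g"
  by (simp add: app_inject[symmetric] fun_eq_iff)

section \<open>The identities satisfied by the action of a module\<close>

context n_Lie_module
begin

lemma V_zero: "0 \<in> V" and V_add: "u \<in> V \<Longrightarrow> v \<in> V \<Longrightarrow> u + v \<in> V"
proof -
  have "0 \<in> V \<times> (UNIV :: 'm set)" using sum.subspace_0[OF sum.subspace_V] by simp
  then show "0 \<in> V" by (simp add: zero_prod_def)
  assume "u \<in> V" "v \<in> V"
  then have "(u, 0) + (v, 0) \<in> V \<times> (UNIV :: 'm set)" by (intro sum.subspace_add[OF sum.subspace_V]) auto
  then show "u + v \<in> V" by simp
qed

sublocale B: alt_map n "V \<times> (UNIV :: 'm set)" B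
  by unfold_locales (auto intro: V_add sum.br_add sum.br_alternating)

abbreviation emb :: "'v list \<Rightarrow> ('v \<times> 'm) list" where "emb vs \<equiv> map (\<lambda>v. (v, 0)) vs"

abbreviation act :: "'v list \<Rightarrow> 'm \<Rightarrow> 'm" where "act \<equiv> module_act B"

lemma emb_tuples: "vs \<in> tuples k V \<Longrightarrow> emb vs \<in> tuples k (V \<times> UNIV)"
  by (auto simp: tuples_def)

lemma emb_snoc_tuples: "vs \<in> tuples (n - 1) V \<Longrightarrow> n \<ge> 1 \<Longrightarrow> emb vs @ [(0, m)] \<in> tuples n (V \<times> UNIV)"
  by (auto simp: tuples_def V_zero)

lemma B_act: "vs \<in> tuples (n - 1) V \<Longrightarrow> n \<ge> 1 \<Longrightarrow> B (emb vs @ [(0, m)]) = (0, act vs m)"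
proof -
  assume vs: "vs \<in> tuples (n - 1) V" "n \<ge> 1"
  have "fst (B (emb vs @ [(0, m)])) = 0"
    using vs by (intro ideal[of _ "n - 1"] emb_snoc_tuples) (auto simp: tuples_def nth_append)
  then show ?thesis by (simp add: module_act_def prod_eq_iff)
qed

lemma snoc_update: "length xs = n - 1 \<Longrightarrow> n \<ge> 1 \<Longrightarrow> (xs @ [x])[n - 1 := y] = xs @ [y]"
  by (metis list_update_length)

lemma act_add_right: "vs \<in> tuples (n - 1) V \<Longrightarrow> n \<ge> 1 \<Longrightarrow> act vs (m + m') = act vs m + act vs m'"
proof -
  assume vs: "vs \<in> tuples (n - 1) V" "n \<ge> 1"
  have up: "(emb vs @ [(0, 0)])[n - 1 := x] = emb vs @ [x]" for x using vs by (intro snoc_update) (auto simp: tuples_def)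
  have "B (emb vs @ [(0, m) + (0, m')]) = B (emb vs @ [(0, m)]) + B (emb vs @ [(0, m')])"
    using B.F_add[OF emb_snoc_tuples[OF vs, of 0], of "n - 1" "(0, m)" "(0, m')"] vs unfolding up by (simp add: V_zero)
  then show ?thesis using vs by (simp add: B_act)
qed

lemma act_scale_right: "vs \<in> tuples (n - 1) V \<Longrightarrow> n \<ge> 1 \<Longrightarrow> act vs (scaleM c m) = scaleM c (act vs m)"
proof -
  assume vs: "vs \<in> tuples (n - 1) V" "n \<ge> 1"
  have up: "(emb vs @ [(0, 0)])[n - 1 := x] = emb vs @ [x]" for x using vs by (intro snoc_update) (auto simp: tuples_def)
  have "scaleV c 0 = 0"
    using sum.scale_zero_right[of c] by (simp add: scale_pair_def zero_prod_def)
  then have "B (emb vs @ [(0, scaleM c m)]) = scale_pair scaleV scaleM c (B (emb vs @ [(0, m)]))"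
    using sum.br_scale[OF emb_snoc_tuples[OF vs, of 0], of "n - 1" "(0, m)" c] vs unfolding up by (simp add: V_zero scale_pair_def)
  then show ?thesis using vs by (simp add: B_act scale_pair_def)
qed

lemma act_zero_right: "vs \<in> tuples (n - 1) V \<Longrightarrow> n \<ge> 1 \<Longrightarrow> act vs 0 = 0"
  using act_add_right[of vs 0 0] by simp

lemma act_minus_right: "vs \<in> tuples (n - 1) V \<Longrightarrow> n \<ge> 1 \<Longrightarrow> act vs (- m) = - act vs m"
  using act_add_right[of vs m "- m"] act_zero_right[of vs] by (simp add: eq_neg_iff_add_eq_0 add.commute)

lemma act_add: "vs \<in> tuples (n - 1) V \<Longrightarrow> i < n - 1 \<Longrightarrow> u \<in> V \<Longrightarrow> v \<in> V \<Longrightarrow>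
   act (vs[i := u + v]) m = act (vs[i := u]) m + act (vs[i := v]) m"
proof -
  assume a: "vs \<in> tuples (n - 1) V" "i < n - 1" "u \<in> V" "v \<in> V"
  then have up: "emb (vs[i := x]) @ [(0, m)] = (emb vs @ [(0, m)])[i := (x, 0)]" for x
    by (simp add: map_update list_update_append tuples_def)
  have "B ((emb vs @ [(0, m)])[i := (u, 0) + (v, 0)]) = B ((emb vs @ [(0, m)])[i := (u, 0)]) + B ((emb vs @ [(0, m)])[i := (v, 0)])"
    using a by (intro B.F_add emb_snoc_tuples) auto
  then show ?thesis unfolding module_act_def up by simp
qed

lemma act_scale: "vs \<in> tuples (n - 1) V \<Longrightarrow> i < n - 1 \<Longrightarrow> v \<in> V \<Longrightarrow>
   act (vs[i := scaleV c v]) m = scaleM c (act (vs[i := v]) m)"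
proof -
  assume a: "vs \<in> tuples (n - 1) V" "i < n - 1" "v \<in> V"
  then have up: "emb (vs[i := x]) @ [(0, m)] = (emb vs @ [(0, m)])[i := (x, 0)]" for x
    by (simp add: map_update list_update_append tuples_def)
  have "B ((emb vs @ [(0, m)])[i := scale_pair scaleV scaleM c (v, 0)]) = scale_pair scaleV scaleM c (B ((emb vs @ [(0, m)])[i := (v, 0)]))"
    using a by (intro sum.br_scale emb_snoc_tuples) auto
  then show ?thesis unfolding module_act_def up by (simp add: scale_pair_def)
qed

lemma act_alt: "vs \<in> tuples (n - 1) V \<Longrightarrow> i < j \<Longrightarrow> j < n - 1 \<Longrightarrow> vs ! i = vs ! j \<Longrightarrow> act vs m = 0"
proof -
  assume a: "vs \<in> tuples (n - 1) V" "i < j" "j < n - 1" "vs ! i = vs ! j"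
  then have "B (emb vs @ [(0, m)]) = 0"
    by (intro B.F_alt[of _ i j] emb_snoc_tuples) (auto simp: nth_append tuples_def)
  then show ?thesis by (simp add: module_act_def)
qed

text \<open>The fundamental identity with the module element as the last entry of the inner
  bracket.\<close>

lemma act_lie:
  assumes as: "as \<in> tuples (n - 1) V" and bs: "bs \<in> tuples (n - 1) V" and n: "n \<ge> 1"
    and br: "\<And>xs. xs \<in> tuples n V \<Longrightarrow> br xs \<in> V"
  shows "act as (act bs m) = (\<Sum>i<n - 1. act (bs[i := br (as @ [bs ! i])]) m) + act bs (act as m)"
proof -
  let ?x = "emb bs @ [(0, m)]"
  have n1: "n = Suc (n - 1)" using n by simp
  have l: "length as = n - 1" "length bs = n - 1" using as bs by (auto simp: tuples_def)
  have "B (emb as @ [B ?x]) = (\<Sum>i<n. B (?x[i := B (emb as @ [?x ! i])]))"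
    by (rule sum.fundamental_identity[OF emb_tuples[OF as] emb_snoc_tuples[OF bs n]])
  also have "\<dots> = (\<Sum>i<Suc (n - 1). B (?x[i := B (emb as @ [?x ! i])]))" using n1 by simp
  also have "\<dots> = (\<Sum>i<n - 1. B (?x[i := B (emb as @ [?x ! i])])) + B (?x[n - 1 := B (emb as @ [?x ! (n - 1)])])"
    by (rule sum.lessThan_Suc)
  also have "B (?x[n - 1 := B (emb as @ [?x ! (n - 1)])]) = (0, act bs (act as m))"
  proof -
    have "?x ! (n - 1) = (0, m)" using l by (simp add: nth_append)
    moreover have "?x[n - 1 := y] = emb bs @ [y]" for y using l n by (intro snoc_update) auto
    ultimately show ?thesis using as bs n by (simp add: B_act)
  qed
  also have "(\<Sum>i<n - 1. B (?x[i := B (emb as @ [?x ! i])])) = (\<Sum>i<n - 1. (0, act (bs[i := br (as @ [bs ! i])]) m))"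
  proof (rule sum.cong[OF refl])
    fix i assume i: "i \<in> {..<n - 1}"
    have t: "as @ [bs ! i] \<in> tuples n V" using as bs i n by (auto simp: tuples_def)
    have "B (emb as @ [?x ! i]) = B (emb (as @ [bs ! i]))" using i l by (simp add: nth_append)
    also have "\<dots> = (br (as @ [bs ! i]), 0)" by (rule subalgebra[OF t])
    finally have "B (?x[i := B (emb as @ [?x ! i])]) = B (emb (bs[i := br (as @ [bs ! i])]) @ [(0, m)])"
      using i l by (simp add: list_update_append map_update)
    also have "\<dots> = (0, act (bs[i := br (as @ [bs ! i])]) m)"
      using bs n by (intro B_act tuples_update br[OF t])
    finally show "B (?x[i := B (emb as @ [?x ! i])]) = (0, act (bs[i := br (as @ [bs ! i])]) m)" .
  qed
  finally have "(0 :: 'v, act as (act bs m)) = (\<Sum>i<n - 1. (0, act (bs[i := br (as @ [bs ! i])]) m)) + (0, act bs (act as m))"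
    using as bs n by (simp add: B_act)
  then show ?thesis by (simp add: prod_eq_iff snd_sum)
qed

lemma B_one_module_entry:
  assumes bs: "bs \<in> tuples n V" and i: "i < n"
  shows "B ((emb bs)[i := (0, m)]) = (0, signed (n - 1 - i) (act (omit i bs) m))"
proof -
  let ?x = "(emb bs)[i := (0, m)]"
  have x: "?x \<in> tuples n (V \<times> UNIV)" using bs by (intro tuples_update emb_tuples) (auto simp: V_zero)
  have l: "length bs = n" using bs by (simp add: tuples_def)
  have o: "omit i bs \<in> tuples (n - 1) V" using bs i by (rule omit_in_tuples)
  have "omit i ?x @ [?x ! i] = emb (omit i bs) @ [(0, m)]"
    using i l by (simp add: omit_update_same map_omit)
  then have "signed (n - 1 - i) (B ?x) = (0, act (omit i bs) m)"
    using B.F_move_last[OF x i] B_act[OF o] i by simp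
  then have "B ?x = signed (n - 1 - i) (0, act (omit i bs) m)" by (metis signed_simps(4))
  then show ?thesis by (simp add: signed_def)
qed

text \<open>The fundamental identity with the module element among the outer entries: the inner
  bracket then lies in the algebra, and on the right the module element is carried into each slot in
  turn.\<close>

lemma act_quad:
  assumes ts: "ts \<in> tuples (n - 2) V" and hs: "hs \<in> tuples n V" and n: "n \<ge> 2"
    and br: "\<And>xs. xs \<in> tuples n V \<Longrightarrow> br xs \<in> V"
  shows "act (ts @ [br hs]) m = (\<Sum>i<n. signed (n - 1 - i) (act (omit i hs) (act (ts @ [hs ! i]) m)))"
proof -
  let ?as = "emb ts @ [(0, m)]"
  have l: "length ts = n - 2" "length hs = n" using ts hs by (auto simp: tuples_def)
  have n2: "n = Suc (Suc (n - 2))" "n - 1 = Suc (n - 2)" using n by simp_all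
  have as: "?as \<in> tuples (n - 1) (V \<times> UNIV)" using ts n by (auto simp: tuples_def V_zero)
  have tsh: "ts @ [h] \<in> tuples (n - 1) V" if "h \<in> V" for h using ts n that by (auto simp: tuples_def)
  \<comment> \<open>The module element stands in the last but one place; the exchange with
    \<open>h\<close> costs one sign.\<close>
  have last: "B (?as @ [(h, 0)]) = (0, - act (ts @ [h]) m)" if h: "h \<in> V" for h
  proof -
    let ?x = "emb (ts @ [h]) @ [(0, m)]"
    have "?x ! (n - 1) = (0, m)" "?x ! (n - 2) = (h, 0)" using l n2 by (auto simp: nth_append)
    moreover have "?x[n - 2 := (0, m), n - 1 := (h, 0)] = ?as @ [(h, 0)]"
      using l n2 by (intro nth_equalityI) (auto simp: nth_append nth_list_update less_Suc_eq)
    ultimately have "B (?as @ [(h, 0)]) = - B ?x"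
      using B.F_swap[OF emb_snoc_tuples[OF tsh[OF h], of m], of "n - 2" "n - 1"] n by simp
    then show ?thesis using B_act[OF tsh[OF h], of m] n by simp
  qed
  have hV: "hs ! i \<in> V" if "i < n" for i using hs that by (rule tuples_nth)
  have "B (?as @ [B (emb hs)]) = (\<Sum>i<n. B ((emb hs)[i := B (?as @ [emb hs ! i])]))"
    by (rule sum.fundamental_identity[OF as emb_tuples[OF hs]])
  moreover have "B ((emb hs)[i := B (?as @ [emb hs ! i])]) = (0, - signed (n - 1 - i) (act (omit i hs) (act (ts @ [hs ! i]) m)))" if "i < n" for i
  proof -
    have h: "emb hs ! i = (hs ! i, 0)" using that l by simp
    show ?thesis
      unfolding h last[OF hV[OF that]] B_one_module_entry[OF hs that]
      using act_minus_right[OF omit_in_tuples[OF hs that]] n by (simp add: signed_minus)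
  qed
  ultimately have "(0 :: 'v, - act (ts @ [br hs]) m) = (\<Sum>i<n. (0, - signed (n - 1 - i) (act (omit i hs) (act (ts @ [hs ! i]) m))))"
    using subalgebra[OF hs] last[OF br[OF hs]] by simp
  then show ?thesis by (simp add: prod_eq_iff snd_sum sum_negf)
qed

end

lemma tuples_map_trunc: "length fs = k \<Longrightarrow> map (trunc n) fs \<in> tuples k (mfps_in n)"
  by (auto simp: tuples_def)

lemma tuples_trunc_ident: "fs \<in> tuples k (mfps_in n) \<Longrightarrow> map (trunc n) fs = fs"
  by (intro map_idI trunc_ident) (auto simp: tuples_def)

lemma jac_in_tuples: "xs \<in> tuples n (mfps_in n) \<Longrightarrow> jacobian_bracket n xs \<in> mfps_in n"
  by (rule jac_in) (auto simp: tuples_def)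

text \<open>By Schur's lemma a formal sum of tuples that acts trivially on the power series acts on an
  irreducible module by zero or injectively; the quadratic identity excludes the second case.\<close>

lemma module_kernel_zero:
  fixes scaleM :: "'a::field_char_0 \<Rightarrow> 'm::ab_group_add \<Rightarrow> 'm"
  assumes n: "n \<ge> 3" and M: "n_Lie_module mfps_scale n (mfps_in n) (jacobian_bracket n) scaleM B"
    and irr: "irreducible_under scaleM (module_act B ` tuples (n - 1) (mfps_in n))"
    and A: "\<And>a. a \<in> set A \<Longrightarrow> a \<in> tuples (n - 1) (mfps_in n)"
    and zero: "\<And>g. g \<in> mfps_in n \<Longrightarrow> sum_list (map (\<lambda>a. jacobian_bracket n (a @ [g])) A) = 0"
  shows "sum_list (map (\<lambda>a. module_act B a m) A) = 0"
proof -
  interpret n_Lie_module mfps_scale n "mfps_in n" "jacobian_bracket n" scaleM B by (rule M)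
  have n1: "n \<ge> 1" "n \<ge> 2" using n by auto
  \<comment> \<open>Truncation extends the operators to arbitrary series, so that the identities
    hold for all tuples of the right length.\<close>
  define \<rho> where "\<rho> fs = Aend (act (map (trunc n) fs))" for fs :: "'a mfps list"
  have app_rho: "app (\<rho> fs) m = act (map (trunc n) fs) m" if "length fs = n - 1" for fs m
    unfolding \<rho>_def using act_add_right[OF tuples_map_trunc[OF that] n1(1)] by (subst Aend_inverse) auto
  have jt: "trunc n (jacobian_bracket n xs) = jacobian_bracket n (map (trunc n) xs)" if "length xs = n" for xs :: "'a mfps list"
    using that by (rule trunc_jac)
  have appA: "app (sum_list (map \<rho> A)) m = sum_list (map (\<lambda>a. act (map (trunc n) a) m) A)"
    if "\<And>a. a \<in> set A \<Longrightarrow> length a = n - 1" for A m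
    unfolding app_sum_list using that by (intro arg_cong[of _ _ sum_list] map_cong refl app_rho)
  interpret nrep n \<rho>
  proof
    show "n \<ge> 3" by (rule n)
  next
    fix fs :: "'a mfps list" and i f g assume l: "length fs = n - 1" and i: "i < n - 1"
    show "\<rho> (fs[i := f + g]) = \<rho> (fs[i := f]) + \<rho> (fs[i := g])"
      using act_add[OF tuples_map_trunc[OF l] i, of "trunc n f" "trunc n g"] l
      by (intro aend_eqI) (simp add: app_rho map_update)
  next
    fix fs :: "'a mfps list" and i j assume l: "length fs = n - 1" and i: "i < j" "j < n - 1" "fs ! i = fs ! j"
    show "\<rho> fs = 0"
      using act_alt[OF tuples_map_trunc[OF l] i(1,2)] i l by (intro aend_eqI) (simp add: app_rho)
  next
    fix as bs :: "'a mfps list" assume l: "length as = n - 1" "length bs = n - 1"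
    note t = tuples_map_trunc[OF l(1), of n] tuples_map_trunc[OF l(2), of n]
    have "act (map (trunc n) as) (act (map (trunc n) bs) x) = (\<Sum>i<n - 1. act (map (trunc n) (bs[i := jacobian_bracket n (as @ [bs ! i])])) x)
       + act (map (trunc n) bs) (act (map (trunc n) as) x)" for x
      using act_lie[OF t n1(1) jac_in_tuples, of x] l n by (simp add: map_update jt)
    then show "\<rho> as * \<rho> bs - \<rho> bs * \<rho> as = (\<Sum>i<n - 1. \<rho> (bs[i := jacobian_bracket n (as @ [bs ! i])]))"
      using l by (intro aend_eqI) (simp add: app_rho app_sum)
  next
    fix ts hs :: "'a mfps list" assume l: "length ts = n - 2" "length hs = n"
    note t = tuples_map_trunc[OF l(1), of n] tuples_map_trunc[OF l(2), of n]
    have "act (map (trunc n) (ts @ [jacobian_bracket n hs])) x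
      = (\<Sum>i<n. signed (n - 1 - i) (act (map (trunc n) (omit i hs)) (act (map (trunc n) (ts @ [hs ! i])) x)))" for x
      using act_quad[OF t n1(2) jac_in_tuples, of x] l n by (simp add: map_omit jt)
    then show "\<rho> (ts @ [jacobian_bracket n hs]) = (\<Sum>i<n. signed (n - 1 - i) (\<rho> (omit i hs) * \<rho> (ts @ [hs ! i])))"
      using l n by (intro aend_eqI) (simp add: app_rho app_sum app_signed)
  next
    have two: "x = 0" if "x + x = 0" for x :: 'm
    proof -
      have "scaleM 2 x = scaleM (1 + 1) x" by simp
      also have "\<dots> = x + x" unfolding M.scale_left_distrib by simp
      finally have "scaleM 2 x = 0" using that by simp
      then show ?thesis by simp
    qed
    have three: "x = 0" if "x + x + x = 0" for x :: 'm
    proof -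
      have "scaleM 3 x = scaleM (1 + 1 + 1) x" by simp
      also have "\<dots> = x + x + x" unfolding M.scale_left_distrib by simp
      finally have "scaleM 3 x = 0" using that by simp
      then show ?thesis by simp
    qed
    show "r = 0" if "r + r = 0" for r :: "'m aend"
      by (rule aend_eqI) (metis app_simps(1,2) that two)
    show "r = 0" if "r + r + r = 0" for r :: "'m aend"
      by (rule aend_eqI) (metis app_simps(1,2) that three)
  next
    fix A and r :: "'m aend" assume l: "\<And>a. a \<in> set A \<Longrightarrow> length a = n - 1"
      and z: "\<And>g. sum_list (map (\<lambda>a. jacobian_bracket n (a @ [g])) A) = 0"
      and r: "sum_list (map \<rho> A) * r = 0"
    define T where "T = app (sum_list (map \<rho> A))"
    have T: "T x = sum_list (map (\<lambda>a. act (map (trunc n) a) x) A)" for x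
      unfolding T_def by (rule appA) (rule l)
    \<comment> \<open>The same computation as for \<open>kernel_central\<close>, carried out on the
      module, since it is part of the proof that the assumptions of \<open>nrep\<close>
      hold.\<close>
    have comm: "T (act b x) = act b (T x)" if b: "b \<in> tuples (n - 1) (mfps_in n)" for b x
    proof -
      have tA: "map (trunc n) a \<in> tuples (n - 1) (mfps_in n)" if "a \<in> set A" for a
        using l[OF that] by (rule tuples_map_trunc)
      have lb: "length b = n - 1" using b by (simp add: tuples_def)
      have sl: "act b (sum_list (map F A)) = sum_list (map (\<lambda>a. act b (F a)) A)" for F :: "'a mfps list \<Rightarrow> 'm" and A
        by (induction A) (auto simp: act_add_right[OF b n1(1)] act_zero_right[OF b n1(1)])
      have bi: "b ! i = trunc n (b ! i)" if "i < n - 1" for i using b that by (simp add: trunc_ident tuples_nth)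
      let ?J = "\<lambda>a i. jacobian_bracket n (map (trunc n) a @ [b ! i])"
      have "T (act b x) = sum_list (map (\<lambda>a. act (map (trunc n) a) (act b x)) A)" by (rule T)
      also have "\<dots> = sum_list (map (\<lambda>a. (\<Sum>i<n - 1. act (b[i := ?J a i]) x) + act b (act (map (trunc n) a) x)) A)"
        by (intro arg_cong[of _ _ sum_list] map_cong refl act_lie[OF tA b n1(1) jac_in_tuples])
      also have "\<dots> = sum_list (map (\<lambda>a. \<Sum>i<n - 1. act (b[i := ?J a i]) x) A) + sum_list (map (\<lambda>a. act b (act (map (trunc n) a) x)) A)"
        by (rule sum_list_addf)
      also have "sum_list (map (\<lambda>a. act b (act (map (trunc n) a) x)) A) = act b (T x)"
        unfolding T sl ..
      also have "sum_list (map (\<lambda>a. \<Sum>i<n - 1. act (b[i := ?J a i]) x) A) = (\<Sum>i<n - 1. sum_list (map (\<lambda>a. act (b[i := ?J a i]) x) A))"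
        by (induction A) (auto simp: sum.distrib)
      also have "\<dots> = (\<Sum>i<n - 1. act (b[i := sum_list (map (\<lambda>a. ?J a i) A)]) x)"
      proof (rule sum.cong[OF refl])
        fix i assume i: "i \<in> {..<n - 1}"
        have J: "?J a i \<in> mfps_in n" if "length a = n - 1" for a
          using i b that n by (intro jac_in_tuples) (auto simp: tuples_def)
        have z0: "act (b[i := 0]) x = 0" using act_add[OF b, of i 0 0 x] i by simp
        have "sum_list (map (\<lambda>a. ?J a i) A) \<in> mfps_in n \<and>
          sum_list (map (\<lambda>a. act (b[i := ?J a i]) x) A) = act (b[i := sum_list (map (\<lambda>a. ?J a i) A)]) x"
          using l
        proof (induction A)
          case (Cons a A)
          then show ?case using J[of a] act_add[OF b, of i "?J a i" "sum_list (map (\<lambda>a. ?J a i) A)" x] i by auto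
        qed (simp add: z0)
        then show "sum_list (map (\<lambda>a. act (b[i := ?J a i]) x) A) = act (b[i := sum_list (map (\<lambda>a. ?J a i) A)]) x" by blast
      qed
      also have "\<dots> = 0"
      proof (rule sum.neutral, clarify)
        fix i assume i: "i < n - 1"
        have "sum_list (map (\<lambda>a. ?J a i) A) = sum_list (map (\<lambda>a. trunc n (jacobian_bracket n (a @ [b ! i]))) A)"
          using l n i bi[OF i] by (intro arg_cong[of _ _ sum_list] map_cong refl) (simp add: jt)
        also have "\<dots> = trunc n (sum_list (map (\<lambda>a. jacobian_bracket n (a @ [b ! i])) A))"
          by (induction A) auto
        finally have "sum_list (map (\<lambda>a. ?J a i) A) = 0" using z by simp
        then show "act (b[i := sum_list (map (\<lambda>a. ?J a i) A)]) x = 0"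
          using act_add[OF b, of i 0 0 x] i by simp
      qed
      finally show ?thesis by simp
    qed
    define N where "N = {x. T x = 0}"
    have Tadd: "T (x + y) = T x + T y" for x y unfolding T_def by (rule app_add_right)
    have T0: "T 0 = 0" unfolding T_def by simp
    have Tscale: "T (scaleM c x) = scaleM c (T x)" for c x
    proof -
      have "T (scaleM c x) = sum_list (map (\<lambda>a. scaleM c (act (map (trunc n) a) x)) A)"
        unfolding T using l by (intro arg_cong[of _ _ sum_list] map_cong refl act_scale_right tuples_map_trunc n1)
      also have "\<dots> = scaleM c (T x)" unfolding T by (induction A) (auto simp: M.scale_right_distrib)
      finally show ?thesis .
    qed
    have "M.subspace N" unfolding N_def by (rule M.subspaceI) (auto simp: Tadd Tscale T0)
    moreover have "\<forall>t\<in>act ` tuples (n - 1) (mfps_in n). \<forall>x\<in>N. t x \<in> N"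
      using comm act_zero_right n1 by (auto simp: N_def)
    ultimately have "N = {0} \<or> N = UNIV" using irr unfolding irreducible_under_def by blast
    then show "sum_list (map \<rho> A) = 0 \<or> r = 0"
    proof
      assume "N = {0}"
      moreover have "app r x \<in> N" for x
        using arg_cong[OF r, of "\<lambda>h. app h x"] unfolding N_def T_def by simp
      ultimately have "app r x = 0" for x by auto
      then show ?thesis by (intro disjI2 aend_eqI) simp
    next
      assume "N = UNIV"
      then have "T x = 0" for x unfolding N_def by blast
      then show ?thesis unfolding T_def by (intro disjI1 aend_eqI) simp
    qed
  qed
  have lA: "length a = n - 1" if "a \<in> set A" for a using A[OF that] by (simp add: tuples_def)
  \<comment> \<open>A field is determined by its values at the coordinates, which lie in
    \<open>mfps_in n\<close>; so the hypothesis extends to all series.\<close>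
  have "sum_list (map (\<lambda>a. jacobian_bracket n (a @ [g])) A) = 0" for g
  proof -
    have "sum_list (map (\<lambda>a. jacobian_bracket n (a @ [g])) A) = sum_list (map (\<lambda>a. vf n (jfield n a) g) A)"
      using lA n by (intro arg_cong[of _ _ sum_list] map_cong refl jac_snoc) auto
    also have "\<dots> = vf n (\<lambda>r. sum_list (map (\<lambda>a. jacobian_bracket n (a @ [fvar r])) A)) g"
      by (simp only: vf_sum_list) (simp add: jfield_def[abs_def])
    also have "\<dots> = 0" by (simp add: vf_def zero)
    finally show ?thesis .
  qed
  then have "sum_list (map \<rho> A) = 0" by (intro kernel_zero lA)
  then have "app (sum_list (map \<rho> A)) m = 0" by simp
  moreover have "sum_list (map (\<lambda>a. act (map (trunc n) a) m) A) = sum_list (map (\<lambda>a. act a m) A)"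
    by (intro arg_cong[of _ _ sum_list] map_cong refl) (simp add: tuples_trunc_ident[OF A])
  moreover have "app (sum_list (map \<rho> A)) m = sum_list (map (\<lambda>a. act (map (trunc n) a) m) A)"
    by (rule appA) (rule lA)
  ultimately show ?thesis by simp
qed

section \<open>Representations of the enveloping algebra\<close>

definition word_act :: "('l \<Rightarrow> 'm \<Rightarrow> 'm) \<Rightarrow> 'l list \<Rightarrow> 'm \<Rightarrow> 'm" where
  "word_act \<sigma> w = foldr (\<lambda>x f. \<sigma> x \<circ> f) w id"

lemma word_act_simps [simp]: "word_act \<sigma> [] = id" "word_act \<sigma> (x # w) = \<sigma> x \<circ> word_act \<sigma> w"
  by (simp_all add: word_act_def)

lemma word_act_append: "word_act \<sigma> (u @ v) = word_act \<sigma> u \<circ> word_act \<sigma> v"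
  by (induction u) auto

definition free_act :: "('a::field \<Rightarrow> 'm::ab_group_add \<Rightarrow> 'm) \<Rightarrow> ('l \<Rightarrow> 'm \<Rightarrow> 'm) \<Rightarrow> ('l list \<Rightarrow> 'a) \<Rightarrow> 'm \<Rightarrow> 'm" where
  "free_act scaleM \<sigma> p m = (\<Sum>w | p w \<noteq> 0. scaleM (p w) (word_act \<sigma> w m))"

lemma linear_iff': "vector_space t \<Longrightarrow> Vector_Spaces.linear t t f \<longleftrightarrow> (\<forall>x y. f (x + y) = f x + f y) \<and> (\<forall>c x. f (t c x) = t c (f x))"
  by (simp add: Vector_Spaces.linear_iff)

lemma ring_endo:
  assumes "vector_space scaleM" shows "ring (endo_ring scaleM)"
proof -
  interpret vector_space scaleM by fact
  note lin = linear_iff'[OF assms]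
  show ?thesis
  proof (rule ringI)
    show "abelian_group (endo_ring scaleM)"
    proof (rule abelian_groupI)
      fix S assume "S \<in> carrier (endo_ring scaleM)"
      then show "\<exists>T\<in>carrier (endo_ring scaleM). T \<oplus>\<^bsub>endo_ring scaleM\<^esub> S = \<zero>\<^bsub>endo_ring scaleM\<^esub>"
        by (intro bexI[of _ "\<lambda>m. - S m"]) (auto simp: endo_ring_def lin)
    qed (auto simp: endo_ring_def lin scale_right_distrib algebra_simps)
    show "Group.monoid (endo_ring scaleM)"
      by (rule monoidI) (auto simp: endo_ring_def lin)
  qed (auto simp: endo_ring_def lin fun_eq_iff)
qed

lemma free_algebra_simps:
  "\<one>\<^bsub>free_algebra L\<^esub> = (\<lambda>w. if w = [] then 1 else 0)" "\<zero>\<^bsub>free_algebra L\<^esub> = (\<lambda>w. 0)"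
  "p \<oplus>\<^bsub>free_algebra L\<^esub> q = (\<lambda>w. p w + q w)"
  by (simp_all add: free_algebra_def)

lemma free_mult: "p \<otimes>\<^bsub>free_algebra L\<^esub> q = (\<lambda>w. \<Sum>k\<le>length w. p (take k w) * q (drop k w))"
  by (simp add: free_algebra_def)

lemma free_carrier: "p \<in> carrier (free_algebra L) \<longleftrightarrow> finite {w. p w \<noteq> 0} \<and> (\<forall>w. p w \<noteq> 0 \<longrightarrow> set w \<subseteq> L)"
  by (simp add: free_algebra_def)

lemma free_gen_in: "x \<in> L \<Longrightarrow> free_gen x \<in> carrier (free_algebra L)"
  by (auto simp: free_carrier free_gen_def)

lemma free_const_in: "free_const c \<in> carrier (free_algebra L)"
  by (auto simp: free_carrier free_const_def)

section \<open>Extension of a Lie algebra representation to the enveloping algebra\<close>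

locale lie_rep = M: vector_space scaleM
  for scaleM :: "'a::field \<Rightarrow> 'm::ab_group_add \<Rightarrow> 'm" +
  fixes L :: "'l::ab_group_add set" and s :: "'a \<Rightarrow> 'l \<Rightarrow> 'l" and br :: "'l \<Rightarrow> 'l \<Rightarrow> 'l" and \<sigma> :: "'l \<Rightarrow> 'm \<Rightarrow> 'm"
  assumes L_closed: "\<And>x y. x \<in> L \<Longrightarrow> y \<in> L \<Longrightarrow> x + y \<in> L" "\<And>c x. x \<in> L \<Longrightarrow> s c x \<in> L"
      "\<And>x y. x \<in> L \<Longrightarrow> y \<in> L \<Longrightarrow> br x y \<in> L"
    and \<sigma>_linear: "x \<in> L \<Longrightarrow> Vector_Spaces.linear scaleM scaleM (\<sigma> x)"
    and \<sigma>_add: "x \<in> L \<Longrightarrow> y \<in> L \<Longrightarrow> \<sigma> (x + y) m = \<sigma> x m + \<sigma> y m"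
    and \<sigma>_scale: "x \<in> L \<Longrightarrow> \<sigma> (s c x) m = scaleM c (\<sigma> x m)"
    and \<sigma>_br: "x \<in> L \<Longrightarrow> y \<in> L \<Longrightarrow> \<sigma> (br x y) m = \<sigma> x (\<sigma> y m) - \<sigma> y (\<sigma> x m)"
begin

abbreviation "ev \<equiv> free_act scaleM \<sigma>"
abbreviation "A \<equiv> (free_algebra L :: ('l list \<Rightarrow> 'a) ring)"
abbreviation "E \<equiv> endo_ring scaleM"
abbreviation "I \<equiv> (uea_ideal L s br :: ('l list \<Rightarrow> 'a) set)"
abbreviation "U \<equiv> (uea L s br :: ('l list \<Rightarrow> 'a) set ring)"

lemmas lin = linear_iff'[OF M.vector_space_axioms]

lemma word_linear: "set w \<subseteq> L \<Longrightarrow> Vector_Spaces.linear scaleM scaleM (word_act \<sigma> w)"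
  by (induction w) (use \<sigma>_linear in \<open>auto simp: lin\<close>)

lemma word_add: "set w \<subseteq> L \<Longrightarrow> word_act \<sigma> w (x + y) = word_act \<sigma> w x + word_act \<sigma> w y"
  and word_scale: "set w \<subseteq> L \<Longrightarrow> word_act \<sigma> w (scaleM c x) = scaleM c (word_act \<sigma> w x)"
  using word_linear[of w] by (auto simp: lin)

lemma word_sum: "set w \<subseteq> L \<Longrightarrow> word_act \<sigma> w (sum f S) = (\<Sum>a\<in>S. word_act \<sigma> w (f a))"
  using word_scale[of w 0 0] by (induction S rule: infinite_finite_induct) (auto simp: word_add)

lemma ev_eq: "finite S \<Longrightarrow> {w. p w \<noteq> 0} \<subseteq> S \<Longrightarrow> ev p m = (\<Sum>w\<in>S. scaleM (p w) (word_act \<sigma> w m))"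
  unfolding free_act_def by (rule sum.mono_neutral_left) auto

lemma ev_add: 
  assumes "p \<in> carrier A" "q \<in> carrier A"
  shows "ev (p \<oplus>\<^bsub>A\<^esub> q) m = ev p m + ev q m"
proof -
  let ?S = "{w. p w \<noteq> 0} \<union> {w. q w \<noteq> 0}"
  have S: "finite ?S" using assms by (simp add: free_carrier)
  have sub: "{w. (p \<oplus>\<^bsub>A\<^esub> q) w \<noteq> 0} \<subseteq> ?S" by (auto simp: free_algebra_simps)
  show ?thesis
    using ev_eq[OF S sub, of m] ev_eq[OF S, of p m] ev_eq[OF S, of q m]
    by (simp add: free_algebra_simps M.scale_left_distrib sum.distrib)
qed

lemma ev_linear: 
  assumes "p \<in> carrier A" shows "Vector_Spaces.linear scaleM scaleM (ev p)"
proof -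
  have w: "set w \<subseteq> L" if "p w \<noteq> 0" for w using assms that by (simp add: free_carrier)
  then show ?thesis unfolding lin free_act_def
    by (auto simp: word_add word_scale M.scale_right_distrib sum.distrib M.scale_sum_right mult.commute intro!: sum.cong)
qed

text \<open>A term of the product is a word with a cutting position. The pairs that contribute
  correspond to pairs of words in the two supports, by concatenation and the length of the first
  word.\<close>

lemma ev_mult: 
  assumes "p \<in> carrier A" "q \<in> carrier A"
  shows "ev (p \<otimes>\<^bsub>A\<^esub> q) m = ev p (ev q m)"
proof -
  let ?P = "{w. p w \<noteq> 0}" and ?Q = "{w. q w \<noteq> 0}"
  have fin: "finite ?P" "finite ?Q" using assms by (auto simp: free_carrier)
  have PL: "set u \<subseteq> L" if "u \<in> ?P" for u using assms that by (auto simp: free_carrier)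
  let ?S = "(\<lambda>(u, v). u @ v) ` (?P \<times> ?Q)"
  let ?g = "\<lambda>u v. scaleM (p u * q v) (word_act \<sigma> (u @ v) m)"
  let ?h = "\<lambda>(u, v). (u @ v, length u)"
  have supp: "{w. (p \<otimes>\<^bsub>A\<^esub> q) w \<noteq> 0} \<subseteq> ?S"
  proof clarify
    fix w assume "(p \<otimes>\<^bsub>A\<^esub> q) w \<noteq> 0"
    then obtain k where "p (take k w) * q (drop k w) \<noteq> 0" unfolding free_mult by (meson sum.neutral)
    then show "w \<in> ?S" by (intro image_eqI[of _ _ "(take k w, drop k w)"]) auto
  qed
  have "ev (p \<otimes>\<^bsub>A\<^esub> q) m = (\<Sum>w\<in>?S. scaleM ((p \<otimes>\<^bsub>A\<^esub> q) w) (word_act \<sigma> w m))"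
    using fin supp by (intro ev_eq) auto
  also have "\<dots> = (\<Sum>w\<in>?S. \<Sum>k\<le>length w. ?g (take k w) (drop k w))"
    unfolding free_mult M.scale_sum_left by simp
  also have "\<dots> = (\<Sum>(w, k)\<in>(SIGMA w:?S. {..length w}). ?g (take k w) (drop k w))"
    using fin by (subst sum.Sigma) auto
  also have "\<dots> = (\<Sum>(w, k)\<in>?h ` (?P \<times> ?Q). ?g (take k w) (drop k w))"
  proof (rule sum.mono_neutral_right)
    show "\<forall>x\<in>(SIGMA w:?S. {..length w}) - ?h ` (?P \<times> ?Q). (case x of (w, k) \<Rightarrow> ?g (take k w) (drop k w)) = 0"
    proof
      fix x assume x: "x \<in> (SIGMA w:?S. {..length w}) - ?h ` (?P \<times> ?Q)"
      obtain w k where wkx: "x = (w, k)" by (cases x)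
      then have wk: "w \<in> ?S" "k \<le> length w" "(w, k) \<notin> ?h ` (?P \<times> ?Q)" using x by auto
      have e: "(w, k) = ?h (take k w, drop k w)" using wk(2) by simp
      have "(take k w, drop k w) \<notin> ?P \<times> ?Q" 
      proof
        assume "(take k w, drop k w) \<in> ?P \<times> ?Q"
        then have "?h (take k w, drop k w) \<in> ?h ` (?P \<times> ?Q)" by (rule imageI)
        then show False unfolding e[symmetric] using wk(3) by contradiction
      qed
      then have "p (take k w) * q (drop k w) = 0" by auto
      then show "(case x of (w, k) \<Rightarrow> ?g (take k w) (drop k w)) = 0" by (simp add: wkx)
    qed
  qed (use fin in auto)
  also have "\<dots> = (\<Sum>(u, v)\<in>?P \<times> ?Q. ?g u v)"
  proof -
    have inj: "inj_on ?h (?P \<times> ?Q)" by (auto simp: inj_on_def)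
    show ?thesis unfolding sum.reindex[OF inj] by (intro sum.cong refl) auto
  qed
  also have "\<dots> = (\<Sum>u\<in>?P. \<Sum>v\<in>?Q. ?g u v)"
    using fin by (subst sum.Sigma) auto
  also have "\<dots> = (\<Sum>u\<in>?P. scaleM (p u) (word_act \<sigma> u (\<Sum>v\<in>?Q. scaleM (q v) (word_act \<sigma> v m))))"
    using PL by (intro sum.cong refl) (simp add: word_sum word_scale word_act_append M.scale_sum_right)
  finally show ?thesis by (simp add: free_act_def)
qed

lemma ev_gen: "ev (free_gen x) m = \<sigma> x m"
  by (subst ev_eq[of "{[x]}"]) (auto simp: free_gen_def)

lemma ev_const: "ev (free_const c) m = scaleM c m"
  by (subst ev_eq[of "{[]}"]) (auto simp: free_const_def)

lemma ring_A: "ring A" and ring_E: "ring E"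
  by (rule ring_free_algebra, rule ring_endo[OF M.vector_space_axioms])

lemma ev_hom: "ev \<in> ring_hom A E"
proof (rule ring_hom_memI)
  show "ev \<one>\<^bsub>A\<^esub> = \<one>\<^bsub>E\<^esub>"
    using ev_const[of 1] by (auto simp: free_const_def endo_ring_def free_algebra_simps)
qed (auto simp: ev_linear ev_mult ev_add endo_ring_def fun_eq_iff 
     intro: ev_linear ev_mult ev_add)

sublocale ev: ring_hom_ring A E ev
  by (rule ring_hom_ringI2[OF ring_A ring_E ev_hom])

lemma rel_carrier: "uea_relations L s br \<subseteq> carrier A"
  by (rule uea_relations_carrier[OF L_closed])

lemma ideal_I: "ideal I A"
  unfolding uea_ideal_def by (rule ring.genideal_ideal[OF ring_A rel_carrier])

lemma E_minus: "S \<in> carrier E \<Longrightarrow> T \<in> carrier E \<Longrightarrow> (S \<ominus>\<^bsub>E\<^esub> T) m = S m - T m"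
proof -
  assume "S \<in> carrier E" "T \<in> carrier E"
  then have "S \<ominus>\<^bsub>E\<^esub> T \<oplus>\<^bsub>E\<^esub> T = S" by (simp add: ev.S.minus_eq ev.S.a_assoc ev.S.l_neg)
  then have "(S \<ominus>\<^bsub>E\<^esub> T \<oplus>\<^bsub>E\<^esub> T) m = S m" by simp
  then show ?thesis by (simp add: endo_ring_def eq_diff_eq)
qed

lemma ev_minus: "p \<in> carrier A \<Longrightarrow> q \<in> carrier A \<Longrightarrow> ev (p \<ominus>\<^bsub>A\<^esub> q) m = ev p m - ev q m"
proof -
  assume pq: "p \<in> carrier A" "q \<in> carrier A"
  then have "(p \<ominus>\<^bsub>A\<^esub> q) \<oplus>\<^bsub>A\<^esub> q = p" by (simp add: ev.R.minus_eq ev.R.a_assoc ev.R.l_neg)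
  moreover have "p \<ominus>\<^bsub>A\<^esub> q \<in> carrier A" using pq by (rule ev.R.minus_closed)
  ultimately show ?thesis using ev_add[of "p \<ominus>\<^bsub>A\<^esub> q" q m] pq by (simp add: eq_diff_eq)
qed

text \<open>The kernel of the evaluation is an ideal, and the three kinds of relations lie in it by
  additivity, homogeneity and the bracket rule for \<open>\<sigma>\<close>.\<close>

lemma ev_ideal: "p \<in> I \<Longrightarrow> ev p m = 0"
proof -
  note c = free_gen_in free_const_in ev.R.m_closed ev.R.a_closed ev.R.minus_closed L_closed
  have "uea_relations L s br \<subseteq> a_kernel A E ev"
  proof
    fix r assume r: "r \<in> (uea_relations L s br :: ('l list \<Rightarrow> 'a) set)"
    have "ev r m = 0" for m
    proof -
      consider x y where "r = free_gen (x + y) \<ominus>\<^bsub>A\<^esub> (free_gen x \<oplus>\<^bsub>A\<^esub> free_gen y)" "x \<in> L" "y \<in> L"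
        | d x where "r = free_gen (s d x) \<ominus>\<^bsub>A\<^esub> (free_const d \<otimes>\<^bsub>A\<^esub> free_gen x)" "x \<in> L"
        | x y where "r = (free_gen x \<otimes>\<^bsub>A\<^esub> free_gen y \<ominus>\<^bsub>A\<^esub> free_gen y \<otimes>\<^bsub>A\<^esub> free_gen x) \<ominus>\<^bsub>A\<^esub> free_gen (br x y)" "x \<in> L" "y \<in> L"
        using r unfolding uea_relations_def Let_def by blast
      then show ?thesis
      proof cases
        case 1
        then show ?thesis
          by (simp only: c ev_minus ev_add ev_gen \<sigma>_add) simp
      next
        case 2
        then show ?thesis
          by (simp only: c ev_minus ev_mult ev_gen ev_const \<sigma>_scale) simp
      next
        case 3
        then show ?thesis
          by (simp only: c ev_minus ev_mult ev_gen \<sigma>_br) simp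
      qed
    qed
    then have "ev r = \<zero>\<^bsub>E\<^esub>" by (simp add: endo_ring_def fun_eq_iff)
    moreover have "r \<in> carrier A" using r rel_carrier by (rule subsetD[rotated])
    ultimately show "r \<in> a_kernel A E ev" unfolding a_kernel_def' by simp
  qed
  then have "I \<subseteq> a_kernel A E ev"
    unfolding uea_ideal_def by (intro ev.R.genideal_minimal ev.kernel_is_ideal)
  moreover assume "p \<in> I"
  ultimately have "p \<in> a_kernel A E ev" by (rule subsetD)
  then have "ev p = \<zero>\<^bsub>E\<^esub>" unfolding a_kernel_def' by simp
  then show "ev p m = 0" by (simp add: endo_ring_def)
qed

text \<open>Evaluation of any representative of the coset; the choice is harmless since the ideal
  evaluates to zero. The restriction produces the normalisation required of representations.\<close>

definition lift where
  "lift = (\<lambda>C\<in>carrier U. ev (SOME p. p \<in> C))"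

lemma U_carrier: "carrier U = {I +>\<^bsub>A\<^esub> p | p. p \<in> carrier A}"
  by (auto simp: uea_def FactRing_def A_RCOSETS_def')

lemma coset_hom: "(+>\<^bsub>A\<^esub>) I \<in> ring_hom A U"
  unfolding uea_def by (rule ideal.rcos_ring_hom[OF ideal_I])

lemma lift_coset: 
  assumes "p \<in> carrier A" shows "lift (I +>\<^bsub>A\<^esub> p) = ev p"
proof -
  interpret I: ideal I A by (rule ideal_I)
  have "p \<in> I +>\<^bsub>A\<^esub> p" by (rule I.a_rcos_self[OF assms])
  then have q: "(SOME q. q \<in> I +>\<^bsub>A\<^esub> p) \<in> I +>\<^bsub>A\<^esub> p" by (rule someI[of "\<lambda>q. q \<in> I +>\<^bsub>A\<^esub> p"])
  define q where "q = (SOME q. q \<in> I +>\<^bsub>A\<^esub> p)"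
  have "q \<in> I +>\<^bsub>A\<^esub> p" unfolding q_def by (rule q)
  then obtain i where i: "i \<in> I" "q = i \<oplus>\<^bsub>A\<^esub> p"
    by (auto simp: a_r_coset_def')
  then have "ev q m = ev p m" for m
    using ev_add[OF I.a_Hcarr[OF i(1)] assms] ev_ideal[OF i(1)] by (simp del: free_algebra_simps)
  moreover have "I +>\<^bsub>A\<^esub> p \<in> carrier U" using assms by (auto simp: U_carrier)
  ultimately show ?thesis unfolding lift_def q_def by auto
qed

lemma lift_hom: "lift \<in> ring_hom U E"
proof (rule ring_hom_memI)
  note h = ring_hom_mult[OF coset_hom] ring_hom_add[OF coset_hom] ring_hom_one[OF coset_hom]
  fix C assume "C \<in> carrier U"
  then obtain p where p: "C = I +>\<^bsub>A\<^esub> p" "p \<in> carrier A" by (auto simp: U_carrier)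
  then show "lift C \<in> carrier E" using ring_hom_closed[OF ev_hom] by (simp add: lift_coset)
  fix D assume "D \<in> carrier U"
  then obtain q where q: "D = I +>\<^bsub>A\<^esub> q" "q \<in> carrier A" by (auto simp: U_carrier)
  show "lift (C \<otimes>\<^bsub>U\<^esub> D) = lift C \<otimes>\<^bsub>E\<^esub> lift D"
    using p q h(1)[of p q, symmetric] ring_hom_mult[OF ev_hom, of p q] by (simp add: lift_coset del: free_algebra_simps)
  show "lift (C \<oplus>\<^bsub>U\<^esub> D) = lift C \<oplus>\<^bsub>E\<^esub> lift D"
    using p q h(2)[of p q, symmetric] ring_hom_add[OF ev_hom, of p q] ev.R.a_closed[of p q] by (simp add: lift_coset del: free_algebra_simps)
next
  show "lift \<one>\<^bsub>U\<^esub> = \<one>\<^bsub>E\<^esub>"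
    using lift_coset[OF ev.R.one_closed] ring_hom_one[OF coset_hom] ring_hom_one[OF ev_hom] by simp
qed

lemma lift_gen: "x \<in> L \<Longrightarrow> lift (uea_gen L s br x) = \<sigma> x"
  unfolding uea_gen_def by (simp add: lift_coset free_gen_in) (simp add: fun_eq_iff ev_gen)

lemma lift_const: "lift (uea_const L s br c) = scaleM c"
  unfolding uea_const_def by (simp add: lift_coset free_const_in) (simp add: fun_eq_iff ev_const)

lemma lift_extensional: "lift \<in> extensional (carrier U)"
  by (simp add: lift_def)

lemma ev_invariant:
  assumes N: "M.subspace N" and inv: "\<And>x m. x \<in> L \<Longrightarrow> m \<in> N \<Longrightarrow> \<sigma> x m \<in> N" and p: "p \<in> carrier A" and m: "m \<in> N"
  shows "ev p m \<in> N"
proof -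
  have "set w \<subseteq> L \<Longrightarrow> word_act \<sigma> w m \<in> N" for w by (induction w) (auto simp: m inv)
  then show ?thesis unfolding free_act_def using p
    by (intro M.subspace_sum M.subspace_scale N) (auto simp: free_carrier)
qed

lemma ev_intertwine:
  assumes T: "Vector_Spaces.linear scaleM scaleM T" and eq: "\<And>x m. x \<in> L \<Longrightarrow> T (\<sigma> x m) = \<tau> x (T m)" and p: "p \<in> carrier A"
  shows "T (ev p m) = free_act scaleM \<tau> p (T m)"
proof -
  have T': "T (x + y) = T x + T y" "T (scaleM c x) = scaleM c (T x)" for x y c using T by (auto simp: lin)
  have T0: "T 0 = 0" using T'(2)[of 0 0] by simp
  have Ts: "T (sum f S) = (\<Sum>a\<in>S. T (f a))" for f and S :: "'l list set"
    by (induction S rule: infinite_finite_induct) (auto simp: T' T0)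
  have w: "set w \<subseteq> L \<Longrightarrow> T (word_act \<sigma> w m) = word_act \<tau> w (T m)" for w by (induction w) (auto simp: eq)
  show ?thesis unfolding free_act_def Ts T' using p
    by (intro sum.cong refl) (auto simp: w free_carrier)
qed

end

text \<open>Constants and generators span the free algebra as a ring, so a homomorphism is determined by them.\<close>

lemma hom_eq_free_act:
  fixes L :: "'l::ab_group_add set" and scaleM :: "'a::field \<Rightarrow> 'm::ab_group_add \<Rightarrow> 'm"
  assumes M: "vector_space scaleM"
    and h: "h \<in> ring_hom (free_algebra L :: ('l list \<Rightarrow> 'a) ring) (endo_ring scaleM)"
    and const: "\<And>c. h (free_const c) = scaleM c"
    and p: "p \<in> carrier (free_algebra L)"
  shows "h p = free_act scaleM (\<lambda>x. h (free_gen x)) p"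
proof -
  let ?A = "free_algebra L :: ('l list \<Rightarrow> 'a) ring" and ?E = "endo_ring scaleM"
  interpret vector_space scaleM by fact
  interpret A: ring ?A by (rule ring_free_algebra)
  define mon where "mon w = (\<lambda>v. if v = w then (1::'a) else 0)" for w :: "'l list"
  have mon_in: "mon w \<in> carrier ?A" if "set w \<subseteq> L" for w using that by (auto simp: free_carrier mon_def)
  have mon_Cons: "free_gen x \<otimes>\<^bsub>?A\<^esub> mon w = mon (x # w)" for x w
  proof (rule ext)
    fix v
    have "(\<Sum>k\<le>length v. free_gen x (take k v) * mon w (drop k v)) = (\<Sum>k\<le>length v. if k = 1 \<and> v = x # w then 1 else (0::'a))"
    proof (rule sum.cong[OF refl])
      fix k assume k: "k \<in> {..length v}"
      have "take k v = [x] \<and> drop k v = w \<longleftrightarrow> k = 1 \<and> v = x # w"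
      proof
        assume a: "take k v = [x] \<and> drop k v = w"
        then have "v = x # w" using append_take_drop_id[of k v] by simp
        moreover have "k = 1" using a k by (metis atMost_iff length_Cons length_take list.size(3) min.absorb2 One_nat_def)
        ultimately show "k = 1 \<and> v = x # w" by simp
      qed (auto simp: Suc_le_eq)
      moreover have "free_gen x (take k v) * mon w (drop k v) = (if take k v = [x] \<and> drop k v = w then 1 else (0::'a))"
        by (simp add: free_gen_def mon_def)
      ultimately show "free_gen x (take k v) * mon w (drop k v) = (if k = 1 \<and> v = x # w then 1 else (0::'a))"
        by simp
    qed
    also have "\<dots> = mon (x # w) v" by (cases "v = x # w") (auto simp: mon_def Suc_le_eq)
    finally show "(free_gen x \<otimes>\<^bsub>?A\<^esub> mon w) v = mon (x # w) v" by (simp add: free_mult)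
  qed
  have h_mon: "set w \<subseteq> L \<Longrightarrow> h (mon w) = word_act (\<lambda>x. h (free_gen x)) w" for w
  proof (induction w)
    case Nil
    have "mon [] = \<one>\<^bsub>?A\<^esub>" by (auto simp: mon_def free_algebra_simps)
    then show ?case using ring_hom_one[OF h] by (simp add: endo_ring_def)
  next
    case (Cons x w)
    then have "h (mon (x # w)) = h (free_gen x) \<otimes>\<^bsub>?E\<^esub> h (mon w)"
      unfolding mon_Cons[symmetric] by (intro ring_hom_mult[OF h] free_gen_in mon_in) auto
    then show ?case using Cons by (simp add: endo_ring_def)
  qed
  have const_mult: "free_const c \<otimes>\<^bsub>?A\<^esub> q = (\<lambda>w. c * q w)" for c q
  proof (rule ext)
    fix w
    have "(\<Sum>k\<le>length w. free_const c (take k w) * q (drop k w)) = (\<Sum>k\<in>{0}. c * q (drop k w))"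
      by (rule sum.mono_neutral_cong_right) (auto simp: free_const_def split: if_splits)
    then show "(free_const c \<otimes>\<^bsub>?A\<^esub> q) w = c * q w" by (simp add: free_mult)
  qed
  have "h p m = (\<Sum>w\<in>S. scaleM (p w) (word_act (\<lambda>x. h (free_gen x)) w m))"
    if "finite S" "{w. p w \<noteq> 0} = S" "p \<in> carrier ?A" for p S m
    using that
  proof (induction S arbitrary: p rule: finite_induct)
    case empty
    then have "p = \<zero>\<^bsub>?A\<^esub>" by (auto simp: free_algebra_simps)
    moreover have "h \<zero>\<^bsub>?A\<^esub> = \<zero>\<^bsub>?E\<^esub>"
      by (rule ring_hom_zero[OF h ring_free_algebra ring_endo[OF M]])
    ultimately show ?case by (simp add: endo_ring_def)
  next
    case (insert w S)
    define q where "q = p(w := 0)"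
    have "{w. q w \<noteq> 0} = {w. p w \<noteq> 0} - {w}" by (auto simp: q_def)
    then have q1: "{w. q w \<noteq> 0} = S" using insert(2,4) by simp
    then have q: "{w. q w \<noteq> 0} = S" "q \<in> carrier ?A"
      using insert(1,5) unfolding free_carrier by (auto simp: q_def)
    have w: "set w \<subseteq> L" using insert by (auto simp: free_carrier)
    have "p = (free_const (p w) \<otimes>\<^bsub>?A\<^esub> mon w) \<oplus>\<^bsub>?A\<^esub> q"
      unfolding const_mult by (auto simp: q_def mon_def free_algebra_simps)
    then have "h p = (h (free_const (p w)) \<otimes>\<^bsub>?E\<^esub> h (mon w)) \<oplus>\<^bsub>?E\<^esub> h q"
      using ring_hom_add[OF h A.m_closed[OF free_const_in mon_in[OF w]] q(2), of "p w"]
        ring_hom_mult[OF h free_const_in mon_in[OF w], of "p w"] by (metis (no_types, lifting))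
    then have "h p m = scaleM (p w) (word_act (\<lambda>x. h (free_gen x)) w m) + h q m"
      by (simp add: const h_mon[OF w] endo_ring_def)
    also have "h q m = (\<Sum>w\<in>S. scaleM (q w) (word_act (\<lambda>x. h (free_gen x)) w m))"
      by (rule insert.IH[OF q])
    also have "\<dots> = (\<Sum>w\<in>S. scaleM (p w) (word_act (\<lambda>x. h (free_gen x)) w m))"
      using insert(2) by (intro sum.cong refl) (auto simp: q_def)
    finally show ?case using insert by simp
  qed
  then show ?thesis using p unfolding free_act_def by (auto simp: free_carrier)
qed

text \<open>Gives access to the facts on the enveloping algebra that hold for every representation,
  at a point where none has been constructed yet.\<close>

lemma lie_rep_zero:
  assumes "vector_space scaleM" "\<And>x y. x \<in> L \<Longrightarrow> y \<in> L \<Longrightarrow> x + y \<in> L" "\<And>c x. x \<in> L \<Longrightarrow> s c x \<in> L"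
      "\<And>x y. x \<in> L \<Longrightarrow> y \<in> L \<Longrightarrow> br x y \<in> L"
  shows "lie_rep scaleM L s br (\<lambda>_ _. 0)"
proof -
  interpret vector_space scaleM by fact
  show ?thesis
    by unfold_locales (use assms in \<open>auto simp: linear_iff'\<close>)
qed

text \<open>Composed with the quotient map, the homomorphism is determined on the free algebra by
  constants and generators. It kills the defining relations, and each kind of relation yields one of
  the rules for \<open>\<sigma>\<close>.\<close>

lemma lie_rep_of_hom:
  fixes scaleM :: "'a::field \<Rightarrow> 'm::ab_group_add \<Rightarrow> 'm" and L :: "'l::ab_group_add set"
  assumes M: "vector_space scaleM" and L: "\<And>x y. x \<in> L \<Longrightarrow> y \<in> L \<Longrightarrow> x + y \<in> L" "\<And>c x. x \<in> L \<Longrightarrow> s c x \<in> L"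
      "\<And>x y. x \<in> L \<Longrightarrow> y \<in> L \<Longrightarrow> br x y \<in> L"
    and h: "h \<in> ring_hom (uea L s br) (endo_ring scaleM)" and const: "\<And>c. h (uea_const L s br c) = scaleM c"
  defines "\<sigma> \<equiv> \<lambda>x. h (uea_gen L s br x)"
  shows "lie_rep scaleM L s br \<sigma> \<and>
    (\<forall>p\<in>carrier (free_algebra L). h (uea_ideal L s br +>\<^bsub>free_algebra L\<^esub> p) = free_act scaleM \<sigma> p)"
proof -
  interpret Z: lie_rep scaleM L s br "\<lambda>_ _. 0" by (rule lie_rep_zero) fact+
  define k where "k = h \<circ> (+>\<^bsub>Z.A\<^esub>) Z.I"
  have k: "k \<in> ring_hom Z.A Z.E" unfolding k_def by (rule ring_hom_trans[OF Z.coset_hom h])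
  have kg: "k (free_gen x) = \<sigma> x" for x by (simp add: k_def \<sigma>_def uea_gen_def)
  have kc: "k (free_const c) = scaleM c" for c using const[of c] by (simp add: k_def uea_const_def)
  have k_eq: "k p = free_act scaleM \<sigma> p" if "p \<in> carrier Z.A" for p
    using hom_eq_free_act[OF M k kc that] unfolding kg .
  then have free: "\<forall>p\<in>carrier (free_algebra L). h (uea_ideal L s br +>\<^bsub>free_algebra L\<^esub> p) = free_act scaleM \<sigma> p"
    by (simp add: k_def)
  interpret k: ring_hom_ring Z.A Z.E k by (rule ring_hom_ringI2[OF Z.ring_A Z.ring_E k])
  interpret U: ring Z.U by (rule ring_uea) (fact L)+
  \<comment> \<open>A relation belongs to the ideal, so its coset is the zero of the
    quotient.\<close>
  have kI: "k r = \<zero>\<^bsub>Z.E\<^esub>" if "r \<in> uea_relations L s br" for r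
  proof -
    interpret I: ideal Z.I Z.A by (rule Z.ideal_I)
    have "r \<in> Z.I" unfolding uea_ideal_def using that Z.ev.R.genideal_self[OF Z.rel_carrier] by blast
    then have "Z.I +>\<^bsub>Z.A\<^esub> r = Z.I" by (rule I.a_rcos_const)
    also have "\<dots> = \<zero>\<^bsub>Z.U\<^esub>" by (simp add: uea_def FactRing_def)
    finally show ?thesis
      unfolding k_def using ring_hom_zero[OF h U.ring_axioms Z.ring_E] by simp
  qed
  have k_minus: "k (p \<ominus>\<^bsub>Z.A\<^esub> q) m = k p m - k q m" if "p \<in> carrier Z.A" "q \<in> carrier Z.A" for p q m
  proof -
    have "k (p \<ominus>\<^bsub>Z.A\<^esub> q) = k p \<ominus>\<^bsub>Z.E\<^esub> k q"
      using that by (simp add: a_minus_def)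
    then show ?thesis using Z.E_minus[of "k p" "k q" m] that by simp
  qed
  have k_add: "k (p \<oplus>\<^bsub>Z.A\<^esub> q) m = k p m + k q m" if "p \<in> carrier Z.A" "q \<in> carrier Z.A" for p q m
    using ring_hom_add[OF k that] by (simp add: endo_ring_def)
  have k_mult: "k (p \<otimes>\<^bsub>Z.A\<^esub> q) m = k p (k q m)" if "p \<in> carrier Z.A" "q \<in> carrier Z.A" for p q m
    using ring_hom_mult[OF k that] by (simp add: endo_ring_def)
  have zE: "\<zero>\<^bsub>Z.E\<^esub> m = 0" for m by (simp add: endo_ring_def)
  note c = free_gen_in free_const_in Z.ev.R.m_closed Z.ev.R.a_closed Z.ev.R.minus_closed L
  have "lie_rep scaleM L s br \<sigma>"
  proof (intro lie_rep.intro M lie_rep_axioms.intro)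
    fix x assume x: "x \<in> L"
    have "k (free_gen x) \<in> carrier Z.E" using k.hom_closed free_gen_in[OF x] by blast
    then show "Vector_Spaces.linear scaleM scaleM (\<sigma> x)" unfolding kg by (simp add: endo_ring_def)
    fix m
    show "\<sigma> (s d x) m = scaleM d (\<sigma> x m)" for d
    proof -
      have "free_gen (s d x) \<ominus>\<^bsub>Z.A\<^esub> (free_const d \<otimes>\<^bsub>Z.A\<^esub> free_gen x) \<in> (uea_relations L s br :: ('l list \<Rightarrow> 'a) set)"
        unfolding uea_relations_def Let_def using x by blast
      from kI[OF this] have "k (free_gen (s d x) \<ominus>\<^bsub>Z.A\<^esub> (free_const d \<otimes>\<^bsub>Z.A\<^esub> free_gen x)) m = 0" by (simp only: zE)
      then show ?thesis using x by (simp only: k_minus k_mult c kg kc) simp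
    qed
    fix y assume y: "y \<in> L"
    show "\<sigma> (x + y) m = \<sigma> x m + \<sigma> y m"
    proof -
      have "free_gen (x + y) \<ominus>\<^bsub>Z.A\<^esub> (free_gen x \<oplus>\<^bsub>Z.A\<^esub> free_gen y) \<in> (uea_relations L s br :: ('l list \<Rightarrow> 'a) set)"
        unfolding uea_relations_def Let_def using x y by blast
      from kI[OF this] have "k (free_gen (x + y) \<ominus>\<^bsub>Z.A\<^esub> (free_gen x \<oplus>\<^bsub>Z.A\<^esub> free_gen y)) m = 0" by (simp only: zE)
      then show ?thesis using x y by (simp only: k_minus k_add c kg kc) simp
    qed
    show "\<sigma> (br x y) m = \<sigma> x (\<sigma> y m) - \<sigma> y (\<sigma> x m)"
    proof -
      have "(free_gen x \<otimes>\<^bsub>Z.A\<^esub> free_gen y \<ominus>\<^bsub>Z.A\<^esub> free_gen y \<otimes>\<^bsub>Z.A\<^esub> free_gen x) \<ominus>\<^bsub>Z.A\<^esub> free_gen (br x y) \<in> (uea_relations L s br :: ('l list \<Rightarrow> 'a) set)"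
        unfolding uea_relations_def Let_def using x y by blast
      from kI[OF this] have "k ((free_gen x \<otimes>\<^bsub>Z.A\<^esub> free_gen y \<ominus>\<^bsub>Z.A\<^esub> free_gen y \<otimes>\<^bsub>Z.A\<^esub> free_gen x) \<ominus>\<^bsub>Z.A\<^esub> free_gen (br x y)) m = 0" by (simp only: zE)
      then show ?thesis using x y by (simp only: k_minus k_mult c kg kc) simp
    qed
  qed (fact L)+
  with free show ?thesis by blast
qed

section \<open>Inner derivations of the power series\<close>

lemma S_LieI:
  assumes "\<And>i. i < n \<Longrightarrow> f i \<in> mfps_in n" "vdiv n f = 0"
  shows "(\<lambda>g. if g \<in> mfps_in n then vf n f g else 0) \<in> S_Lie n"
  unfolding S_Lie_def vf_def using assms unfolding vdiv_def by blast

lemma S_LieE: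
  assumes "X \<in> S_Lie n"
  obtains f where "\<And>i. i < n \<Longrightarrow> f i \<in> mfps_in n" "vdiv n f = 0" "X = (\<lambda>g. if g \<in> mfps_in n then vf n f g else 0)"
  using assms unfolding S_Lie_def vf_def vdiv_def by blast

lemma S_Lie_add: "X \<in> S_Lie n \<Longrightarrow> Y \<in> S_Lie n \<Longrightarrow> X + Y \<in> S_Lie n"
proof -
  assume X: "X \<in> S_Lie n" and Y: "Y \<in> S_Lie n"
  obtain f where f: "\<And>i. i < n \<Longrightarrow> f i \<in> mfps_in n" "vdiv n f = 0" "X = (\<lambda>g. if g \<in> mfps_in n then vf n f g else 0)"
    using X by (rule S_LieE) blast
  obtain h where h: "\<And>i. i < n \<Longrightarrow> h i \<in> mfps_in n" "vdiv n h = 0" "Y = (\<lambda>g. if g \<in> mfps_in n then vf n h g else 0)"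
    using Y by (rule S_LieE) blast
  have "X + Y = (\<lambda>g. if g \<in> mfps_in n then vf n (\<lambda>i. f i + h i) g else 0)"
    unfolding f(3) h(3) by (auto simp: fun_eq_iff vf_def distrib_right sum.distrib)
  also have "\<dots> \<in> S_Lie n" using f(1,2) h(1,2) by (intro S_LieI) (auto simp: vdiv_def sum.distrib)
  finally show ?thesis .
qed

lemma S_Lie_scale: "X \<in> S_Lie n \<Longrightarrow> S_scale c X \<in> S_Lie n"
proof -
  assume X: "X \<in> S_Lie n"
  obtain f where f: "\<And>i. i < n \<Longrightarrow> f i \<in> mfps_in n" "vdiv n f = 0" "X = (\<lambda>g. if g \<in> mfps_in n then vf n f g else 0)"
    using X by (rule S_LieE) blast
  have z: "mfps_scale c 0 = 0" by (rule mfps_eqI) simp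
  have "S_scale c X = (\<lambda>g. if g \<in> mfps_in n then vf n (\<lambda>i. mfps_scale c (f i)) g else 0)"
    unfolding f(3) S_scale_def by (auto simp: fun_eq_iff vf_def sum_scale mfps_scale_mult z)
  also have "\<dots> \<in> S_Lie n" using f(1,2) by (intro S_LieI) (auto simp: vdiv_def z sum_scale[symmetric])
  finally show ?thesis .
qed

lemma S_Lie_zero: "0 \<in> S_Lie n"
proof -
  have "(\<lambda>g. if g \<in> mfps_in n then vf n (\<lambda>_. 0) g else 0) \<in> S_Lie n" by (intro S_LieI) (auto simp: vdiv_def)
  then show ?thesis by (simp add: vf_def zero_fun_def if_distrib cong: if_cong)
qed

lemma S_Lie_sum_list: "(\<And>a. a \<in> set A \<Longrightarrow> F a \<in> S_Lie n) \<Longrightarrow> sum_list (map F A) \<in> S_Lie n"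
  by (induction A) (auto intro: S_Lie_add S_Lie_zero)

lemma S_Lie_closed: "X \<in> S_Lie n \<Longrightarrow> g \<in> mfps_in n \<Longrightarrow> X g \<in> mfps_in n"
  by (elim S_LieE) (auto simp: vf_def intro!: mfps_in_sum)

lemma S_Lie_outside: "X \<in> S_Lie n \<Longrightarrow> g \<notin> mfps_in n \<Longrightarrow> X g = 0"
  by (elim S_LieE) auto

lemma S_Lie_zero_arg: "X \<in> S_Lie n \<Longrightarrow> X 0 = 0"
  by (elim S_LieE) (auto simp: vf_def)

lemma snoc_tuples: "as \<in> tuples (n - 1) V \<Longrightarrow> g \<in> V \<Longrightarrow> n \<ge> 1 \<Longrightarrow> as @ [g] \<in> tuples n V"
  by (auto simp: tuples_def)

lemma ad_S_Lie:
  fixes as :: "'a::field_char_0 mfps list"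
  assumes "as \<in> tuples (n - 1) (mfps_in n)" "n \<ge> 1"
  shows "ad n as \<in> S_Lie n"
proof -
  have l: "length as = n - 1" using assms by (simp add: tuples_def)
  have "ad n as = (\<lambda>g. if g \<in> mfps_in n then vf n (jfield n as) g else 0)"
    unfolding ad_def jac_snoc[OF l assms(2)] ..
  also have "\<dots> \<in> S_Lie n"
  proof (rule S_LieI)
    show "vdiv n (jfield n as) = 0" by (rule vdiv_jfield[OF l assms(2)])
    show "jfield n as i \<in> mfps_in n" if "i < n" for i
      unfolding jfield_def using assms that by (intro jac_in_tuples snoc_tuples) auto
  qed
  finally show ?thesis .
qed

text \<open>The decomposition of divergence-free fields, with the entries truncated to
  \<open>n\<close> variables; this does not change the field on \<open>mfps_in n\<close>, because
  truncation commutes with the Jacobian bracket.\<close>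

lemma S_Lie_span:
  fixes X :: "'a::field_char_0 mfps \<Rightarrow> 'a mfps"
  assumes n: "n \<ge> 3" and X: "X \<in> S_Lie n"
  obtains A where "\<And>a. a \<in> set A \<Longrightarrow> a \<in> tuples (n - 1) (mfps_in n)" "X = sum_list (map (ad n) A)"
proof -
  obtain f where f: "\<And>i. i < n \<Longrightarrow> f i \<in> mfps_in n" "vdiv n f = 0" "X = (\<lambda>g. if g \<in> mfps_in n then vf n f g else 0)"
    using X by (rule S_LieE) blast
  obtain gs :: "('a mfps \<times> nat list) list" where gs: "\<forall>(g, I)\<in>set gs. distinct I \<and> length I = n - 2 \<and> set I \<subseteq> {..<n} \<and>
        ((\<forall>r<n. pderiv_at 1 (f r) = 0) \<longrightarrow> pderiv_at 1 g = 0)"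
    "\<forall>h. vf n f h = (\<Sum>(g, I)\<leftarrow>gs. jacobian_bracket n (g # map fvar I @ [h]))"
    using field_decomposition[OF n f(2)] by (elim exE conjE) rule
  define A where "A = map (\<lambda>x. map (trunc n) (fst x # map fvar (snd x))) gs"
  have lx: "length (fst x # map fvar (snd x) :: 'a mfps list) = n - 1" if "x \<in> set gs" for x
    using gs(1) that n by auto
  have A: "a \<in> tuples (n - 1) (mfps_in n)" if a: "a \<in> set A" for a
  proof -
    obtain x where "x \<in> set gs" "a = map (trunc n) (fst x # map fvar (snd x))"
      using a unfolding A_def set_map by blast
    then show ?thesis using tuples_map_trunc[OF lx] by simp
  qed
  have "X g = sum_list (map (ad n) A) g" for g
  proof (cases "g \<in> mfps_in n")
    case True
    have XJ: "X g = sum_list (map (\<lambda>x. jacobian_bracket n ((fst x # map fvar (snd x)) @ [g])) gs)"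
      using gs(2) True unfolding f(3) by (simp add: case_prod_unfold)
    have "X g = trunc n (X g)" using S_Lie_closed[OF X True] by (simp add: trunc_ident)
    also have "\<dots> = sum_list (map (\<lambda>x. trunc n (jacobian_bracket n ((fst x # map fvar (snd x)) @ [g]))) gs)"
      unfolding XJ by (induction gs) auto
    also have "\<dots> = sum_list (map (\<lambda>x. ad n (map (trunc n) (fst x # map fvar (snd x))) g) gs)"
    proof (intro arg_cong[of _ _ sum_list] map_cong refl)
      fix x assume "x \<in> set gs"
      then have "length ((fst x # map fvar (snd x)) @ [g]) = n" using lx[of x] n by simp
      then show "trunc n (jacobian_bracket n ((fst x # map fvar (snd x)) @ [g])) = ad n (map (trunc n) (fst x # map fvar (snd x))) g"
        unfolding ad_def using True by (subst trunc_jac) (auto simp: trunc_ident)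
    qed
    also have "\<dots> = sum_list (map (ad n) A) g"
      unfolding sum_list_apply A_def by (simp add: o_def)
    finally show ?thesis .
  next
    case False
    then show ?thesis unfolding sum_list_apply using S_Lie_outside[OF X False] by (simp add: ad_def)
  qed
  then show ?thesis using A by (intro that[of A]) auto
qed

text \<open>A divergence-free field is a derivation of the Jacobian bracket; the term in which it
  hits the last entry is the one subtracted in the commutator.\<close>

lemma commutator_ad:
  fixes X :: "'a::field_char_0 mfps \<Rightarrow> 'a mfps"
  assumes X: "X \<in> S_Lie n" and b: "b \<in> tuples (n - 1) (mfps_in n)" and n: "n \<ge> 1"
  shows "commutator X (ad n b) = (\<Sum>i<n - 1. ad n (b[i := X (b ! i)]))"
proof
  fix g
  obtain f where f: "\<And>i. i < n \<Longrightarrow> f i \<in> mfps_in n" "vdiv n f = 0" "X = (\<lambda>g. if g \<in> mfps_in n then vf n f g else 0)"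
    using X by (rule S_LieE) blast
  have Xg: "X g = vf n f g" if "g \<in> mfps_in n" for g using that unfolding f(3) by simp
  have sumap: "(\<Sum>i<k. F i) g = (\<Sum>i<k. F i g)" for k and F :: "nat \<Rightarrow> 'a mfps \<Rightarrow> 'a mfps"
    by (induction k) auto
  have l: "length b = n - 1" using b by (simp add: tuples_def)
  show "commutator X (ad n b) g = (\<Sum>i<n - 1. ad n (b[i := X (b ! i)])) g"
  proof (cases "g \<in> mfps_in n")
    case True
    have t: "b @ [g] \<in> tuples n (mfps_in n)" by (rule snoc_tuples[OF b True n])
    have n1: "n = Suc (n - 1)" using n by simp
    have "X (ad n b g) = vf n f (jacobian_bracket n (b @ [g]))"
      using True by (simp add: ad_def Xg jac_in_tuples[OF t])
    also have "\<dots> = (\<Sum>i<n. jacobian_bracket n ((b @ [g])[i := vf n f ((b @ [g]) ! i)]))"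
      using l n by (intro vf_jac f) auto
    also have "\<dots> = (\<Sum>i<Suc (n - 1). jacobian_bracket n ((b @ [g])[i := vf n f ((b @ [g]) ! i)]))" using n1 by simp
    also have "\<dots> = (\<Sum>i<n - 1. jacobian_bracket n ((b @ [g])[i := vf n f ((b @ [g]) ! i)])) + jacobian_bracket n (b @ [vf n f g])"
      unfolding sum.lessThan_Suc using l by (simp add: nth_append list_update_length[of b, unfolded l One_nat_def])
    also have "(\<Sum>i<n - 1. jacobian_bracket n ((b @ [g])[i := vf n f ((b @ [g]) ! i)])) = (\<Sum>i<n - 1. ad n (b[i := X (b ! i)]) g)"
      using l True b by (intro sum.cong refl) (auto simp: ad_def nth_append list_update_append Xg tuples_nth)
    also have "jacobian_bracket n (b @ [vf n f g]) = ad n b (X g)"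
      using S_Lie_closed[OF X True] by (simp add: ad_def Xg[OF True])
    finally show ?thesis unfolding sumap commutator_def by simp
  next
    case False
    have "jacobian_bracket n (b @ [0]) = 0"
      using jac.F_zero[of "b @ [0]" n "n - 1"] l n list_update_length[of b 0 "[]" "0 :: 'a mfps"] by (simp add: tuples_def)
    then show ?thesis unfolding sumap commutator_def using False S_Lie_outside[OF X False] S_Lie_zero_arg[OF X]
      by (simp add: ad_def)
  qed
qed

lemma commutator_sum_list_right:
  assumes "X \<in> S_Lie n" and F: "\<And>a. a \<in> set A \<Longrightarrow> F a \<in> S_Lie n"
  shows "commutator X (sum_list (map F A)) = sum_list (map (\<lambda>a. commutator X (F a)) A)"
  using F
proof (induction A)
  case (Cons a A)
  have "commutator X (Y + Z) = commutator X Y + commutator X Z" if YZ: "Y \<in> S_Lie n" "Z \<in> S_Lie n" for Y Z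
  proof
    fix g
    have add: "X (u + v) = X u + X v" if "u \<in> mfps_in n" "v \<in> mfps_in n" for u v
      using assms(1) that by (elim S_LieE) (auto simp: vf_add)
    show "commutator X (Y + Z) g = (commutator X Y + commutator X Z) g"
    proof (cases "g \<in> mfps_in n")
      case True
      then show ?thesis using S_Lie_closed[OF YZ(1)] S_Lie_closed[OF YZ(2)] by (simp add: commutator_def add)
    next
      case False
      then show ?thesis using S_Lie_outside[OF assms(1)] S_Lie_outside[OF YZ(1)] S_Lie_outside[OF YZ(2)]
        S_Lie_zero_arg[OF assms(1)] S_Lie_zero_arg[OF YZ(1)] S_Lie_zero_arg[OF YZ(2)] by (simp add: commutator_def)
    qed
  qed
  note add = this
  have "commutator X (sum_list (map F (a # A))) = commutator X (F a + sum_list (map F A))"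
    by (simp only: list.map sum_list.Cons)
  also have "\<dots> = commutator X (F a) + commutator X (sum_list (map F A))"
    using Cons.prems by (intro add S_Lie_sum_list) auto
  also have "commutator X (sum_list (map F A)) = sum_list (map (\<lambda>a. commutator X (F a)) A)"
    using Cons.prems by (intro Cons.IH) auto
  finally show ?case by (simp only: list.map sum_list.Cons)
qed (auto simp: commutator_def fun_eq_iff S_Lie_zero_arg[OF assms(1)])

lemma S_Lie_sum: "(\<And>i. i \<in> A \<Longrightarrow> F i \<in> S_Lie n) \<Longrightarrow> sum F A \<in> S_Lie n"
  by (induction A rule: infinite_finite_induct) (auto intro: S_Lie_add S_Lie_zero)

text \<open>It suffices to take an inner derivation for \<open>Y\<close>, and then the commutator is
  a sum of inner derivations.\<close>

lemma S_Lie_commutator: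
  fixes X :: "'a::field_char_0 mfps \<Rightarrow> 'a mfps"
  assumes n: "n \<ge> 3" and X: "X \<in> S_Lie n" and Y: "Y \<in> S_Lie n"
  shows "commutator X Y \<in> S_Lie n"
proof -
  obtain A where A: "\<And>a. a \<in> set A \<Longrightarrow> a \<in> tuples (n - 1) (mfps_in n)" "Y = sum_list (map (ad n) A)"
    using S_Lie_span[OF n Y] by blast
  have "commutator X Y = sum_list (map (\<lambda>a. commutator X (ad n a)) A)"
    unfolding A(2) using A(1) n by (intro commutator_sum_list_right[OF X] ad_S_Lie) auto
  also have "\<dots> \<in> S_Lie n"
  proof (rule S_Lie_sum_list)
    fix a assume "a \<in> set A"
    then have a: "a \<in> tuples (n - 1) (mfps_in n)" by (rule A(1))
    have n1: "n \<ge> 1" using n by simp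
    show "commutator X (ad n a) \<in> S_Lie n"
      unfolding commutator_ad[OF X a n1]
      by (intro S_Lie_sum ad_S_Lie tuples_update a n1 S_Lie_closed[OF X]) (auto intro: tuples_nth[OF a])
  qed
  finally show ?thesis .
qed

lemma ad_update_add: 
  assumes "fs \<in> tuples (n - 1) (mfps_in n)" "i < n - 1"
  shows "ad n (fs[i := u + v]) = ad n (fs[i := u]) + ad n (fs[i := v])"
proof
  fix g
  have l: "length (fs @ [g]) = n" "length fs = n - 1" using assms by (auto simp: tuples_def)
  have "jacobian_bracket n (fs[i := u + v] @ [g]) = jacobian_bracket n (fs[i := u] @ [g]) + jacobian_bracket n (fs[i := v] @ [g])"
    using jac_add[OF _ l(1), of i u v] assms(2) l by (simp add: list_update_append)
  then show "ad n (fs[i := u + v]) g = (ad n (fs[i := u]) + ad n (fs[i := v])) g" by (simp add: ad_def)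
qed

lemma ad_update_scale: 
  assumes "fs \<in> tuples (n - 1) (mfps_in n)" "i < n - 1"
  shows "ad n (fs[i := mfps_scale c u]) = S_scale c (ad n (fs[i := u]))"
proof
  fix g
  have z: "mfps_scale c 0 = (0 :: 'a mfps)" by (rule mfps_eqI) simp
  have l: "length (fs @ [g]) = n" "length fs = n - 1" using assms by (auto simp: tuples_def)
  have "jacobian_bracket n (fs[i := mfps_scale c u] @ [g]) = mfps_scale c (jacobian_bracket n (fs[i := u] @ [g]))"
    using jac_scale[OF _ l(1), of i c u] assms(2) l by (simp add: list_update_append)
  then show "ad n (fs[i := mfps_scale c u]) g = (S_scale c (ad n (fs[i := u]))) g" by (simp add: ad_def S_scale_def z)
qed

lemma ad_alt:
  assumes "fs \<in> tuples (n - 1) (mfps_in n)" "i < j" "j < n - 1" "fs ! i = fs ! j"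
  shows "ad n fs = 0"
proof
  fix g
  have l: "length (fs @ [g]) = n" "length fs = n - 1" using assms by (auto simp: tuples_def)
  have "jacobian_bracket n (fs @ [g]) = 0"
    using assms l by (intro jac_alt[of i n j]) (auto simp: nth_append)
  then show "ad n fs g = 0 g" by (simp add: ad_def)
qed

lemma ad_one:
  assumes "fs \<in> tuples (n - 1) (mfps_in n)" "1 \<in> set fs"
  shows "ad n fs = 0"
proof
  fix g
  obtain i where i: "i < length fs" "fs ! i = 1" using assms(2) by (auto simp: in_set_conv_nth)
  then have l: "length (fs @ [g]) = n" "length fs = n - 1" using assms by (auto simp: tuples_def)
  have "(fs @ [g])[i := 1] = fs @ [g]" using i by (metis list_update_append1 list_update_id)
  then have "jacobian_bracket n (fs @ [g]) = 0"
    using jac_one[OF _ l(1), of i] i l by simp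
  then show "ad n fs g = 0 g" by (simp add: ad_def)
qed

section \<open>From an action of tuples to a module\<close>

text \<open>The induction is on the number \<open>j\<close> of leading slots that may hold arbitrary
  elements; the last of these is split into two elements of \<open>H\<close>.\<close>

lemma additive_vanish:
  fixes F :: "'w::ab_group_add list \<Rightarrow> 'r::ab_group_add"
  assumes add: "\<And>xs i u v. xs \<in> tuples k W \<Longrightarrow> i < k \<Longrightarrow> u \<in> W \<Longrightarrow> v \<in> W \<Longrightarrow> F (xs[i := u + v]) = F (xs[i := u]) + F (xs[i := v])"
    and gen: "\<And>w. w \<in> W \<Longrightarrow> \<exists>u\<in>H. \<exists>v\<in>H. w = u + v" and H: "H \<subseteq> W"
    and van: "\<And>xs. xs \<in> tuples k H \<Longrightarrow> F xs = 0"
    and xs: "xs \<in> tuples k W"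
  shows "F xs = 0"
proof -
  have "F xs = 0" if "j \<le> k" "xs \<in> tuples k W" "\<And>i. j \<le> i \<Longrightarrow> i < k \<Longrightarrow> xs ! i \<in> H" for j xs
    using that
  proof (induction j arbitrary: xs)
    case 0
    then have "xs \<in> tuples k H" by (auto simp: tuples_def in_set_conv_nth)
    then show ?case by (rule van)
  next
    case (Suc j)
    have l: "length xs = k" using Suc by (simp add: tuples_def)
    obtain u v where uv: "u \<in> H" "v \<in> H" "xs ! j = u + v"
      using gen[OF tuples_nth[OF Suc.prems(2), of j]] Suc.prems(1) by auto
    have "F (xs[j := w]) = 0" if "w \<in> H" for w
      using Suc.prems that H l by (intro Suc.IH tuples_update) (auto simp: nth_list_update)
    moreover have "xs = xs[j := u + v]" using uv(3) by (metis list_update_id)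
    ultimately show ?case
      using add[OF Suc.prems(2), of j u v] Suc.prems(1) uv H by auto
  qed
  from this[of k xs] xs show ?thesis by simp
qed

lemma omit_update_other:
  "i \<noteq> k \<Longrightarrow> i < length f \<Longrightarrow> k < length f \<Longrightarrow> omit i (f[k := u]) = (omit i f)[(if k < i then k else k - 1) := u]"
  by (cases "k < i") (auto simp: omit_update_less omit_update_greater)

lemma omit_snoc: "p < length f \<Longrightarrow> omit p (f @ [x]) = omit p f @ [x]"
  by (simp add: omit_def)

lemma omit_last: "omit (length f) (f @ [x]) = f"
  by (simp add: omit_def)

text \<open>What a family of operators has to satisfy in order to come from a module: the Lie
  identity and the quadratic identity are the two nontrivial cases of the fundamental identity with
  exactly one module entry.\<close>

locale n_Lie_action = V: n_Lie_algebra scaleV n V br + M: vector_space scaleM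
  for scaleV :: "'a::field \<Rightarrow> 'v::ab_group_add \<Rightarrow> 'v" and n :: nat and V :: "'v set"
    and br :: "'v list \<Rightarrow> 'v" and scaleM :: "'a \<Rightarrow> 'm::ab_group_add \<Rightarrow> 'm" +
  fixes \<rho> :: "'v list \<Rightarrow> 'm \<Rightarrow> 'm"
  assumes n2: "n \<ge> 2"
    and rho_right: "vs \<in> tuples (n - 1) V \<Longrightarrow> \<rho> vs (m + m') = \<rho> vs m + \<rho> vs m'"
      "vs \<in> tuples (n - 1) V \<Longrightarrow> \<rho> vs (scaleM c m) = scaleM c (\<rho> vs m)"
    and rho_add: "\<lbrakk>vs \<in> tuples (n - 1) V; i < n - 1; u \<in> V; v \<in> V\<rbrakk> \<Longrightarrow> \<rho> (vs[i := u + v]) m = \<rho> (vs[i := u]) m + \<rho> (vs[i := v]) m"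
    and rho_scale: "\<lbrakk>vs \<in> tuples (n - 1) V; i < n - 1; v \<in> V\<rbrakk> \<Longrightarrow> \<rho> (vs[i := scaleV c v]) m = scaleM c (\<rho> (vs[i := v]) m)"
    and rho_alt: "\<lbrakk>vs \<in> tuples (n - 1) V; i < j; j < n - 1; vs ! i = vs ! j\<rbrakk> \<Longrightarrow> \<rho> vs m = 0"
    and rho_lie: "\<lbrakk>as \<in> tuples (n - 1) V; bs \<in> tuples (n - 1) V\<rbrakk> \<Longrightarrow>
      \<rho> as (\<rho> bs m) = (\<Sum>i<n - 1. \<rho> (bs[i := br (as @ [bs ! i])]) m) + \<rho> bs (\<rho> as m)"
    and rho_quad: "\<lbrakk>ts \<in> tuples (n - 2) V; hs \<in> tuples n V\<rbrakk> \<Longrightarrow>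
      \<rho> (ts @ [br hs]) m = (\<Sum>i<n. signed (n - 1 - i) (\<rho> (omit i hs) (\<rho> (ts @ [hs ! i]) m)))"
begin

lemma n1: "n \<ge> 1" "0 < n" "n = Suc (n - 1)" using n2 by auto

lemma V0: "0 \<in> V" and V_add: "u \<in> V \<Longrightarrow> v \<in> V \<Longrightarrow> u + v \<in> V" and V_scale: "u \<in> V \<Longrightarrow> scaleV c u \<in> V"
  using V.subspace_0[OF V.subspace_V] V.subspace_add[OF V.subspace_V] V.subspace_scale[OF V.subspace_V] by auto

sublocale \<rho>: alt_map "n - 1" V "\<lambda>vs. \<rho> vs m" for m
  by unfold_locales (auto intro: V_add rho_add rho_alt)

sublocale br: alt_map n V br
  by unfold_locales (auto intro: V_add V.br_add V.br_alternating)

abbreviation "W \<equiv> V \<times> (UNIV :: 'm set)"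

text \<open>The module component of the bracket: in each summand one entry contributes its module
  part, and the sign is the cost of moving this entry to the end.\<close>

definition P where "P xs = (\<Sum>i<n. signed (n - 1 - i) (\<rho> (omit i (map fst xs)) (snd (xs ! i))))"

definition B where "B = (\<lambda>xs\<in>tuples n W. (br (map fst xs), P xs))"

lemma B_eq: "xs \<in> tuples n W \<Longrightarrow> B xs = (br (map fst xs), P xs)"
  by (simp add: B_def)

lemma fst_tuples: "xs \<in> tuples k W \<Longrightarrow> map fst xs \<in> tuples k V"
  by (auto simp: tuples_def)

lemma omit_fst: "xs \<in> tuples n W \<Longrightarrow> i < n \<Longrightarrow> omit i (map fst xs) \<in> tuples (n - 1) V"
  by (intro omit_in_tuples fst_tuples)

lemma rho_right0: "vs \<in> tuples (n - 1) V \<Longrightarrow> \<rho> vs 0 = 0"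
  using rho_right(1)[of vs 0 0] by simp

lemma rho_right_minus: "vs \<in> tuples (n - 1) V \<Longrightarrow> \<rho> vs (- m) = - \<rho> vs m"
  using rho_right(1)[of vs m "- m"] rho_right0[of vs] by (simp add: eq_neg_iff_add_eq_0 add.commute)

lemma rho_signed: "vs \<in> tuples (n - 1) V \<Longrightarrow> \<rho> vs (signed k m) = signed k (\<rho> vs m)"
  by (simp add: signed_def rho_right_minus)

lemma rho_zero_entry: "vs \<in> tuples (n - 1) V \<Longrightarrow> i < n - 1 \<Longrightarrow> vs ! i = 0 \<Longrightarrow> \<rho> vs m = 0"
  using \<rho>.F_zero[of vs i m] V0 by (metis list_update_id)

lemma br_zero_entry: "vs \<in> tuples n V \<Longrightarrow> i < n \<Longrightarrow> vs ! i = 0 \<Longrightarrow> br vs = 0"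
  using br.F_zero[of vs i] V0 by (metis list_update_id)

lemma term_update:
  assumes xs: "xs \<in> tuples n W" and i: "i < n" and k: "k < n"
  shows "\<rho> (omit i (map fst (xs[k := w]))) (snd (xs[k := w] ! i)) =
    (if i = k then \<rho> (omit i (map fst xs)) (snd w)
     else \<rho> ((omit i (map fst xs))[(if k < i then k else k - 1) := fst w]) (snd (xs ! i)))"
  using i k tuples_length[OF xs] by (auto simp: map_update omit_update_same omit_update_other)

lemma P_add:
  assumes xs: "xs \<in> tuples n W" and k: "k < n" and u: "u \<in> W" "v \<in> W"
  shows "P (xs[k := u + v]) = P (xs[k := u]) + P (xs[k := v])"
proof -
  have "\<rho> (omit i (map fst (xs[k := u + v]))) (snd (xs[k := u + v] ! i)) =
     \<rho> (omit i (map fst (xs[k := u]))) (snd (xs[k := u] ! i)) + \<rho> (omit i (map fst (xs[k := v]))) (snd (xs[k := v] ! i))" if i: "i < n" for i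
    unfolding term_update[OF xs i k] using omit_fst[OF xs i] u k i
    by (auto simp: rho_right intro!: rho_add)
  then show ?thesis unfolding P_def by (simp add: signed_add sum.distrib)
qed

lemma signed_scaleM: "signed k (scaleM c m) = scaleM c (signed k m)"
  by (simp add: signed_def)

lemma P_scale:
  assumes xs: "xs \<in> tuples n W" and k: "k < n" and u: "u \<in> W"
  shows "P (xs[k := scale_pair scaleV scaleM c u]) = scaleM c (P (xs[k := u]))"
proof -
  have "\<rho> (omit i (map fst (xs[k := scale_pair scaleV scaleM c u]))) (snd (xs[k := scale_pair scaleV scaleM c u] ! i)) =
     scaleM c (\<rho> (omit i (map fst (xs[k := u]))) (snd (xs[k := u] ! i)))" if i: "i < n" for i
    unfolding term_update[OF xs i k] using omit_fst[OF xs i] u k i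
    by (auto simp: scale_pair_def rho_right intro!: rho_scale)
  then show ?thesis unfolding P_def by (simp add: signed_scaleM M.scale_sum_right)
qed

text \<open>Summands that keep both equal entries vanish. The two that omit one of them have the
  same entries in cyclically shifted order, and their signs are opposite to this shift.\<close>

lemma P_alt:
  assumes xs: "xs \<in> tuples n W" and ij: "i < j" "j < n" "xs ! i = xs ! j"
  shows "P xs = 0"
proof -
  let ?f = "map fst xs" and ?m = "snd (xs ! i)"
  let ?t = "\<lambda>l. signed (n - 1 - l) (\<rho> (omit l ?f) (snd (xs ! l)))"
  have l: "length xs = n" using xs by (simp add: tuples_def)
  have "P xs = (\<Sum>l\<in>{i, j}. ?t l)" unfolding P_def
  proof (rule sum.mono_neutral_right)
    show "\<forall>l\<in>{..<n} - {i, j}. ?t l = 0"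
    proof
      fix k assume k: "k \<in> {..<n} - {i, j}"
      define i' where "i' = (if i < k then i else i - 1)"
      define j' where "j' = (if j < k then j else j - 1)"
      have "omit k ?f ! i' = ?f ! i" "omit k ?f ! j' = ?f ! j" "i' < j'" "j' < n - 1"
        using k ij l unfolding i'_def j'_def by (auto simp: nth_omit)
      then have "\<rho> (omit k ?f) m = 0" for m
        using k ij l by (intro rho_alt[OF omit_fst[OF xs], of k i' j']) auto
      then show "?t k = 0" by simp
    qed
  qed (use ij in auto)
  also have "\<dots> = signed (n - 1 - i) (\<rho> (omit i ?f) ?m) + signed (n - 1 - j) (\<rho> (omit j ?f) ?m)"
    using ij by simp
  also have "\<dots> = 0"
    using fst_tuples[OF xs] ij l n1(3) by (intro \<rho>.F_omit_equal) auto
  finally show ?thesis .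
qed

lemma W_add: "u \<in> W \<Longrightarrow> v \<in> W \<Longrightarrow> u + v \<in> W"
  by (auto intro: V_add)

lemma B_in: "xs \<in> tuples n W \<Longrightarrow> B xs \<in> W"
  using V.br_closed[OF fst_tuples, of xs] by (simp add: B_eq)

sublocale B: alt_map n W B
proof
  show "u + v \<in> W" if "u \<in> W" "v \<in> W" for u v using that by (rule W_add)
  show "B (xs[i := u + v]) = B (xs[i := u]) + B (xs[i := v])" if "xs \<in> tuples n W" "i < n" "u \<in> W" "v \<in> W" for xs i u v
  proof -
    have t: "xs[i := w] \<in> tuples n W" if "w \<in> W" for w using that \<open>xs \<in> tuples n W\<close> by (intro tuples_update)
    have "br (map fst (xs[i := u + v])) = br (map fst (xs[i := u])) + br (map fst (xs[i := v]))"
      using that by (auto simp: map_update intro!: V.br_add fst_tuples)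
    then show ?thesis using that P_add[OF that] by (simp add: B_eq t W_add)
  qed
  show "B xs = 0" if "xs \<in> tuples n W" "i < j" "j < n" "xs ! i = xs ! j" for xs i j
  proof -
    have "br (map fst xs) = 0"
      using that by (intro V.br_alternating[OF fst_tuples[OF that(1)], of i j]) (auto simp: tuples_def)
    then show ?thesis using P_alt[OF that] that(1) by (simp add: B_eq zero_prod_def)
  qed
qed

lemma W0: "0 \<in> W" by (simp add: zero_prod_def V0)

lemma B_zero_entry: "xs \<in> tuples n W \<Longrightarrow> i < n \<Longrightarrow> B (xs[i := 0]) = 0"
  by (rule B.F_zero[OF _ _ W0])

lemma B_scale:
  assumes "xs \<in> tuples n W" "i < n" "v \<in> W"
  shows "B (xs[i := scale_pair scaleV scaleM c v]) = scale_pair scaleV scaleM c (B (xs[i := v]))"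
proof -
  have "scale_pair scaleV scaleM c v \<in> W" using assms(3) by (auto simp: scale_pair_def V_scale)
  moreover have "br (map fst (xs[i := scale_pair scaleV scaleM c v])) = scaleV c (br (map fst (xs[i := v])))"
    using assms by (auto simp: map_update scale_pair_def intro!: V.br_scale fst_tuples)
  ultimately show ?thesis using assms P_scale[OF assms] by (simp add: B_eq tuples_update scale_pair_def)
qed

lemma B_module_entry:
  assumes xs: "xs \<in> tuples n W" and k: "k < n" "fst (xs ! k) = 0"
  shows "B xs = (0, signed (n - 1 - k) (\<rho> (omit k (map fst xs)) (snd (xs ! k))))"
proof -
  let ?f = "map fst xs"
  have l: "length xs = n" using xs by (simp add: tuples_def)
  have "P xs = (\<Sum>i\<in>{k}. signed (n - 1 - i) (\<rho> (omit i ?f) (snd (xs ! i))))"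
    unfolding P_def
  proof (rule sum.mono_neutral_right)
    show "\<forall>i\<in>{..<n} - {k}. signed (n - 1 - i) (\<rho> (omit i ?f) (snd (xs ! i))) = 0"
    proof
      fix i assume i: "i \<in> {..<n} - {k}"
      define k' where "k' = (if k < i then k else k - 1)"
      have "omit i ?f ! k' = 0" "k' < n - 1"
        using i k l unfolding k'_def by (auto simp: nth_omit)
      then have "\<rho> (omit i ?f) (snd (xs ! i)) = 0" using i by (intro rho_zero_entry[OF omit_fst[OF xs]]) auto
      then show "signed (n - 1 - i) (\<rho> (omit i ?f) (snd (xs ! i))) = 0" by simp
    qed
  qed (use k in auto)
  moreover have "br ?f = 0" using k l by (intro br_zero_entry[OF fst_tuples[OF xs], of k]) auto
  ultimately show ?thesis using xs by (simp add: B_eq)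
qed

lemma B_fst_zero: "xs \<in> tuples n W \<Longrightarrow> k < n \<Longrightarrow> fst (xs ! k) = 0 \<Longrightarrow> fst (B xs) = 0"
  by (simp add: B_module_entry)

lemma B_two:
  assumes xs: "xs \<in> tuples n W" and k: "k < n" "fst (xs ! k) = 0" and j: "j < n" "fst (xs ! j) = 0" "j \<noteq> k"
  shows "B xs = 0"
proof -
  let ?f = "map fst xs"
  have l: "length xs = n" using xs by (simp add: tuples_def)
  define j' where "j' = (if j < k then j else j - 1)"
  have "omit k ?f ! j' = 0" "j' < n - 1" using j k l unfolding j'_def by (auto simp: nth_omit)
  then have "\<rho> (omit k ?f) (snd (xs ! k)) = 0" using k by (intro rho_zero_entry[OF omit_fst[OF xs]]) auto
  then show ?thesis by (simp add: B_module_entry[OF xs k] zero_prod_def)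
qed

abbreviation emb where "emb vs \<equiv> map (\<lambda>v. (v, 0 :: 'm)) vs"

lemma emb_in: "vs \<in> tuples k V \<Longrightarrow> emb vs \<in> tuples k W"
  by (auto simp: tuples_def)

lemma B_emb: "vs \<in> tuples n V \<Longrightarrow> B (emb vs) = (br vs, 0)"
proof -
  assume vs: "vs \<in> tuples n V"
  have f: "map fst (emb vs) = vs" by (simp add: o_def)
  have "P (emb vs) = 0" unfolding P_def f using vs omit_in_tuples[OF vs]
    by (intro sum.neutral) (auto simp: tuples_def rho_right0)
  then show ?thesis using emb_in[OF vs] f by (simp add: B_eq)
qed

text \<open>The failure of the fundamental identity. It is additive in every slot, so it only has to
  be examined on entries that lie in \<open>V\<close> or in the module.\<close>

definition D where "D as bs = B (as @ [B bs]) - (\<Sum>i<n. B (bs[i := B (as @ [bs ! i])]))"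

lemma snoc_in: "as \<in> tuples (n - 1) W \<Longrightarrow> x \<in> W \<Longrightarrow> as @ [x] \<in> tuples n W"
  using n1(1) by (intro snoc_tuples)

lemma D_add_left:
  assumes as: "as \<in> tuples (n - 1) W" and bs: "bs \<in> tuples n W" and i: "p < n - 1" "u \<in> W" "v \<in> W"
  shows "D (as[p := u + v]) bs = D (as[p := u]) bs + D (as[p := v]) bs"
proof -
  have l: "length as = n - 1" using as by (simp add: tuples_def)
  have add: "B (as[p := u + v] @ [x]) = B (as[p := u] @ [x]) + B (as[p := v] @ [x])" if "x \<in> W" for x
    using B.F_add[OF snoc_in[OF as that], of p u v] i l by (simp add: list_update_append)
  have "B (bs[i := B (as[p := u + v] @ [bs ! i])]) = B (bs[i := B (as[p := u] @ [bs ! i])]) + B (bs[i := B (as[p := v] @ [bs ! i])])"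
    if "i < n" for i
    unfolding add[OF tuples_nth[OF bs that]] using i(2,3) that
    by (intro B.F_add bs B_in snoc_in tuples_update as tuples_nth[OF bs]) auto
  then show ?thesis unfolding D_def using add[OF B_in[OF bs]] by (simp add: sum.distrib)
qed

lemma snoc_add:
  assumes as: "as \<in> tuples (n - 1) W" and uv: "u \<in> W" "v \<in> W"
  shows "B (as @ [u + v]) = B (as @ [u]) + B (as @ [v])"
proof -
  have "(as @ [0])[n - 1 := x] = as @ [x]" for x using tuples_length[OF as] by (metis list_update_length)
  then show ?thesis using B.F_add[OF snoc_in[OF as W0], of "n - 1" u v] uv n1 by simp
qed

lemma D_add_right:
  assumes as: "as \<in> tuples (n - 1) W" and bs: "bs \<in> tuples n W" and k: "k < n" and u: "u \<in> W" "v \<in> W"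
  shows "D as (bs[k := u + v]) = D as (bs[k := u]) + D as (bs[k := v])"
proof -
  have l: "length bs = n" using bs by (simp add: tuples_def)
  let ?t = "\<lambda>w i. B ((bs[k := w])[i := B (as @ [(bs[k := w]) ! i])])"
  have "?t (u + v) i = ?t u i + ?t v i" if i: "i < n" for i
  proof (cases "i = k")
    case True
    have "B (bs[k := B (as @ [u]) + B (as @ [v])]) = B (bs[k := B (as @ [u])]) + B (bs[k := B (as @ [v])])"
      by (intro B.F_add bs k B_in snoc_in as u)
    then show ?thesis using True k l snoc_add[OF as u] by simp
  next
    case False
    have c: "B (as @ [bs ! i]) \<in> W" by (intro B_in snoc_in as tuples_nth[OF bs i])
    have "?t w i = B ((bs[i := B (as @ [bs ! i])])[k := w])" for w
      using False i k l by (simp add: list_update_swap)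
    then show ?thesis using B.F_add[OF tuples_update[OF bs c], of k u v i] k u by simp
  qed
  moreover have "B (as @ [B (bs[k := u + v])]) = B (as @ [B (bs[k := u])]) + B (as @ [B (bs[k := v])])"
    unfolding B.F_add[OF bs k u] by (intro snoc_add as B_in tuples_update bs u)
  ultimately show ?thesis unfolding D_def by (simp add: sum.distrib)
qed

abbreviation "H \<equiv> V \<times> {0 :: 'm} \<union> {0} \<times> UNIV"

lemma H_W: "H \<subseteq> W" using V0 by auto

lemma H_gen: "w \<in> W \<Longrightarrow> \<exists>u\<in>H. \<exists>v\<in>H. w = u + v"
  by (rule bexI[of _ "(fst w, 0)"], rule bexI[of _ "(0, snd w)"]) auto

lemma tuples_mono: "xs \<in> tuples k H \<Longrightarrow> xs \<in> tuples k W"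
  using H_W by (auto simp: tuples_def)

lemma tuples_emb: 
  assumes "xs \<in> tuples k W" "\<And>i. i < k \<Longrightarrow> snd (xs ! i) = 0"
  shows "xs = emb (map fst xs)"
  using assms by (intro nth_equalityI) (auto simp: tuples_def prod_eq_iff)

text \<open>With two or more module entries in total every term vanishes. One module entry in
  \<open>as\<close> is the quadratic identity, one in \<open>bs\<close> is the Lie identity, and
  none is the fundamental identity of \<open>V\<close>.\<close>

lemma D_homogeneous:
  assumes asH: "as \<in> tuples (n - 1) H" and bsH: "bs \<in> tuples n H"
  shows "D as bs = 0"
proof -
  note as = tuples_mono[OF asH] and bs = tuples_mono[OF bsH]
  note la = tuples_length[OF as] and lb = tuples_length[OF bs]
  have lastW: "as @ [x] \<in> tuples n W" if "x \<in> W" for x using as that by (rule snoc_in)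
  have bW: "bs ! i \<in> W" if "i < n" for i using bs that by (rule tuples_nth)
  have cW: "B (as @ [bs ! i]) \<in> W" if "i < n" for i using that by (intro B_in lastW bW)
  have upd: "bs[i := B (as @ [bs ! i])] \<in> tuples n W" if "i < n" for i using that by (intro tuples_update bs cW)
  have last0: "fst (B (as @ [x])) = 0" if "x \<in> W" "fst x = 0" for x
    using that la n1 by (intro B_fst_zero[OF lastW, of _ "n - 1"]) (auto simp: nth_append)
  have HA: "snd (as ! i) = 0 \<or> fst (as ! i) = 0" if "i < n - 1" for i using tuples_nth[OF asH that] by auto
  have HB: "snd (bs ! i) = 0 \<or> fst (bs ! i) = 0" if "i < n" for i using tuples_nth[OF bsH that] by auto
  define a b where "a = map fst as" and "b = map fst bs"
  have a: "a \<in> tuples (n - 1) V" and b: "b \<in> tuples n V" unfolding a_def b_def by (intro fst_tuples as bs)+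
  have bnth: "b ! i = fst (bs ! i)" if "i < n" for i using that lb by (simp add: b_def)
  show ?thesis
  \<comment> \<open>A vanishing first component counts as a module entry, so the zero vector is
    covered by this case.\<close>
  proof (cases "\<exists>p<n - 1. fst (as ! p) = 0")
    case True
    then obtain p where p: "p < n - 1" "fst (as ! p) = 0" by blast
    have pn: "p < n" "p \<noteq> n - 1" using p by auto
    have asp: "(as @ [x]) ! p = as ! p" for x using p la by (simp add: nth_append)
    show ?thesis
    proof (cases "\<exists>k<n. fst (bs ! k) = 0")
      case True
      then obtain k where k: "k < n" "fst (bs ! k) = 0" by blast
      have two: "B (as @ [x]) = 0" if "x \<in> W" "fst x = 0" for x
        using pn p that la n1 by (intro B_two[OF lastW, of _ "n - 1" p]) (auto simp: nth_append)
      have "B (as @ [B bs]) = 0" by (intro two B_in bs B_fst_zero[OF bs k])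
      moreover have "B (bs[i := B (as @ [bs ! i])]) = 0" if i: "i < n" for i
      proof (cases "i = k")
        case True
        then show ?thesis using two[OF bW[OF k(1)] k(2)] k(1) by (simp add: B_zero_entry[OF bs])
      next
        case False
        have "fst (B (as @ [bs ! i])) = 0" using pn p(2) asp by (intro B_fst_zero[OF lastW[OF bW[OF i]], of p]) auto
        then show ?thesis using False i k lb by (intro B_two[OF upd[OF i], of i k]) auto
      qed
      ultimately show ?thesis unfolding D_def by simp
    next
      case False
      then have bse: "bs = emb b" unfolding b_def using HB by (intro tuples_emb[OF bs]) auto
      show ?thesis
      proof (cases "\<exists>q<n - 1. q \<noteq> p \<and> fst (as ! q) = 0")
        case True
        then obtain q where q: "q < n - 1" "q \<noteq> p" "fst (as ! q) = 0" by blast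
        have "B (as @ [x]) = 0" if "x \<in> W" for x
          using p q la pn by (intro B_two[OF lastW[OF that], of p q]) (auto simp: nth_append)
        then show ?thesis unfolding D_def using B_zero_entry[OF bs] bW B_in[OF bs] by simp
      next
        case False
        have e: "B (as @ [(h, 0)]) = (0, signed (n - 1 - p) (\<rho> (omit p a @ [h]) (snd (as ! p))))" if "h \<in> V" for h
        proof -
          have W: "(h, 0) \<in> W" using that by simp
          have "omit p (map fst (as @ [(h, 0)])) = omit p a @ [h]" unfolding a_def using p la by (simp add: omit_snoc)
          then show ?thesis using B_module_entry[OF lastW[OF W] pn(1)] p(2) by (simp add: asp)
        qed
        have tp: "omit p a \<in> tuples (n - 2) V" using omit_in_tuples[OF a p(1)] by (simp add: numeral_2_eq_2)
        have bV: "b ! i \<in> V" if "i < n" for i using b that by (rule tuples_nth)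
        have bi: "bs ! i = (b ! i, 0)" if "i < n" for i using that lb arg_cong[OF bse, of "\<lambda>x. x ! i"] by (simp add: b_def)
        let ?\<alpha> = "snd (as ! p)"
        have r: "omit p a @ [h] \<in> tuples (n - 1) V" if "h \<in> V" for h
          using tp that n2 by (auto simp: tuples_def)
        have "B (bs[i := B (as @ [bs ! i])]) = (0, signed (n - 1 - p) (signed (n - 1 - i) (\<rho> (omit i b) (\<rho> (omit p a @ [b ! i]) ?\<alpha>))))" if i: "i < n" for i
        proof -
          let ?c = "B (as @ [bs ! i])"
          have c: "?c = (0, signed (n - 1 - p) (\<rho> (omit p a @ [b ! i]) ?\<alpha>))" unfolding bi[OF i] by (rule e[OF bV[OF i]])
          have "B (bs[i := ?c]) = (0, signed (n - 1 - i) (\<rho> (omit i (map fst (bs[i := ?c]))) (snd ((bs[i := ?c]) ! i))))"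
            using i lb by (intro B_module_entry[OF upd[OF i] i]) (simp add: c)
          moreover have "omit i (map fst (bs[i := ?c])) = omit i b" using i lb by (simp add: map_update omit_update_same b_def)
          moreover have "(bs[i := ?c]) ! i = ?c" using i lb by simp
          ultimately show ?thesis
            using omit_in_tuples[OF b i] by (simp add: c rho_signed signed_signed add.commute)
        qed
        moreover have "B (as @ [B bs]) = (0, signed (n - 1 - p) (\<rho> (omit p a @ [br b]) ?\<alpha>))"
          unfolding bse B_emb[OF b] by (rule e[OF V.br_closed[OF b]])
        moreover have "\<rho> (omit p a @ [br b]) ?\<alpha> = (\<Sum>i<n. signed (n - 1 - i) (\<rho> (omit i b) (\<rho> (omit p a @ [b ! i]) ?\<alpha>)))"
          by (rule rho_quad[OF tp b])
        ultimately show ?thesis unfolding D_def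
          by (simp add: prod_eq_iff fst_sum snd_sum signed_sum)
      qed
    qed
  next
    case False
    then have ase: "as = emb a" unfolding a_def using HA by (intro tuples_emb[OF as]) auto
    have e0: "B (as @ [(h, 0)]) = (br (a @ [h]), 0)" if "h \<in> V" for h
    proof -
      have "as @ [(h, 0)] = emb (a @ [h])" unfolding ase by simp
      then show ?thesis using B_emb[OF snoc_tuples[OF a that n1(1)]] by simp
    qed
    have e1: "B (as @ [(0, m)]) = (0, \<rho> a m)" for m
    proof -
      have W: "(0, m) \<in> W" using V0 by simp
      have "omit (n - 1) (map fst (as @ [(0, m)])) = a" using omit_last[of a 0] la by (simp add: a_def)
      moreover have "(as @ [(0, m)]) ! (n - 1) = (0, m)" using la by (simp add: nth_append)
      ultimately show ?thesis using B_module_entry[OF lastW[OF W], of "n - 1"] n1 by simp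
    qed
    show ?thesis
    proof (cases "\<exists>k<n. fst (bs ! k) = 0")
      case True
      then obtain k where k: "k < n" "fst (bs ! k) = 0" by blast
      show ?thesis
      proof (cases "\<exists>l<n. l \<noteq> k \<and> fst (bs ! l) = 0")
        case True
        then obtain l where l: "l < n" "l \<noteq> k" "fst (bs ! l) = 0" by blast
        have "B bs = 0" using k l by (intro B_two[OF bs, of k l]) auto
        moreover have "B (as @ [0]) = 0" using e1[of 0] rho_right0[OF a] by (simp add: zero_prod_def)
        moreover have "B (bs[i := B (as @ [bs ! i])]) = 0" if i: "i < n" for i
        proof -
          have "fst (bs ! i) = 0 \<Longrightarrow> fst (B (as @ [bs ! i])) = 0" by (rule last0[OF bW[OF i]])
          then show ?thesis using k l i lb
            by (intro B_two[OF upd[OF i], of k l]) (auto simp: nth_list_update)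
        qed
        ultimately show ?thesis unfolding D_def by simp
      next
        case False
        define \<beta> where "\<beta> = snd (bs ! k)"
        have bk: "bs ! k = (0, \<beta>)" using k(2) by (simp add: \<beta>_def prod_eq_iff)
        have bi: "bs ! i = (b ! i, 0)" if "i < n" "i \<noteq> k" for i
          using HB[OF that(1)] False that by (auto simp: prod_eq_iff bnth)
        have ok: "omit k b \<in> tuples (n - 1) V" by (rule omit_in_tuples[OF b k(1)])
        have bV: "b ! i \<in> V" if "i < n" for i using b that by (rule tuples_nth)
        have Bb: "B bs = (0, signed (n - 1 - k) (\<rho> (omit k b) \<beta>))"
          using B_module_entry[OF bs k] by (simp add: b_def \<beta>_def)
        have L: "B (as @ [B bs]) = (0, signed (n - 1 - k) (\<rho> a (\<rho> (omit k b) \<beta>)))"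
          unfolding Bb e1 by (simp add: rho_signed[OF a])
        have tk: "B (bs[k := B (as @ [bs ! k])]) = (0, signed (n - 1 - k) (\<rho> (omit k b) (\<rho> a \<beta>)))"
        proof -
          let ?x = "bs[k := (0, \<rho> a \<beta>)]"
          have x: "?x \<in> tuples n W" using V0 by (intro tuples_update bs) simp
          have "omit k (map fst ?x) = omit k b" using k lb by (simp add: map_update omit_update_same b_def)
          then show ?thesis unfolding bk e1 using B_module_entry[OF x k(1)] k lb by simp
        qed
        have ti: "B (bs[i := B (as @ [bs ! i])]) = (0, signed (n - 1 - k) (\<rho> ((omit k b)[j := br (a @ [omit k b ! j])]) \<beta>))"
          if j: "j < n - 1" and i: "i = (if j < k then j else Suc j)" for i j
        proof -
          have ik: "i < n" "i \<noteq> k" using j k i by (auto split: if_splits)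
          have nth: "omit k b ! j = b ! i" using i j k tuples_length[OF b] by (simp add: nth_omit)
          let ?y = "br (a @ [b ! i])"
          let ?x = "bs[i := (?y, 0)]"
          have c: "B (as @ [bs ! i]) = (?y, 0)" unfolding bi[OF ik] by (rule e0[OF bV[OF ik(1)]])
          have x: "?x \<in> tuples n W" using upd[OF ik(1)] unfolding c .
          have "omit k (map fst ?x) = (omit k b)[j := ?y]"
            using k lb ik i by (auto simp: map_update b_def[symmetric] omit_update_other tuples_length[OF b])
          then show ?thesis unfolding c nth using B_module_entry[OF x k(1)] k ik lb by (simp add: \<beta>_def)
        qed
        \<comment> \<open>The index of the module entry gives the product of the two operators in
          exchanged order; the other indices give the terms with one entry of
          \<open>omit k b\<close> replaced.\<close>
        have "(\<Sum>i<n. B (bs[i := B (as @ [bs ! i])])) = B (bs[k := B (as @ [bs ! k])])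
           + (\<Sum>j<n - 1. B (bs[(if j < k then j else Suc j) := B (as @ [bs ! (if j < k then j else Suc j)])]))"
          by (rule sum_skip[OF k(1)])
        also have "(\<Sum>j<n - 1. B (bs[(if j < k then j else Suc j) := B (as @ [bs ! (if j < k then j else Suc j)])]))
          = (\<Sum>j<n - 1. (0, signed (n - 1 - k) (\<rho> ((omit k b)[j := br (a @ [omit k b ! j])]) \<beta>)))"
          by (intro sum.cong refl ti) auto
        finally have R: "(\<Sum>i<n. B (bs[i := B (as @ [bs ! i])])) = (0, signed (n - 1 - k) (\<rho> (omit k b) (\<rho> a \<beta>)))
            + (\<Sum>j<n - 1. (0, signed (n - 1 - k) (\<rho> ((omit k b)[j := br (a @ [omit k b ! j])]) \<beta>)))"
          unfolding tk .
        show ?thesis unfolding D_def L R rho_lie[OF a ok]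
          by (simp add: prod_eq_iff fst_sum snd_sum signed_sum signed_add)
      qed
    next
      case False
      then have bse: "bs = emb b" unfolding b_def using HB by (intro tuples_emb[OF bs]) auto
      have bV: "b ! i \<in> V" if "i < n" for i using b that by (rule tuples_nth)
      have bi: "bs ! i = (b ! i, 0)" if "i < n" for i using that lb arg_cong[OF bse, of "\<lambda>x. x ! i"] by (simp add: b_def)
      have "B (bs[i := B (as @ [bs ! i])]) = (br (b[i := br (a @ [b ! i])]), 0)" if i: "i < n" for i
      proof -
        have y: "br (a @ [b ! i]) \<in> V" by (intro V.br_closed snoc_tuples a bV i n1(1))
        have "bs[i := B (as @ [bs ! i])] = emb (b[i := br (a @ [b ! i])])"
          unfolding bi[OF i] e0[OF bV[OF i]] by (subst bse) (simp add: map_update)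
        then show ?thesis using B_emb[OF tuples_update[OF b y]] by simp
      qed
      moreover have "B (as @ [B bs]) = (br (a @ [br b]), 0)"
        unfolding bse B_emb[OF b] by (rule e0[OF V.br_closed[OF b]])
      ultimately show ?thesis unfolding D_def using V.fundamental_identity[OF a b]
        by (simp add: prod_eq_iff fst_sum snd_sum)
    qed
  qed
qed

lemma D_zero:
  assumes as: "as \<in> tuples (n - 1) W" and bs: "bs \<in> tuples n W"
  shows "D as bs = 0"
proof (rule additive_vanish[where F = "\<lambda>as. D as bs" and W = W and H = H and k = "n - 1"])
  fix as assume asH: "as \<in> tuples (n - 1) H"
  note as' = tuples_mono[OF asH]
  show "D as bs = 0"
    by (rule additive_vanish[where F = "D as" and W = W and H = H and k = n])
       (use D_add_right[OF as'] D_homogeneous[OF asH] bs V0 in \<open>auto intro: H_gen H_W[THEN subsetD]\<close>)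
qed (use D_add_left[OF _ bs] as V0 in \<open>auto intro: H_gen H_W[THEN subsetD]\<close>)

lemma vector_space_pair: "vector_space (scale_pair scaleV scaleM)"
  by unfold_locales (auto simp: scale_pair_def V.scale_right_distrib V.scale_left_distrib M.scale_right_distrib M.scale_left_distrib)

theorem module: "n_Lie_module scaleV n V br scaleM B"
proof -
  interpret S: vector_space "scale_pair scaleV scaleM" by (rule vector_space_pair)
  have sub: "S.subspace W"
    by (rule S.subspaceI) (auto simp: zero_prod_def scale_pair_def V0 V_add V_scale)
  have "n_Lie_algebra (scale_pair scaleV scaleM) n W B"
  proof (intro n_Lie_algebra.intro vector_space_pair n_Lie_algebra_axioms.intro)
    show "B (as @ [B bs]) = (\<Sum>i<n. B (bs[i := B (as @ [bs ! i])]))" if "as \<in> tuples (n - 1) W" "bs \<in> tuples n W" for as bs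
      using D_zero[OF that] by (simp add: D_def)
  qed (use sub B_in B.F_add B_scale B.F_alt in auto)
  moreover have "n_Lie_module_axioms n V br B"
  proof
    show "B xs = 0" if "xs \<in> tuples n W" "i < j" "j < n" "fst (xs ! i) = 0" "fst (xs ! j) = 0" for xs i j
      by (rule B_two[of xs i j]) (use that in auto)
  qed (use B_emb B_fst_zero in auto)
  ultimately show ?thesis by (intro n_Lie_module.intro M.vector_space_axioms)
qed

lemma module_act_B: 
  assumes "vs \<in> tuples (n - 1) V" shows "module_act B vs m = \<rho> vs m"
proof -
  have t: "emb vs @ [(0, m)] \<in> tuples n W" using V0 by (intro snoc_in emb_in assms) simp
  have l: "length vs = n - 1" using assms by (simp add: tuples_def)
  have "omit (n - 1) (map fst (emb vs @ [(0, m)])) = vs" using omit_last[of vs 0] l by (simp add: o_def)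
  then show ?thesis
    unfolding module_act_def using B_module_entry[OF t, of "n - 1"] l n1 by (simp add: nth_append)
qed

end

text \<open>By additivity it is enough to compare homogeneous tuples: the bracket is prescribed when
  no entry is in the module, it is the action up to sign for one such entry, and it is zero for
  two.\<close>

lemma n_Lie_module_unique:
  assumes B: "n_Lie_module scaleV n V br scaleM B" and B': "n_Lie_module scaleV n V br scaleM B'" and n: "n \<ge> 1"
    and act: "\<And>vs m. vs \<in> tuples (n - 1) V \<Longrightarrow> module_act B vs m = module_act B' vs m"
    and xs: "xs \<in> tuples n (V \<times> UNIV)"
  shows "B xs = B' xs"
proof -
  interpret B: n_Lie_module scaleV n V br scaleM B by (rule B)
  interpret B': n_Lie_module scaleV n V br scaleM B' by (rule B')
  let ?H = "V \<times> {0} \<union> {0} \<times> UNIV"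
  have "B xs - B' xs = 0"
  proof (rule additive_vanish[where F = "\<lambda>xs. B xs - B' xs" and W = "V \<times> UNIV" and H = ?H and k = n])
    show "\<exists>u\<in>?H. \<exists>v\<in>?H. w = u + v" if "w \<in> V \<times> UNIV" for w :: "'b \<times> 'c"
      using that by (intro bexI[of _ "(fst w, 0)"] bexI[of _ "(0, snd w)"]) auto
    show H: "?H \<subseteq> V \<times> UNIV" using B.V_zero by auto
    show "B xs - B' xs = 0" if H': "xs \<in> tuples n ?H" for xs
    proof -
      have xs: "xs \<in> tuples n (V \<times> UNIV)" using H' H unfolding tuples_def by blast
      have l: "length xs = n" using xs by (simp add: tuples_def)
      have h: "snd (xs ! i) = 0 \<or> fst (xs ! i) = 0" if "i < n" for i using tuples_nth[OF H' that] by auto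
      have f: "map fst xs \<in> tuples n V" using xs by (auto simp: tuples_def)
      show ?thesis
      proof (cases "\<exists>k<n. fst (xs ! k) = 0")
        case True
        then obtain k where k: "k < n" "fst (xs ! k) = 0" by blast
        show ?thesis
        proof (cases "\<exists>j<n. j \<noteq> k \<and> fst (xs ! j) = 0")
          case True
          then obtain j where j: "j < n" "j \<noteq> k" "fst (xs ! j) = 0" by blast
          then have "B xs = 0 \<and> B' xs = 0"
            using k B.abelian[OF xs, of j k] B.abelian[OF xs, of k j] B'.abelian[OF xs, of j k] B'.abelian[OF xs, of k j]
            by (cases j k rule: linorder_cases) auto
          then show ?thesis by simp
        next
          case False
          have "xs = (map (\<lambda>v. (v, 0)) (map fst xs))[k := (0, snd (xs ! k))]"
            using l k h False by (intro nth_equalityI) (auto simp: nth_list_update prod_eq_iff)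
          then show ?thesis
            using B.B_one_module_entry[OF f k(1), of "snd (xs ! k)"] B'.B_one_module_entry[OF f k(1), of "snd (xs ! k)"]
              act[OF omit_in_tuples[OF f k(1)]] by simp
        qed
      next
        case False
        then have "xs = map (\<lambda>v. (v, 0)) (map fst xs)"
          using l h by (intro nth_equalityI) (auto simp: prod_eq_iff)
        then show ?thesis using B.subalgebra[OF f] B'.subalgebra[OF f] by simp
      qed
    qed
  qed (use xs B.B.F_add B'.B.F_add in auto)
  then show ?thesis by simp
qed

lemma n_Lie_algebra_mfps:
  assumes "n \<ge> 1"
  shows "n_Lie_algebra mfps_scale n (mfps_in n :: 'a::field_char_0 mfps set) (jacobian_bracket n)"
proof -
  interpret vector_space "mfps_scale :: 'a \<Rightarrow> 'a mfps \<Rightarrow> 'a mfps" by (rule vector_space_mfps_scale)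
  show ?thesis
  proof
    show "subspace (mfps_in n :: 'a mfps set)" by (rule subspaceI) auto
    show "jacobian_bracket n xs \<in> mfps_in n" if "xs \<in> tuples n (mfps_in n)" for xs :: "'a mfps list"
      using that by (rule jac_in_tuples)
    show "jacobian_bracket n xs = 0" if "xs \<in> tuples n (mfps_in n)" "i < j" "j < n" "xs ! i = xs ! j" for xs :: "'a mfps list" and i j
      by (rule jac_alt[of i n j]) (use that in \<open>auto simp: tuples_def\<close>)
    fix as bs :: "'a mfps list" assume as: "as \<in> tuples (n - 1) (mfps_in n)" and bs: "bs \<in> tuples n (mfps_in n)"
    have l: "length as = n - 1" "length bs = n" using as bs by (auto simp: tuples_def)
    show "jacobian_bracket n (as @ [jacobian_bracket n bs]) = (\<Sum>i<n. jacobian_bracket n (bs[i := jacobian_bracket n (as @ [bs ! i])]))"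
      unfolding jac_snoc[OF l(1) assms] by (rule vf_jac[OF vdiv_jfield[OF l(1) assms] l(2)])
  qed (auto simp: tuples_def jac_add jac_scale)
qed

section \<open>The correspondence\<close>

context lie_rep
begin

lemma E_neg: "S \<in> carrier E \<Longrightarrow> (\<ominus>\<^bsub>E\<^esub> S) m = - S m"
  using E_minus[OF ev.S.zero_closed, of S m] by (simp add: ev.S.minus_eq) (simp add: endo_ring_def)

lemma sigma_zero: "0 \<in> L \<Longrightarrow> \<sigma> 0 m = 0"
  using \<sigma>_add[of 0 0 m] by simp

lemma sigma_zero_right: "x \<in> L \<Longrightarrow> \<sigma> x 0 = 0"
  and sigma_minus_right: "x \<in> L \<Longrightarrow> \<sigma> x (- m) = - \<sigma> x m"
  and sigma_add_right: "x \<in> L \<Longrightarrow> \<sigma> x (m + m') = \<sigma> x m + \<sigma> x m'"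
  and sigma_scale_right: "x \<in> L \<Longrightarrow> \<sigma> x (scaleM c m) = scaleM c (\<sigma> x m)"
proof -
  assume x: "x \<in> L"
  show a: "\<sigma> x (m + m') = \<sigma> x m + \<sigma> x m'" for m m' using \<sigma>_linear[OF x] by (simp add: lin)
  show "\<sigma> x (scaleM c m) = scaleM c (\<sigma> x m)" using \<sigma>_linear[OF x] by (simp add: lin)
  show z: "\<sigma> x 0 = 0" using a[of 0 0] by simp
  show "\<sigma> x (- m) = - \<sigma> x m" using a[of m "- m"] z by (simp add: eq_neg_iff_add_eq_0 add.commute)
qed

end

lemma S_scale_minus: "S_scale (- 1) X = - X"
  by (rule ext, rule mfps_eqI) (simp add: S_scale_def mfps_scale.rep_eq uminus_mfps.rep_eq)

locale S_rep = lie_rep scaleM "S_Lie n" S_scale commutator \<sigma>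
  for scaleM :: "'a::field_char_0 \<Rightarrow> 'm::ab_group_add \<Rightarrow> 'm" and n \<sigma> +
  assumes n3: "n \<ge> 3"
begin

abbreviation V where "V \<equiv> mfps_in n :: 'a mfps set"
abbreviation act where "act fs \<equiv> \<sigma> (ad n fs)"

lemma n1: "n \<ge> 1" using n3 by simp

lemma ad_in: "fs \<in> tuples (n - 1) V \<Longrightarrow> ad n fs \<in> S_Lie n"
  by (rule ad_S_Lie[OF _ n1])

lemma U_S_eq: "U_S n = U" by (simp add: U_S_def)

lemma ring_U: "ring U" by (rule ring_uea[OF L_closed])

lemma U_ad_in: "fs \<in> tuples (n - 1) V \<Longrightarrow> U_ad n fs \<in> carrier U"
  unfolding U_carrier U_ad_def uea_gen_def using free_gen_in[OF ad_in] by blast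

lemma lift_U_ad: "fs \<in> tuples (n - 1) V \<Longrightarrow> lift (U_ad n fs) = act fs"
  unfolding U_ad_def by (rule lift_gen[OF ad_in])

sublocale h: ring_hom_ring U E lift
  by (rule ring_hom_ringI2[OF ring_U ring_E lift_hom])

lemma lift_mult: "x \<in> carrier U \<Longrightarrow> y \<in> carrier U \<Longrightarrow> lift (x \<otimes>\<^bsub>U\<^esub> y) m = lift x (lift y m)"
  using ring_hom_mult[OF lift_hom, of x y] by (simp add: endo_ring_def)

lemma lift_sign_mult: 
  "x \<in> carrier U \<Longrightarrow> lift ((\<ominus>\<^bsub>U\<^esub> \<one>\<^bsub>U\<^esub>) [^]\<^bsub>U\<^esub> (k::nat) \<otimes>\<^bsub>U\<^esub> x) m = signed k (lift x m)"
proof (induction k arbitrary: x)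
  case (Suc k)
  let ?e = "\<ominus>\<^bsub>U\<^esub> \<one>\<^bsub>U\<^esub>"
  have e: "?e [^]\<^bsub>U\<^esub> Suc k \<otimes>\<^bsub>U\<^esub> x = ?e [^]\<^bsub>U\<^esub> k \<otimes>\<^bsub>U\<^esub> (\<ominus>\<^bsub>U\<^esub> x)"
    using Suc.prems by (simp add: h.R.m_assoc h.R.l_minus)
  have "lift (\<ominus>\<^bsub>U\<^esub> x) m = - lift x m"
    using Suc.prems by (simp add: E_neg)
  then show ?case unfolding e using Suc.IH[of "\<ominus>\<^bsub>U\<^esub> x"] Suc.prems by (simp add: signed_minus)
qed simp

lemma lift_finsum:
  assumes "finite K" "F \<in> K \<rightarrow> carrier U"
  shows "lift (finsum U F K) m = (\<Sum>k\<in>K. lift (F k) m)"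
  using assms
proof (induction K rule: finite_induct)
  case empty
  show ?case by (simp add: h.R.finsum_empty) (simp add: endo_ring_def)
next
  case (insert k K)
  have c: "F k \<in> carrier U" "F \<in> K \<rightarrow> carrier U" using insert.prems by auto
  have "lift (finsum U F (insert k K)) m = lift (F k \<oplus>\<^bsub>U\<^esub> finsum U F K) m"
    using insert.hyps c by (simp add: h.R.finsum_insert)
  also have "\<dots> = lift (F k) m + lift (finsum U F K) m"
    using ring_hom_add[OF lift_hom c(1) h.R.finsum_closed[OF c(2)]] by (simp add: endo_ring_def)
  finally show ?case using insert.hyps insert.IH[OF c(2)] by simp
qed

lemma jac_Cons_in: "hs \<in> tuples n V \<Longrightarrow> ts \<in> tuples (n - 2) V \<Longrightarrow> jacobian_bracket n hs # ts \<in> tuples (n - 1) V"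
  and nth_Cons_in: "hs \<in> tuples n V \<Longrightarrow> ts \<in> tuples (n - 2) V \<Longrightarrow> i < n \<Longrightarrow> hs ! i # ts \<in> tuples (n - 1) V"
  using jac_in_tuples[of hs n] n3 by (auto simp: tuples_def)

lemma lift_Q_gen:
  assumes hs: "hs \<in> tuples n V" and ts: "ts \<in> tuples (n - 2) V"
  shows "Q_gen n hs ts \<in> carrier U"
    "lift (Q_gen n hs ts) m = act (jacobian_bracket n hs # ts) m
      - (\<Sum>i<n. signed (n - 1 - i) (act (omit i hs) (act (hs ! i # ts) m)))"
proof -
  let ?x = "\<lambda>i. U_ad n (take (i - 1) hs @ drop i hs) \<otimes>\<^bsub>U\<^esub> U_ad n (hs ! (i - 1) # ts)"
  let ?F = "\<lambda>i. (\<ominus>\<^bsub>U\<^esub> \<one>\<^bsub>U\<^esub>) [^]\<^bsub>U\<^esub> (i + n) \<otimes>\<^bsub>U\<^esub> ?x i"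
  have om: "take (i - 1) hs @ drop i hs = omit (i - 1) hs" if "i \<in> {1..n}" for i using that by (simp add: omit_def)
  have c: "U_ad n (take (i - 1) hs @ drop i hs) \<in> carrier U" "U_ad n (hs ! (i - 1) # ts) \<in> carrier U" if "i \<in> {1..n}" for i
    unfolding om[OF that] using that by (auto intro!: U_ad_in omit_in_tuples hs nth_Cons_in[OF hs ts])
  have xc: "?x i \<in> carrier U" if "i \<in> {1..n}" for i using c[OF that] by (rule h.R.m_closed)
  have Fc: "?F \<in> {1..n} \<rightarrow> carrier U"
  proof
    fix i assume "i \<in> {1..n}"
    then show "?F i \<in> carrier U" by (intro h.R.m_closed[OF _ xc]) auto
  qed
  have J: "U_ad n (jacobian_bracket n hs # ts) \<in> carrier U" by (rule U_ad_in[OF jac_Cons_in[OF hs ts]])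
  have S: "finsum U ?F {1..n} \<in> carrier U" by (rule h.R.finsum_closed[OF Fc])
  have Q: "Q_gen n hs ts = U_ad n (jacobian_bracket n hs # ts) \<ominus>\<^bsub>U\<^esub> finsum U ?F {1..n}"
    unfolding Q_gen_def U_S_eq ..
  show "Q_gen n hs ts \<in> carrier U" unfolding Q by (rule h.R.minus_closed[OF J S])
  have "lift (finsum U ?F {1..n}) m = (\<Sum>i\<in>{1..n}. lift (?F i) m)"
    by (rule lift_finsum[OF _ Fc]) simp
  also have "\<dots> = (\<Sum>i\<in>{1..n}. signed (i + n) (act (omit (i - 1) hs) (act (hs ! (i - 1) # ts) m)))"
  proof (rule sum.cong[OF refl])
    fix i assume i: "i \<in> {1..n}"
    have i1: "i - 1 < n" using i by auto
    show "lift (?F i) m = signed (i + n) (act (omit (i - 1) hs) (act (hs ! (i - 1) # ts) m))"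
      unfolding lift_sign_mult[OF xc[OF i]] lift_mult[OF c[OF i]] unfolding om[OF i]
      using lift_U_ad[OF omit_in_tuples[OF hs i1]] lift_U_ad[OF nth_Cons_in[OF hs ts i1]] by simp
  qed
  \<comment> \<open>With indices shifted to start at 0 the exponent becomes
    \<open>i + 1 + n\<close>, which has the parity of \<open>n - 1 - i\<close>.\<close>
  also have "\<dots> = (\<Sum>i<n. signed (n - 1 - i) (act (omit i hs) (act (hs ! i # ts) m)))"
    by (rule sum.reindex_bij_witness[of _ Suc "\<lambda>i. i - 1"]) (auto simp: signed_def)
  finally have "lift (finsum U ?F {1..n}) m = \<dots>" .
  moreover have "lift (Q_gen n hs ts) m = lift (U_ad n (jacobian_bracket n hs # ts)) m - lift (finsum U ?F {1..n}) m"
    unfolding Q a_minus_def using J S E_minus[of "lift (U_ad n (jacobian_bracket n hs # ts))" "lift (finsum U ?F {1..n})" m]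
    by (simp add: a_minus_def)
  ultimately show "lift (Q_gen n hs ts) m = act (jacobian_bracket n hs # ts) m
      - (\<Sum>i<n. signed (n - 1 - i) (act (omit i hs) (act (hs ! i # ts) m)))"
    using lift_U_ad[OF jac_Cons_in[OF hs ts]] by simp
qed

sublocale act: alt_map "n - 1" V "\<lambda>fs. act fs m" for m
proof
  fix xs i and u v :: "'a mfps" assume *: "xs \<in> tuples (n - 1) V" "i < n - 1" "u \<in> V" "v \<in> V"
  show "act (xs[i := u + v]) m = act (xs[i := u]) m + act (xs[i := v]) m"
    unfolding ad_update_add[OF *(1,2)] using * by (intro \<sigma>_add ad_in tuples_update)
next
  fix xs :: "'a mfps list" and i j assume *: "xs \<in> tuples (n - 1) V" "i < j" "j < n - 1" "xs ! i = xs ! j"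
  show "act xs m = 0" unfolding ad_alt[OF *] by (rule sigma_zero[OF S_Lie_zero])
qed auto

lemma act_scale: "fs \<in> tuples (n - 1) V \<Longrightarrow> i < n - 1 \<Longrightarrow> u \<in> V \<Longrightarrow> act (fs[i := mfps_scale c u]) m = scaleM c (act (fs[i := u]) m)"
  by (simp only: ad_update_scale \<sigma>_scale ad_in tuples_update)

lemma act_signed: "fs \<in> tuples (n - 1) V \<Longrightarrow> act fs (signed k m) = signed k (act fs m)"
  by (simp add: signed_def sigma_minus_right ad_in)

lemma act_snoc: 
  assumes "ts \<in> tuples (n - 2) V" "x \<in> V" shows "act (ts @ [x]) m = signed (n - 2) (act (x # ts) m)"
proof -
  have "x # ts \<in> tuples (n - 1) V" using assms n3 by (auto simp: tuples_def)
  from act.F_move_last[OF this, of 0 m] n3 show ?thesis by (simp add: omit_def numeral_2_eq_2)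
qed

text \<open>The generators of the ideal carry the distinguished entry first, the action identity
  carries it last. The change costs the same sign \<open>n - 2\<close> in every term on both
  sides.\<close>

lemma quad_iff_Q_gen:
  assumes hs: "hs \<in> tuples n V" and ts: "ts \<in> tuples (n - 2) V"
  shows "lift (Q_gen n hs ts) m = 0 \<longleftrightarrow>
    act (ts @ [jacobian_bracket n hs]) m = (\<Sum>i<n. signed (n - 1 - i) (act (omit i hs) (act (ts @ [hs ! i]) m)))"
proof -
  have "(\<Sum>i<n. signed (n - 1 - i) (act (omit i hs) (act (ts @ [hs ! i]) m)))
    = signed (n - 2) (\<Sum>i<n. signed (n - 1 - i) (act (omit i hs) (act (hs ! i # ts) m)))"
    unfolding signed_sum
    by (intro sum.cong refl)
      (simp add: act_snoc[OF ts tuples_nth[OF hs]] act_signed[OF omit_in_tuples[OF hs]] signed_signed add.commute)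
  then show ?thesis
    unfolding lift_Q_gen(2)[OF hs ts] act_snoc[OF ts jac_in_tuples[OF hs]] by (auto simp: signed_def)
qed

text \<open>The entry 1 makes the bracket zero, and in each summand on the right it occurs in one of
  the two operators, which is then zero because \<open>ad\<close> vanishes on tuples containing
  1.\<close>

lemma quad_of_one:
  assumes hs: "hs \<in> tuples n V" and ts: "ts \<in> tuples (n - 2) V" and one: "1 \<in> set hs"
  shows "act (ts @ [jacobian_bracket n hs]) m = (\<Sum>i<n. signed (n - 1 - i) (act (omit i hs) (act (ts @ [hs ! i]) m)))"
proof -
  have l: "length hs = n" "length ts = n - 2" using hs ts by (auto simp: tuples_def)
  obtain p where p: "p < n" "hs ! p = 1" using one l by (auto simp: in_set_conv_nth)
  have "hs[p := 1] = hs" using p(2) by (metis list_update_id)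
  then have J: "jacobian_bracket n hs = 0" using jac_one[OF p(1) l(1)] by simp
  have z: "act fs m = 0" if "fs \<in> tuples (n - 1) V" "1 \<in> set fs" for fs m
    unfolding ad_one[OF that] by (rule sigma_zero[OF S_Lie_zero])
  have t: "ts @ [x] \<in> tuples (n - 1) V" if "x \<in> V" for x using ts that n3 by (auto simp: tuples_def)
  have t0: "ts @ [0] \<in> tuples (n - 1) V" by (rule t) auto
  have "(ts @ [0])[n - 2 := 0] = ts @ [0]" using l by (metis list_update_length)
  then have "act (ts @ [0]) m = 0" using act.F_zero[OF t0, of "n - 2" m] n3 by simp
  moreover have "act (omit i hs) (act (ts @ [hs ! i]) m) = 0" if i: "i < n" for i
  proof (cases "i = p")
    case True
    then have "act (ts @ [hs ! i]) m = 0" using p t[of 1] by (intro z) auto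
    then show ?thesis using omit_in_tuples[OF hs i] by (simp add: sigma_zero_right ad_in)
  next
    case False
    have "omit i hs ! (if p < i then p else p - 1) = 1" "(if p < i then p else p - 1) < length (omit i hs)"
      using False p i l by (auto simp: nth_omit)
    then have "1 \<in> set (omit i hs)" by (metis nth_mem)
    then show ?thesis by (rule z[OF omit_in_tuples[OF hs i]])
  qed
  ultimately show ?thesis unfolding J by simp
qed

definition quad where "quad \<longleftrightarrow> (\<forall>hs\<in>tuples n V. \<forall>ts\<in>tuples (n - 2) V. \<forall>m.
  act (ts @ [jacobian_bracket n hs]) m = (\<Sum>i<n. signed (n - 1 - i) (act (omit i hs) (act (ts @ [hs ! i]) m))))"

text \<open>The elements acting by zero form an ideal, so only generators matter. The tuples with an
  entry 1, which give no generator, satisfy the identity automatically.\<close>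

lemma lift_Q_ideal: "(\<forall>q\<in>Q_ideal n. lift q = (\<lambda>_. 0)) \<longleftrightarrow> quad"
proof
  let ?G = "{Q_gen n hs ts | hs ts. hs \<in> tuples n V \<and> ts \<in> tuples (n - 2) V \<and> 1 \<notin> set hs}"
  have G: "?G \<subseteq> carrier U" using lift_Q_gen(1) by blast
  have zero_E: "\<zero>\<^bsub>E\<^esub> = (\<lambda>_. 0)" by (simp add: endo_ring_def)
  have Q: "Q_ideal n = Idl\<^bsub>U\<^esub> ?G" by (simp add: Q_ideal_def U_S_eq)
  {
    assume k: "\<forall>q\<in>Q_ideal n. lift q = (\<lambda>_. 0)"
    show quad unfolding quad_def
    proof (intro ballI allI)
      fix hs ts m assume hs: "hs \<in> tuples n V" and ts: "ts \<in> tuples (n - 2) V"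
      show "act (ts @ [jacobian_bracket n hs]) m = (\<Sum>i<n. signed (n - 1 - i) (act (omit i hs) (act (ts @ [hs ! i]) m)))"
      proof (cases "1 \<in> set hs")
        case False
        then have "Q_gen n hs ts \<in> ?G" using hs ts by blast
        then have "Q_gen n hs ts \<in> Q_ideal n" unfolding Q using h.R.genideal_self[OF G] by (rule subsetD[rotated])
        then have "lift (Q_gen n hs ts) = (\<lambda>_. 0)" by (rule bspec[OF k])
        then have "lift (Q_gen n hs ts) m = 0" by (rule fun_cong)
        then show ?thesis unfolding quad_iff_Q_gen[OF hs ts] .
      qed (rule quad_of_one[OF hs ts])
    qed
  }
  assume quad
  have "?G \<subseteq> a_kernel U E lift"
  proof
    fix q assume "q \<in> ?G"
    then obtain hs ts where q: "q = Q_gen n hs ts" "hs \<in> tuples n V" "ts \<in> tuples (n - 2) V"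
      unfolding mem_Collect_eq by (elim exE conjE)
    have "lift q m = 0" for m
      unfolding q(1) quad_iff_Q_gen[OF q(2,3)] using \<open>quad\<close> q(2,3) unfolding quad_def by blast
    then have "lift q = \<zero>\<^bsub>E\<^esub>" by (simp only: zero_E) (rule ext)
    then show "q \<in> a_kernel U E lift" using lift_Q_gen(1)[OF q(2,3)] unfolding q(1) a_kernel_def' by blast
  qed
  then have "Q_ideal n \<subseteq> a_kernel U E lift"
    unfolding Q by (intro h.R.genideal_minimal h.kernel_is_ideal)
  then show "\<forall>q\<in>Q_ideal n. lift q = (\<lambda>_. 0)" unfolding a_kernel_def' zero_E by blast
qed

lemma sigma_sum_list: "(\<And>a. a \<in> set D \<Longrightarrow> F a \<in> S_Lie n) \<Longrightarrow> \<sigma> (sum_list (map F D)) m = sum_list (map (\<lambda>a. \<sigma> (F a) m) D)"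
proof (induction D)
  case (Cons a D)
  have "\<sigma> (F a + sum_list (map F D)) m = \<sigma> (F a) m + \<sigma> (sum_list (map F D)) m"
    using Cons.prems by (intro \<sigma>_add S_Lie_sum_list) auto
  also have "\<sigma> (sum_list (map F D)) m = sum_list (map (\<lambda>a. \<sigma> (F a) m) D)"
    using Cons.prems by (intro Cons.IH) auto
  finally show ?case by (simp only: list.map sum_list.Cons)
qed (use sigma_zero[OF S_Lie_zero] in \<open>simp add: zero_fun_def\<close>)

lemma sigma_sum: "(\<And>i. i \<in> K \<Longrightarrow> F i \<in> S_Lie n) \<Longrightarrow> \<sigma> (sum F K) m = (\<Sum>i\<in>K. \<sigma> (F i) m)"
proof (induction K rule: infinite_finite_induct)
  case (insert k K)
  have "\<sigma> (F k + sum F K) m = \<sigma> (F k) m + \<sigma> (sum F K) m"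
    using insert.prems by (intro \<sigma>_add S_Lie_sum) auto
  also have "\<sigma> (sum F K) m = (\<Sum>i\<in>K. \<sigma> (F i) m)"
    using insert.prems by (intro insert.IH) auto
  finally show ?case unfolding sum.insert[OF insert.hyps] .
qed (use sigma_zero[OF S_Lie_zero] in \<open>simp_all add: zero_fun_def\<close>)

lemma act_lie:
  assumes "as \<in> tuples (n - 1) V" "bs \<in> tuples (n - 1) V"
  shows "act as (act bs m) = (\<Sum>i<n - 1. act (bs[i := jacobian_bracket n (as @ [bs ! i])]) m) + act bs (act as m)"
proof -
  have e: "ad n as (bs ! i) = jacobian_bracket n (as @ [bs ! i])" if "i < n - 1" for i
    using tuples_nth[OF assms(2) that] by (simp add: ad_def)
  have i: "ad n (bs[i := jacobian_bracket n (as @ [bs ! i])]) \<in> S_Lie n" if "i < n - 1" for i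
    by (intro ad_in tuples_update assms jac_in_tuples snoc_tuples tuples_nth[OF assms(2) that] n1)
  have "commutator (ad n as) (ad n bs) = (\<Sum>i<n - 1. ad n (bs[i := jacobian_bracket n (as @ [bs ! i])]))"
    unfolding commutator_ad[OF ad_in[OF assms(1)] assms(2) n1] by (intro sum.cong refl) (simp add: e)
  then have "\<sigma> (commutator (ad n as) (ad n bs)) m = (\<Sum>i<n - 1. act (bs[i := jacobian_bracket n (as @ [bs ! i])]) m)"
    using i by (simp only:) (rule sigma_sum, auto)
  then show ?thesis using \<sigma>_br[OF ad_in[OF assms(1)] ad_in[OF assms(2)], of m] by (simp add: algebra_simps)
qed

lemma n_Lie_action:
  assumes quad
  shows "n_Lie_action mfps_scale n V (jacobian_bracket n) scaleM act"
proof (intro n_Lie_action.intro n_Lie_action_axioms.intro n_Lie_algebra_mfps M.vector_space_axioms)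
  show "act (ts @ [jacobian_bracket n hs]) m = (\<Sum>i<n. signed (n - 1 - i) (act (omit i hs) (act (ts @ [hs ! i]) m)))"
    if "ts \<in> tuples (n - 2) V" "hs \<in> tuples n V" for ts hs m
    using assms that by (simp add: quad_def)
  show "act vs (m + m') = act vs m + act vs m'" "act vs (scaleM c m) = scaleM c (act vs m)"
    if "vs \<in> tuples (n - 1) V" for vs c m m'
    by (rule sigma_add_right[OF ad_in[OF that]], rule sigma_scale_right[OF ad_in[OF that]])
  show "act as (act bs m) = (\<Sum>i<n - 1. act (bs[i := jacobian_bracket n (as @ [bs ! i])]) m) + act bs (act as m)"
    if "as \<in> tuples (n - 1) V" "bs \<in> tuples (n - 1) V" for as bs m
    by (rule act_lie[OF that])
qed (use n3 in \<open>auto intro: act.F_add act.F_alt act_scale\<close>)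

lemma sigma_span:
  assumes "X \<in> S_Lie n"
  obtains D where "\<And>a. a \<in> set D \<Longrightarrow> a \<in> tuples (n - 1) V" "X = sum_list (map (ad n) D)"
    "\<And>m. \<sigma> X m = sum_list (map (\<lambda>a. act a m) D)"
proof -
  obtain D where D: "\<And>a. a \<in> set D \<Longrightarrow> a \<in> tuples (n - 1) V" "X = sum_list (map (ad n) D)"
    using S_Lie_span[OF n3 assms] by blast
  show ?thesis by (rule that[OF D]) (auto simp: D(2) intro!: sigma_sum_list ad_in D(1))
qed

text \<open>The invariant subspaces are the same: every derivation is a sum of elements
  \<open>ad\<close>, and words in derivations together with scalars give all of the enveloping
  algebra.\<close>

lemma irreducible_iff:
  "irreducible_under scaleM (lift ` carrier U) \<longleftrightarrow> irreducible_under scaleM (act ` tuples (n - 1) V)"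
proof -
  have "(\<forall>t\<in>lift ` carrier U. \<forall>m\<in>N. t m \<in> N) \<longleftrightarrow> (\<forall>t\<in>act ` tuples (n - 1) V. \<forall>m\<in>N. t m \<in> N)"
    if N: "M.subspace N" for N
  proof
    assume "\<forall>t\<in>lift ` carrier U. \<forall>m\<in>N. t m \<in> N"
    then show "\<forall>t\<in>act ` tuples (n - 1) V. \<forall>m\<in>N. t m \<in> N"
      using U_ad_in by (auto simp: lift_U_ad[symmetric])
  next
    assume inv: "\<forall>t\<in>act ` tuples (n - 1) V. \<forall>m\<in>N. t m \<in> N"
    have "\<sigma> X m \<in> N" if "X \<in> S_Lie n" "m \<in> N" for X m
    proof -
      obtain D where D: "\<And>a. a \<in> set D \<Longrightarrow> a \<in> tuples (n - 1) V" "X = sum_list (map (ad n) D)"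
        "\<And>m. \<sigma> X m = sum_list (map (\<lambda>a. act a m) D)" using sigma_span[OF \<open>X \<in> S_Lie n\<close>] by blast
      show ?thesis unfolding D(3) using D(1)
      proof (induction D)
        case (Cons a D)
        then show ?case using inv \<open>m \<in> N\<close> by (auto intro!: M.subspace_add[OF N])
      qed (simp add: M.subspace_0[OF N])
    qed
    then show "\<forall>t\<in>lift ` carrier U. \<forall>m\<in>N. t m \<in> N"
      using ev_invariant[OF N] unfolding U_carrier by (auto simp: lift_coset)
  qed
  then show ?thesis unfolding irreducible_under_def by blast
qed

lemma lift_in_U_S_irreps:
  "lift \<in> U_S_irreps n scaleM \<longleftrightarrow> irreducible_under scaleM (act ` tuples (n - 1) V) \<and> quad"
  unfolding U_S_irreps_def uea_irreps_killing_def mem_Collect_eq irreducible_iff lift_Q_ideal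
  using lift_extensional lift_hom lift_const by blast

end

text \<open>Compatibility on the elements \<open>ad\<close> passes to sums, hence to all
  derivations, and then to words in them.\<close>

lemma lift_intertwine:
  assumes R: "S_rep scaleM n \<sigma>" and R': "S_rep scaleM n \<tau>" and T: "Vector_Spaces.linear scaleM scaleM T"
    and eq: "\<And>fs m. fs \<in> tuples (n - 1) (mfps_in n) \<Longrightarrow> T (\<sigma> (ad n fs) m) = \<tau> (ad n fs) (T m)"
    and C: "C \<in> carrier (uea (S_Lie n) S_scale commutator)"
  shows "T (lie_rep.lift scaleM (S_Lie n) S_scale commutator \<sigma> C m) = lie_rep.lift scaleM (S_Lie n) S_scale commutator \<tau> C (T m)"
proof -
  interpret R: S_rep scaleM n \<sigma> by (rule R)
  interpret R': S_rep scaleM n \<tau> by (rule R')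
  have "T 0 = 0" using T R.M.scale_zero_left by (metis Vector_Spaces.linear_iff)
  moreover have "T (x + y) = T x + T y" for x y using T by (simp add: Vector_Spaces.linear_iff)
  ultimately have Ts: "T (sum_list (map F A)) = sum_list (map (\<lambda>a. T (F a)) A)" for F and A :: "'a mfps list list"
    by (induction A) auto
  have X: "T (\<sigma> X m) = \<tau> X (T m)" if X: "X \<in> S_Lie n" for X m
  proof -
    obtain A where A: "\<And>a. a \<in> set A \<Longrightarrow> a \<in> tuples (n - 1) (mfps_in n)" "X = sum_list (map (ad n) A)"
      "\<And>m. \<sigma> X m = sum_list (map (\<lambda>a. \<sigma> (ad n a) m) A)" using R.sigma_span[OF X] by blast
    have "\<tau> X (T m) = sum_list (map (\<lambda>a. \<tau> (ad n a) (T m)) A)"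
      unfolding A(2) by (intro R'.sigma_sum_list R'.ad_in A(1))
    also have "\<dots> = sum_list (map (\<lambda>a. T (\<sigma> (ad n a) m)) A)"
      using A(1) eq by (intro arg_cong[of _ _ sum_list] map_cong) auto
    finally show ?thesis unfolding A(3) Ts ..
  qed
  obtain p where p: "C = R.I +>\<^bsub>R.A\<^esub> p" "p \<in> carrier R.A" using C unfolding R.U_carrier by blast
  show ?thesis unfolding p(1) R.lift_coset[OF p(2)] R'.lift_coset[OF p(2)] by (rule R.ev_intertwine[OF T X p(2)])
qed

lemma U_S_irreps_lift:
  fixes scaleM :: "'a::field_char_0 \<Rightarrow> 'm::ab_group_add \<Rightarrow> 'm"
  assumes n: "n \<ge> 3" and M: "vector_space scaleM" and h: "h \<in> U_S_irreps n scaleM"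
  obtains \<sigma> where "S_rep scaleM n \<sigma>" "h = lie_rep.lift scaleM (S_Lie n) S_scale commutator \<sigma>"
proof -
  let ?\<sigma> = "\<lambda>x. h (uea_gen (S_Lie n) S_scale commutator x)"
  have h': "h \<in> extensional (carrier (uea (S_Lie n) S_scale commutator))"
    "h \<in> ring_hom (uea (S_Lie n) S_scale commutator) (endo_ring scaleM)"
    "\<And>c. h (uea_const (S_Lie n) S_scale commutator c) = scaleM c"
    using h unfolding U_S_irreps_def uea_irreps_killing_def mem_Collect_eq by blast+
  note * = lie_rep_of_hom[OF M S_Lie_add S_Lie_scale S_Lie_commutator[OF n] h'(2,3)]
  have r: "lie_rep scaleM (S_Lie n) S_scale commutator ?\<sigma>" by (rule conjunct1[OF *])
  have e: "h (uea_ideal (S_Lie n) S_scale commutator +>\<^bsub>free_algebra (S_Lie n)\<^esub> p) = free_act scaleM ?\<sigma> p"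
    if "p \<in> carrier (free_algebra (S_Lie n))" for p
    using conjunct2[OF *] that by (rule bspec)
  interpret lie_rep scaleM "S_Lie n" S_scale commutator ?\<sigma> by (rule r)
  have "h = lift"
  proof (rule extensionalityI[OF h'(1) lift_extensional])
    fix C assume "C \<in> carrier U"
    then obtain p where p: "C = I +>\<^bsub>A\<^esub> p" "p \<in> carrier A" unfolding U_carrier by blast
    show "h C = lift C" unfolding p(1) lift_coset[OF p(2)] by (rule e[OF p(2)])
  qed
  then show ?thesis using n r by (intro that S_rep.intro S_rep_axioms.intro)
qed

section \<open>The representation of the derivations on an irreducible module\<close>

locale irrep = n_Lie_module mfps_scale n "mfps_in n" "jacobian_bracket n" scaleM B
  for n and scaleM :: "'a::field_char_0 \<Rightarrow> 'm::ab_group_add \<Rightarrow> 'm" and B +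
  assumes n3: "n \<ge> 3" and irr: "irreducible_under scaleM (module_act B ` tuples (n - 1) (mfps_in n))"
begin

abbreviation V where "V \<equiv> mfps_in n :: 'a mfps set"

text \<open>The operator of a derivation, through an arbitrary expression as a sum of elements
  \<open>ad\<close>. That the choice does not matter is where irreducibility is used.\<close>

definition \<sigma> where "\<sigma> X m = sum_list (map (\<lambda>a. act a m)
  (SOME A. set A \<subseteq> tuples (n - 1) V \<and> X = sum_list (map (ad n) A)))"

lemma n1: "n \<ge> 1" using n3 by simp

text \<open>A scalar can be absorbed into the first entry, so sums of tuples without coefficients
  already represent linear combinations.\<close>

lemma scale_head:
  assumes a: "a \<in> tuples (n - 1) V"
  shows "a[0 := mfps_scale c (a ! 0)] \<in> tuples (n - 1) V" "act (a[0 := mfps_scale c (a ! 0)]) m = scaleM c (act a m)"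
    "ad n (a[0 := mfps_scale c (a ! 0)]) = S_scale c (ad n a)"
proof -
  have a0: "a ! 0 \<in> V" using n3 by (intro tuples_nth[OF a]) simp
  show "a[0 := mfps_scale c (a ! 0)] \<in> tuples (n - 1) V" by (intro tuples_update a) (simp add: a0)
  show "act (a[0 := mfps_scale c (a ! 0)]) m = scaleM c (act a m)"
    "ad n (a[0 := mfps_scale c (a ! 0)]) = S_scale c (ad n a)"
    using act_scale[OF a _ a0, of 0 c m] ad_update_scale[OF a, of 0 c "a ! 0"] n3 by simp_all
qed

text \<open>The tuples of \<open>A'\<close>, negated in the first entry, are appended to those of
  \<open>A\<close>. The resulting sum has zero field and therefore acts by zero.\<close>

lemma kernel_eq:
  assumes A: "set A \<subseteq> tuples (n - 1) V" and A': "set A' \<subseteq> tuples (n - 1) V"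
    and eq: "sum_list (map (ad n) A) = sum_list (map (ad n) A')"
  shows "sum_list (map (\<lambda>a. act a m) A) = sum_list (map (\<lambda>a. act a m) A')"
proof -
  define neg where "neg a = a[0 := mfps_scale (- 1) (a ! 0)]" for a :: "'a mfps list"
  have n: "neg a \<in> tuples (n - 1) V" "act (neg a) m = - act a m" "ad n (neg a) = - ad n a" if "a \<in> set A'" for a
    using scale_head(1)[of a "- 1"] scale_head(2)[of a "- 1" m] scale_head(3)[of a "- 1"] that A'
    by (auto simp: neg_def S_scale_minus)
  have m: "sum_list (map (\<lambda>a. - F a) A') = - sum_list (map F A')" for F :: "'a mfps list \<Rightarrow> 'x::ab_group_add"
    by (induction A') auto
  have "sum_list (map (\<lambda>a. act a m) (A @ map neg A')) = 0"
  proof (rule module_kernel_zero[OF n3 n_Lie_module_axioms irr])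
    show "a \<in> tuples (n - 1) V" if "a \<in> set (A @ map neg A')" for a using that A n(1) by auto
    fix g :: "'a mfps" assume g: "g \<in> V"
    have e: "jacobian_bracket n (a @ [g]) = ad n a g" for a using g by (simp add: ad_def)
    have "sum_list (map (ad n) (A @ map neg A')) = sum_list (map (ad n) A) + sum_list (map (\<lambda>a. - ad n a) A')"
      using n(3) by (simp add: o_def cong: map_cong)
    also have "\<dots> = 0" unfolding m eq by simp
    finally show "sum_list (map (\<lambda>a. jacobian_bracket n (a @ [g])) (A @ map neg A')) = 0"
      unfolding e sum_list_apply[symmetric] by simp
  qed
  then show ?thesis using n(2) m[of "\<lambda>a. act a m"] by (simp add: o_def cong: map_cong)
qed

lemma span:
  assumes "X \<in> S_Lie n" obtains A where "set A \<subseteq> tuples (n - 1) V" "X = sum_list (map (ad n) A)"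
proof -
  obtain A where A: "\<And>a. a \<in> set A \<Longrightarrow> a \<in> tuples (n - 1) V" "X = sum_list (map (ad n) A)"
    by (rule S_Lie_span[OF n3 assms]) blast
  show ?thesis by (rule that[OF subsetI[OF A(1)] A(2)])
qed

lemma sigma_sum_ad:
  assumes "set A \<subseteq> tuples (n - 1) V"
  shows "\<sigma> (sum_list (map (ad n) A)) m = sum_list (map (\<lambda>a. act a m) A)"
proof -
  let ?P = "\<lambda>A'. set A' \<subseteq> tuples (n - 1) V \<and> sum_list (map (ad n) A) = sum_list (map (ad n) A')"
  have P: "?P (SOME A'. ?P A')" by (rule someI[of ?P A], rule conjI[OF assms refl])
  show ?thesis unfolding \<sigma>_def
    by (rule kernel_eq[symmetric, OF assms conjunct1[OF P] conjunct2[OF P]])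
qed

lemma sigma_ad: "fs \<in> tuples (n - 1) V \<Longrightarrow> \<sigma> (ad n fs) m = act fs m"
  using sigma_sum_ad[of "[fs]" m] by simp

lemma sigma_add:
  assumes "X \<in> S_Lie n" "Y \<in> S_Lie n" shows "\<sigma> (X + Y) m = \<sigma> X m + \<sigma> Y m"
proof -
  obtain A where A: "set A \<subseteq> tuples (n - 1) V" "X = sum_list (map (ad n) A)" using span[OF assms(1)] by blast
  obtain A' where A': "set A' \<subseteq> tuples (n - 1) V" "Y = sum_list (map (ad n) A')" using span[OF assms(2)] by blast
  have AA: "set (A @ A') \<subseteq> tuples (n - 1) V" using A(1) A'(1) by simp
  have "X + Y = sum_list (map (ad n) (A @ A'))" unfolding A(2) A'(2) map_append sum_list_append ..
  then have "\<sigma> (X + Y) m = sum_list (map (\<lambda>a. act a m) (A @ A'))" by (simp only: sigma_sum_ad[OF AA])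
  also have "\<dots> = \<sigma> X m + \<sigma> Y m"
    by (simp only: map_append sum_list_append A(2) A'(2) sigma_sum_ad[OF A(1)] sigma_sum_ad[OF A'(1)])
  finally show ?thesis .
qed

lemma sigma_scale:
  assumes "X \<in> S_Lie n" shows "\<sigma> (S_scale c X) m = scaleM c (\<sigma> X m)"
proof -
  obtain A where A: "set A \<subseteq> tuples (n - 1) V" "X = sum_list (map (ad n) A)" using span[OF assms(1)] by blast
  let ?s = "\<lambda>a. a[0 := mfps_scale c (a ! 0)]"
  have s: "set (map ?s A) \<subseteq> tuples (n - 1) V" using A(1) scale_head(1) by auto
  have "S_scale c (Y + Z) = S_scale c Y + S_scale c Z" "S_scale c 0 = 0" for Y Z :: "'a mfps \<Rightarrow> 'a mfps"
    by (auto simp: S_scale_def fun_eq_iff intro!: mfps_eqI simp: mfps_scale.rep_eq plus_mfps.rep_eq zero_mfps.rep_eq algebra_simps)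
  then have "S_scale c X = sum_list (map (\<lambda>a. S_scale c (ad n a)) A)"
    unfolding A(2) by (induction A) (auto simp: zero_fun_def)
  also have "\<dots> = sum_list (map (ad n) (map ?s A))"
    using A(1) scale_head(3) by (simp add: o_def subset_iff cong: map_cong)
  finally have "\<sigma> (S_scale c X) m = sum_list (map (\<lambda>a. act a m) (map ?s A))"
    using sigma_sum_ad[OF s, of m] by simp
  also have "\<dots> = sum_list (map (\<lambda>a. scaleM c (act a m)) A)"
    using A(1) scale_head(2) by (simp add: o_def subset_iff cong: map_cong)
  also have "\<dots> = scaleM c (sum_list (map (\<lambda>a. act a m) A))"
    by (induction A) (auto simp: M.scale_right_distrib)
  finally show ?thesis unfolding A(2) sigma_sum_ad[OF A(1)] .
qed

lemma sigma_right:
  assumes "X \<in> S_Lie n"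
  shows "\<sigma> X (m + m') = \<sigma> X m + \<sigma> X m'" "\<sigma> X (scaleM c m) = scaleM c (\<sigma> X m)"
proof -
  obtain A where A: "set A \<subseteq> tuples (n - 1) V" "X = sum_list (map (ad n) A)" using span[OF assms(1)] by blast
  show "\<sigma> X (m + m') = \<sigma> X m + \<sigma> X m'" unfolding A(2) sigma_sum_ad[OF A(1)] using A(1)
    by (induction A) (auto simp: act_add_right[OF _ n1])
  show "\<sigma> X (scaleM c m) = scaleM c (\<sigma> X m)" unfolding A(2) sigma_sum_ad[OF A(1)] using A(1)
    by (induction A) (auto simp: act_scale_right[OF _ n1] M.scale_right_distrib)
qed

lemma sigma_sum_list: "(\<And>a. a \<in> set A \<Longrightarrow> F a \<in> S_Lie n) \<Longrightarrow> \<sigma> (sum_list (map F A)) m = sum_list (map (\<lambda>a. \<sigma> (F a) m) A)"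
proof (induction A)
  case Nil
  show ?case using sigma_sum_ad[of "[]" m] by (simp only: list.map sum_list.Nil list.set empty_subsetI)
next
  case (Cons a A)
  have "\<sigma> (F a + sum_list (map F A)) m = \<sigma> (F a) m + \<sigma> (sum_list (map F A)) m"
    using Cons.prems by (intro sigma_add S_Lie_sum_list) auto
  also have "\<sigma> (sum_list (map F A)) m = sum_list (map (\<lambda>a. \<sigma> (F a) m) A)"
    using Cons.prems by (intro Cons.IH) auto
  finally show ?case by (simp only: list.map sum_list.Cons)
qed

lemma sigma_sum: "(\<And>i. i < (k::nat) \<Longrightarrow> F i \<in> S_Lie n) \<Longrightarrow> \<sigma> (\<Sum>i<k. F i) m = (\<Sum>i<k. \<sigma> (F i) m)"
  using sigma_sum_list[of "[0..<k]" F m] by (simp add: sum_list_distinct_conv_sum_set lessThan_atLeast0)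

lemma br_closed: "xs \<in> tuples n V \<Longrightarrow> jacobian_bracket n xs \<in> V"
  by (rule jac_in_tuples)

lemma sigma_commutator_right:
  assumes X: "X \<in> S_Lie n" and Y: "Y \<in> S_Lie n"
    and ad: "\<And>b m. b \<in> tuples (n - 1) V \<Longrightarrow> \<sigma> (commutator X (ad n b)) m = \<sigma> X (act b m) - act b (\<sigma> X m)"
  shows "\<sigma> (commutator X Y) m = \<sigma> X (\<sigma> Y m) - \<sigma> Y (\<sigma> X m)"
proof -
  obtain A where A: "set A \<subseteq> tuples (n - 1) V" "Y = sum_list (map (ad n) A)" using span[OF Y] by blast
  have i: "ad n a \<in> S_Lie n" if "a \<in> set A" for a using A(1) that n1 by (intro ad_S_Lie) auto
  have "commutator X Y = sum_list (map (\<lambda>a. commutator X (ad n a)) A)"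
    unfolding A(2) by (rule commutator_sum_list_right[OF X i])
  then have "\<sigma> (commutator X Y) m = sum_list (map (\<lambda>a. \<sigma> (commutator X (ad n a)) m) A)"
    using S_Lie_commutator[OF n3 X i] by (simp only:) (rule sigma_sum_list)
  also have "\<dots> = sum_list (map (\<lambda>a. \<sigma> X (act a m) - act a (\<sigma> X m)) A)"
    using A(1) ad by (intro arg_cong[of _ _ sum_list] map_cong) auto
  also have "\<dots> = sum_list (map (\<lambda>a. \<sigma> X (act a m)) A) - sum_list (map (\<lambda>a. act a (\<sigma> X m)) A)"
    by (rule sum_list_subtractf)
  also have "sum_list (map (\<lambda>a. \<sigma> X (act a m)) A) = \<sigma> X (sum_list (map (\<lambda>a. act a m) A))"
    using sigma_right(1)[OF X] sigma_right(1)[OF X, of 0 0] by (induction A) auto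
  finally show ?thesis unfolding A(2) sigma_sum_ad[OF A(1)] .
qed

text \<open>Reduction to inner derivations on both sides: \<open>sigma_commutator_right\<close>
  reduces the second argument; antisymmetry of the commutator then lets it reduce the other one as
  well. For two inner derivations the claim is the Lie identity of the action.\<close>

lemma sigma_commutator:
  assumes X: "X \<in> S_Lie n" and Y: "Y \<in> S_Lie n"
  shows "\<sigma> (commutator X Y) m = \<sigma> X (\<sigma> Y m) - \<sigma> Y (\<sigma> X m)"
proof (rule sigma_commutator_right[OF X Y])
  fix b m assume b: "b \<in> tuples (n - 1) V"
  note bi = ad_S_Lie[OF b n1]
  have "\<sigma> (commutator (ad n b) X) m = \<sigma> (ad n b) (\<sigma> X m) - \<sigma> X (\<sigma> (ad n b) m)"
  proof (rule sigma_commutator_right[OF bi X])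
    fix a m assume a: "a \<in> tuples (n - 1) V"
    have e: "ad n b (a ! i) = jacobian_bracket n (b @ [a ! i])" if "i < n - 1" for i
      using tuples_nth[OF a that] by (simp add: ad_def)
    have t: "a[i := jacobian_bracket n (b @ [a ! i])] \<in> tuples (n - 1) V" if "i < n - 1" for i
      by (intro tuples_update a jac_in_tuples snoc_tuples b tuples_nth[OF a that] n1)
    have "commutator (ad n b) (ad n a) = (\<Sum>i<n - 1. ad n (a[i := jacobian_bracket n (b @ [a ! i])]))"
      unfolding commutator_ad[OF bi a n1] by (intro sum.cong refl) (simp add: e)
    then have "\<sigma> (commutator (ad n b) (ad n a)) m = (\<Sum>i<n - 1. \<sigma> (ad n (a[i := jacobian_bracket n (b @ [a ! i])])) m)"
      using ad_S_Lie[OF t n1] by (simp only:) (rule sigma_sum)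
    also have "\<dots> = (\<Sum>i<n - 1. act (a[i := jacobian_bracket n (b @ [a ! i])]) m)"
      by (intro sum.cong refl sigma_ad t) simp
    finally show "\<sigma> (commutator (ad n b) (ad n a)) m = \<sigma> (ad n b) (act a m) - act a (\<sigma> (ad n b) m)"
      using act_lie[OF b a n1 br_closed, of m] by (simp add: sigma_ad[OF b])
  qed
  moreover have "commutator X (ad n b) = S_scale (- 1) (commutator (ad n b) X)"
    unfolding S_scale_minus by (simp add: commutator_def fun_eq_iff)
  ultimately show "\<sigma> (commutator X (ad n b)) m = \<sigma> X (act b m) - act b (\<sigma> X m)"
    using sigma_scale[OF S_Lie_commutator[OF n3 bi X], of "- 1" m] by (simp add: sigma_ad[OF b])
qed

sublocale R: S_rep scaleM n \<sigma>
proof (intro S_rep.intro lie_rep.intro M.vector_space_axioms lie_rep_axioms.intro S_rep_axioms.intro n3)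
  show "Vector_Spaces.linear scaleM scaleM (\<sigma> X)" if "X \<in> S_Lie n" for X
    unfolding linear_iff'[OF M.vector_space_axioms] using sigma_right[OF that] by blast
qed (auto intro: S_Lie_add S_Lie_scale S_Lie_commutator[OF n3] sigma_add sigma_scale sigma_commutator)

lemma lift_U_ad: "fs \<in> tuples (n - 1) V \<Longrightarrow> R.lift (U_ad n fs) m = act fs m"
  by (simp only: R.lift_U_ad sigma_ad)

lemma lift_in_irreps: "R.lift \<in> U_S_irreps n scaleM"
  unfolding R.lift_in_U_S_irreps
proof
  have "R.act ` tuples (n - 1) V = act ` tuples (n - 1) V"
    by (intro image_cong refl ext sigma_ad)
  then show "irreducible_under scaleM (R.act ` tuples (n - 1) V)" using irr by simp
  show "R.quad" unfolding R.quad_def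
  proof (intro ballI allI)
    fix hs ts m assume hs: "hs \<in> tuples n V" and ts: "ts \<in> tuples (n - 2) V"
    have t: "ts @ [x] \<in> tuples (n - 1) V" if "x \<in> V" for x using ts that n3 by (auto simp: tuples_def)
    have "(\<Sum>i<n. signed (n - 1 - i) (R.act (omit i hs) (R.act (ts @ [hs ! i]) m)))
      = (\<Sum>i<n. signed (n - 1 - i) (act (omit i hs) (act (ts @ [hs ! i]) m)))"
    proof (rule sum.cong[OF refl])
      fix i assume "i \<in> {..<n}"
      then have i: "i < n" by simp
      show "signed (n - 1 - i) (R.act (omit i hs) (R.act (ts @ [hs ! i]) m)) = signed (n - 1 - i) (act (omit i hs) (act (ts @ [hs ! i]) m))"
        by (simp only: sigma_ad[OF omit_in_tuples[OF hs i]] sigma_ad[OF t[OF tuples_nth[OF hs i]]])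
    qed
    then show "R.act (ts @ [jacobian_bracket n hs]) m = (\<Sum>i<n. signed (n - 1 - i) (R.act (omit i hs) (R.act (ts @ [hs ! i]) m)))"
      using act_quad[OF ts hs _ br_closed, of m] n3 unfolding sigma_ad[OF t[OF jac_in_tuples[OF hs]]] by simp
  qed
qed

end

lemma irrep_iff:
  fixes scaleM :: "'a::field_char_0 \<Rightarrow> 'm::ab_group_add \<Rightarrow> 'm"
  assumes "n \<ge> 3"
  shows "B \<in> S_nLie_irreps n scaleM \<longleftrightarrow> B \<in> extensional (tuples n (mfps_in n \<times> UNIV)) \<and> irrep n scaleM B"
  using assms by (auto simp: S_nLie_irreps_def n_Lie_irreps_def irrep_def irrep_axioms_def)

text \<open>The bijection relates structures on one and the same vector space and is characterised
  by its values on the elements \<open>ad\<close>. Since it preserves and reflects isomorphism, it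
  also gives a bijection of isomorphism classes.\<close>

theorem theorem4:
  fixes n :: nat
    and scaleM :: "'a::field_char_0 \<Rightarrow> 'm::ab_group_add \<Rightarrow> 'm"
  assumes "n \<ge> 3" and "vector_space scaleM"
  shows "\<exists>\<Phi>. bij_betw \<Phi> (S_nLie_irreps n scaleM) (U_S_irreps n scaleM) \<and>
    (\<forall>B\<in>S_nLie_irreps n scaleM. \<forall>fs\<in>tuples (n - 1) (mfps_in n). \<forall>m.
       \<Phi> B (U_ad n fs) m = module_act B fs m) \<and>
    (\<forall>B\<in>S_nLie_irreps n scaleM. \<forall>B'\<in>S_nLie_irreps n scaleM.
       n_Lie_module_iso scaleM n (mfps_in n) B B' \<longleftrightarrow>
       uea_module_iso (S_Lie n) S_scale commutator scaleM (\<Phi> B) (\<Phi> B'))"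
proof -
  define \<Phi> where "\<Phi> B = lie_rep.lift scaleM (S_Lie n) S_scale commutator (irrep.\<sigma> n B)" for B
  have irr: "irrep n scaleM B" "B \<in> extensional (tuples n (mfps_in n \<times> UNIV))" if "B \<in> S_nLie_irreps n scaleM" for B
    using that irrep_iff[OF assms(1)] by auto
  have rep: "S_rep scaleM n (irrep.\<sigma> n B)" if "B \<in> S_nLie_irreps n scaleM" for B
  proof -
    interpret irrep n scaleM B by (rule irr(1)[OF that])
    show ?thesis by (rule R.S_rep_axioms)
  qed
  have sigma: "irrep.\<sigma> n B (ad n fs) m = module_act B fs m"
    if "B \<in> S_nLie_irreps n scaleM" "fs \<in> tuples (n - 1) (mfps_in n)" for B fs m
  proof -
    interpret irrep n scaleM B by (rule irr(1)[OF that(1)])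
    show ?thesis by (rule sigma_ad[OF that(2)])
  qed
  have U_ad: "\<Phi> B (U_ad n fs) m = module_act B fs m"
    if "B \<in> S_nLie_irreps n scaleM" "fs \<in> tuples (n - 1) (mfps_in n)" for B fs m
  proof -
    interpret irrep n scaleM B by (rule irr(1)[OF that(1)])
    show ?thesis unfolding \<Phi>_def by (rule lift_U_ad[OF that(2)])
  qed
  have inj: "inj_on \<Phi> (S_nLie_irreps n scaleM)"
  proof (rule inj_onI)
    fix B B' assume B: "B \<in> S_nLie_irreps n scaleM" and B': "B' \<in> S_nLie_irreps n scaleM" and eq: "\<Phi> B = \<Phi> B'"
    interpret B: irrep n scaleM B by (rule irr(1)[OF B])
    interpret B': irrep n scaleM B' by (rule irr(1)[OF B'])
    have act: "module_act B vs m = module_act B' vs m" if "vs \<in> tuples (n - 1) (mfps_in n)" for vs m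
      using U_ad[OF B that, of m] U_ad[OF B' that, of m] eq by simp
    show "B = B'"
      by (rule extensionalityI[OF irr(2)[OF B] irr(2)[OF B']],
          rule n_Lie_module_unique[OF B.n_Lie_module_axioms B'.n_Lie_module_axioms B.n1 act])
  qed
  \<comment> \<open>The representation comes from operators of derivations, the relations in
    \<open>Q_ideal n\<close> make these an action of tuples, and this action defines a
    module.\<close>
  have surj: "\<exists>B\<in>S_nLie_irreps n scaleM. \<Phi> B = h" if h: "h \<in> U_S_irreps n scaleM" for h
  proof -
    obtain \<tau> where \<tau>: "S_rep scaleM n \<tau>" "h = lie_rep.lift scaleM (S_Lie n) S_scale commutator \<tau>"
      by (rule U_S_irreps_lift[OF assms h]) (rule that)
    interpret R: S_rep scaleM n \<tau> by (rule \<tau>(1))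
    have q: "irreducible_under scaleM (R.act ` tuples (n - 1) R.V)" "R.quad"
      using iffD1[OF R.lift_in_U_S_irreps h[unfolded \<tau>(2)]] by (rule conjunct1, rule conjunct2)
    interpret N: n_Lie_action mfps_scale n R.V "jacobian_bracket n" scaleM R.act by (rule R.n_Lie_action[OF q(2)])
    have "module_act N.B ` tuples (n - 1) R.V = R.act ` tuples (n - 1) R.V"
      by (intro image_cong refl ext N.module_act_B)
    then have "irreducible_under scaleM (module_act N.B ` tuples (n - 1) R.V)"
      using q(1) by (rule ssubst)
    then have "irrep n scaleM N.B"
      by (intro irrep.intro irrep_axioms.intro N.module assms(1))
    moreover have "N.B \<in> extensional (tuples n (R.V \<times> UNIV))"
      unfolding N.B_def by (rule restrict_extensional)
    ultimately have B: "N.B \<in> S_nLie_irreps n scaleM"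
      unfolding irrep_iff[OF assms(1)] by (rule conjI[rotated])
    \<comment> \<open>The identity map intertwines the original representation with the one built
      from the module, since both agree on the elements \<open>ad\<close>; so the two
      coincide.\<close>
    have id: "Vector_Spaces.linear scaleM scaleM (\<lambda>x. x)"
      by (simp add: linear_iff'[OF assms(2)])
    interpret B: irrep n scaleM N.B by (rule irr(1)[OF B])
    have "\<Phi> N.B = h"
    proof (rule extensionalityI)
      show "\<Phi> N.B \<in> extensional (carrier R.U)" unfolding \<Phi>_def by (rule B.R.lift_extensional)
      show "h \<in> extensional (carrier R.U)" unfolding \<tau>(2) by (rule R.lift_extensional)
      fix C assume C: "C \<in> carrier R.U"
      show "\<Phi> N.B C = h C"
        unfolding \<Phi>_def \<tau>(2)
        by (rule ext, rule lift_intertwine[OF rep[OF B] \<tau>(1) id _ C]) (simp only: sigma[OF B] N.module_act_B)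
    qed
    with B show ?thesis by blast
  qed
  have "\<Phi> ` S_nLie_irreps n scaleM = U_S_irreps n scaleM"
  proof (intro equalityI subsetI)
    fix h assume "h \<in> \<Phi> ` S_nLie_irreps n scaleM"
    then obtain B where B: "B \<in> S_nLie_irreps n scaleM" "h = \<Phi> B" by blast
    interpret irrep n scaleM B by (rule irr(1)[OF B(1)])
    show "h \<in> U_S_irreps n scaleM" unfolding B(2) \<Phi>_def by (rule lift_in_irreps)
  qed (use surj in blast)
  then have bij: "bij_betw \<Phi> (S_nLie_irreps n scaleM) (U_S_irreps n scaleM)"
    using inj by (simp add: bij_betw_def)
  have "n_Lie_module_iso scaleM n (mfps_in n) B B' \<longleftrightarrow>
       uea_module_iso (S_Lie n) S_scale commutator scaleM (\<Phi> B) (\<Phi> B')"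
    if B: "B \<in> S_nLie_irreps n scaleM" and B': "B' \<in> S_nLie_irreps n scaleM" for B B'
  proof
    assume "n_Lie_module_iso scaleM n (mfps_in n) B B'"
    then obtain T where T: "Vector_Spaces.linear scaleM scaleM T" "bij T"
      "\<And>vs m. vs \<in> tuples (n - 1) (mfps_in n) \<Longrightarrow> T (module_act B vs m) = module_act B' vs (T m)"
      unfolding n_Lie_module_iso_def by blast
    have "T (\<Phi> B u m) = \<Phi> B' u (T m)" if "u \<in> carrier (uea (S_Lie n) S_scale commutator)" for u m
      unfolding \<Phi>_def by (rule lift_intertwine[OF rep[OF B] rep[OF B'] T(1) _ that]) (simp only: sigma[OF B] sigma[OF B'] T(3))
    then show "uea_module_iso (S_Lie n) S_scale commutator scaleM (\<Phi> B) (\<Phi> B')"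
      unfolding uea_module_iso_def using T by blast
  next
    interpret R: S_rep scaleM n "irrep.\<sigma> n B" by (rule rep[OF B])
    assume "uea_module_iso (S_Lie n) S_scale commutator scaleM (\<Phi> B) (\<Phi> B')"
    then obtain T where T: "Vector_Spaces.linear scaleM scaleM T" "bij T"
      "\<And>u m. u \<in> carrier R.U \<Longrightarrow> T (\<Phi> B u m) = \<Phi> B' u (T m)"
      unfolding uea_module_iso_def by blast
    have "T (module_act B vs m) = module_act B' vs (T m)" if vs: "vs \<in> tuples (n - 1) (mfps_in n)" for vs m
      using T(3)[OF R.U_ad_in[OF vs], of m] by (simp only: U_ad[OF B vs] U_ad[OF B' vs])
    then show "n_Lie_module_iso scaleM n (mfps_in n) B B'"
      unfolding n_Lie_module_iso_def using T(1,2) by blast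
  qed
  with bij U_ad show ?thesis by (intro exI[of _ \<Phi>] conjI ballI allI)
qed

end
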